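(* Let $n\geq1$, $\sigma\geq 1$, $\alpha\in[0,1/3)$, $s\geq 0$, $\kappa\in[0,1]$, and let $w_0\in H^s\cap L^{1,\kappa}$ (with values in $\mathbb{C}^3$). Let $w$ be the solution of $$w_t-B_0(-\Delta)^{\sigma/2}w-B_1(-\Delta)^{\sigma\alpha}w=0\quad (x\in\mathbb{R}^n,\ t>0),\qquad w(0,x)=w_0(x),$$ and let $S_{\mathrm{int}}$, $S_{\mathrm{ext}}$ be the profiles built from $w_0$ defined in the context. Then, for all $t\ge0$ and all $s_0\geq 0$, $\ell\geq0$ with $0\leq s_0+\ell-(\sigma-2\sigma\alpha)\leq s$, $$\|(w-S_{\mathrm{int}}-S_{\mathrm{ext}})(t,\cdot)\|_{\dot H^{s_0}}\lesssim (1+t)^{-\frac{n+2(s_0+\kappa)}{2(2\sigma-2\sigma\alpha)}-\frac{1-2\alpha}{2(1-\alpha)}}\|w_0\|_{L^{1,\kappa}}+(1+t)^{-\frac{\ell}{2\sigma(1-3\alpha)}}\|w_0\|_{H^{s_0+\ell-(\sigma-2\sigma\alpha)}}+(1+t)^{-\frac{n+2s_0}{2(2\sigma-2\sigma\alpha)}-\frac{1-2\alpha}{2(1-\alpha)}}|P_{w_0}|,$$ where the implicit constant is independent of $t$ and $w_0$.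
   Context: The coefficient matrices are $$B_0=\begin{pmatrix} i&0&0\\0&-i&0\\0&0&0\end{pmatrix},\qquad B_1=\begin{pmatrix}0&0&1\\0&0&1\\-\frac12&-\frac12&-1\end{pmatrix}.$$ $(-\Delta)^{\nu}$ is the Fourier multiplier with symbol $|\xi|^{2\nu}$ (the identity if $\nu=0$); solutions are understood through the Fourier transform in $x$, i.e. $\hat w_t=(B_0|\xi|^\sigma+B_1|\xi|^{2\sigma\alpha})\hat w$, $\hat w(0,\xi)=\hat w_0(\xi)$. Spaces: $H^s$, $\dot H^s$ are the Bessel and Riesz potential spaces on $\mathbb{R}^n$ based on $L^2$; $\|f\|_{L^{1,\kappa}}=\int_{\mathbb{R}^n}(1+|x|)^\kappa|f(x)|\,dx$; $P_f=\int_{\mathbb{R}^n}f(x)\,dx$. Cut-offs: $\chi_{\mathrm{int}},\chi_{\mathrm{mid}},\chi_{\mathrm{ext}}\in\mathcal{C}^\infty$ have supports in $\{|\xi|\le\varepsilon\}$, $\{\varepsilon/2\le|\xi|\le 2N\}$, $\{|\xi|\ge N\}$ respectively, with $\chi_{\mathrm{int}}+\chi_{\mathrm{mid}}+\chi_{\mathrm{ext}}=1$, where $\varepsilon\ll1$ and $N\gg1$ are fixed ($\varepsilon$ sufficiently small, $N$ sufficiently large; in particular the matrices $I+N_2$, respectively $I+N_4$, $I+N_5$, below are invertible on the relevant supports). Matrices ($I$ is the $3\times3$ identity): $$N_1=\begin{pmatrix}-1&\frac{i\sqrt3-1}{2}&\frac{-i\sqrt3-1}{2}\\1&\frac{i\sqrt3-1}{2}&\frac{-i\sqrt3-1}{2}\\0&1&1\end{pmatrix},\qquad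 N_2(|\xi|)=|\xi|^{\sigma-2\sigma\alpha}\begin{pmatrix}0&-\frac{\sqrt3+i}{1+i\sqrt3}&\frac{-\sqrt3+i}{-1+i\sqrt3}\\-\frac{2\sqrt3}{3(1+i\sqrt3)}&0&0\\\frac{2\sqrt3}{3(1-i\sqrt3)}&0&0\end{pmatrix},$$ $$N_4(|\xi|)=|\xi|^{2\sigma\alpha-\sigma}\begin{pmatrix}0&0&i\\0&0&-i\\\frac i2&-\frac i2&0\end{pmatrix},\qquad N_5(|\xi|)=|\xi|^{4\sigma\alpha-2\sigma}\begin{pmatrix}0&\frac14&-1\\\frac14&0&-1\\-\frac12&-\frac12&0\end{pmatrix}.$$ First reference system: $\widetilde w$ solves $\widetilde w_t+\widetilde B_0(-\Delta)^{\sigma\alpha}\widetilde w+\widetilde B_1(-\Delta)^{\sigma-\sigma\alpha}\widetilde w=0$ with $\widetilde B_0=\mathrm{diag}(0,\frac12+i\frac{\sqrt3}2,\frac12-i\frac{\sqrt3}2)$, $\widetilde B_1=\mathrm{diag}(1,-\frac12+i\frac{\sqrt3}6,-\frac12-i\frac{\sqrt3}6)$ and initial data whose Fourier transform is $(I+N_2(|\xi|))^{-1}N_1^{-1}\hat w_0(\xi)$. Thus its Fourier transform is $\mathrm{diag}(e^{\tilde\lambda_j(|\xi|)t})_{j=1}^3(I+N_2(|\xi|))^{-1}N_1^{-1}\hat w_0(\xi)$, where $\tilde\lambda_1=-|\xi|^{2\sigma-2\sigma\alpha}$, $\tilde\lambda_2=-(\frac12+i\frac{\sqrt3}2)|\xi|^{2\sigma\alpha}+(\frac12-i\frac{\sqrt3}6)|\xi|^{2\sigma-2\sigma\alpha}$,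 $\tilde\lambda_3=-(\frac12-i\frac{\sqrt3}2)|\xi|^{2\sigma\alpha}+(\frac12+i\frac{\sqrt3}6)|\xi|^{2\sigma-2\sigma\alpha}$. Second reference system: $\overline w$ solves $\overline w_t+\overline B_0(-\Delta)^{\sigma/2}\overline w+\overline B_1(-\Delta)^{\sigma\alpha}\overline w+\overline B_2(-\Delta)^{2\sigma\alpha-\sigma/2}\overline w+\overline B_3(-\Delta)^{3\sigma\alpha-\sigma}\overline w=0$ with $\overline B_0=\mathrm{diag}(-i,i,0)$, $\overline B_1=\mathrm{diag}(0,0,1)$, $\overline B_2=\mathrm{diag}(-\frac i2,\frac i2,0)$, $\overline B_3=\mathrm{diag}(\frac12,\frac12,-1)$ and initial data whose Fourier transform is $(I+N_5(|\xi|))^{-1}(I+N_4(|\xi|))^{-1}\hat w_0(\xi)$. Thus its Fourier transform is $\mathrm{diag}(e^{\bar\lambda_j(|\xi|)t})_{j=1}^3(I+N_5(|\xi|))^{-1}(I+N_4(|\xi|))^{-1}\hat w_0(\xi)$, where $\bar\lambda_1=i|\xi|^\sigma+\frac i2|\xi|^{4\sigma\alpha-\sigma}-\frac12|\xi|^{6\sigma\alpha-2\sigma}$, $\bar\lambda_2=-i|\xi|^\sigma-\frac i2|\xi|^{4\sigma\alpha-\sigma}-\frac12|\xi|^{6\sigma\alpha-2\sigma}$, $\bar\lambda_3=-|\xi|^{2\sigma\alpha}+|\xi|^{6\sigma\alpha-2\sigma}$. Profiles (defined through their Fourier transforms in $x$): $$\widehat{S_{\mathrm{int}}}(t,\xi)=\chi_{\mathrm{int}}(\xi)N_1(I+N_2(|\xi|))\,\widehat{\widetilde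 w}(t,\xi),\qquad \widehat{S_{\mathrm{ext}}}(t,\xi)=\chi_{\mathrm{ext}}(\xi)(I+N_4(|\xi|))(I+N_5(|\xi|))\,\widehat{\overline w}(t,\xi).$$ *)

theory Defs
  imports "HOL-Analysis.Analysis"
begin

section \<open>Square-integrable fields and the Fourier transform on L2\<close>

text \<open>The space variable ranges over \<^typ>\<open>real ^ 'n\<close>, so the dimension is \<^term>\<open>CARD('n)\<close>;
  functions have values in \<^typ>\<open>complex ^ 3\<close>, whose \<^const>\<open>norm\<close> is the Euclidean one.\<close>

definition square_integrable :: "(real ^ 'n \<Rightarrow> complex ^ 3) \<Rightarrow> bool" where
  "square_integrable f \<longleftrightarrow>
     f \<in> borel_measurable lebesgue \<and> integrable lebesgue (\<lambda>x. (norm (f x))\<^sup>2)"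

definition L2norm :: "(real ^ 'n \<Rightarrow> complex ^ 3) \<Rightarrow> real" where
  "L2norm f = sqrt (LINT x|lebesgue. (norm (f x))\<^sup>2)"

definition fourier_integral :: "(real ^ 'n \<Rightarrow> complex ^ 3) \<Rightarrow> real ^ 'n \<Rightarrow> complex ^ 3" where
  "fourier_integral f \<xi> =
     (2 * pi) powr (- (real CARD('n) / 2)) *\<^sub>R (LINT x|lebesgue. cis (- (x \<bullet> \<xi>)) *s f x)"

text \<open>\<open>g\<close> is (a representative of) the Fourier transform of the L2 function \<open>f\<close>: the limit in L2,
  as \<open>R\<close> tends to infinity, of the Fourier integrals of \<open>f\<close> truncated to the ball of radius \<open>R\<close>
  (for \<open>f\<close> in L1 and L2 it agrees a.e. with the Fourier integral of \<open>f\<close>).  The nonnegative integral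
  is used because a Bochner integral would be 0 for a difference that is not square integrable.\<close>

definition has_fourier ::
  "(real ^ 'n \<Rightarrow> complex ^ 3) \<Rightarrow> (real ^ 'n \<Rightarrow> complex ^ 3) \<Rightarrow> bool" where
  "has_fourier f g \<longleftrightarrow> square_integrable f \<and> square_integrable g \<and>
     ((\<lambda>R. \<integral>\<^sup>+ \<xi>. ennreal ((norm (fourier_integral
               (\<lambda>x. indicator (cball 0 R) x *\<^sub>R f x) \<xi> - g \<xi>))\<^sup>2) \<partial>lebesgue) \<longlongrightarrow> 0) at_top"

text \<open>The Fourier transform of an L2 function is determined up to null sets; this selects a
  representative.\<close>

definition fourier :: "(real ^ 'n \<Rightarrow> complex ^ 3) \<Rightarrow> real ^ 'n \<Rightarrow> complex ^ 3" where
  "fourier f = (SOME g. has_fourier f g)"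


section \<open>Function spaces\<close>

text \<open>The symbol \<open>|\<xi>|\<^sup>a\<close>, with \<open>|\<xi>|\<^sup>0 = 1\<close> also at the origin (whereas \<open>0 powr 0 = 0\<close>).  In particular
  \<open>abs_pow (2 * \<nu>)\<close> is the symbol of \<open>(-\<Delta>)\<^sup>\<nu>\<close>.\<close>

definition abs_pow :: "real \<Rightarrow> real ^ 'n \<Rightarrow> real" where
  "abs_pow a \<xi> = (if a = 0 then 1 else norm \<xi> powr a)"

text \<open>Bessel potential spaces of order \<open>s \<ge> 0\<close>, which consist of L2 functions.\<close>

definition bessel_space :: "real \<Rightarrow> (real ^ 'n \<Rightarrow> complex ^ 3) \<Rightarrow> bool" where
  "bessel_space s f \<longleftrightarrow>
     (\<exists>g. has_fourier f g \<and> square_integrable (\<lambda>\<xi>. (1 + (norm \<xi>)\<^sup>2) powr (s / 2) *\<^sub>R g \<xi>))"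

definition bessel_norm :: "real \<Rightarrow> (real ^ 'n \<Rightarrow> complex ^ 3) \<Rightarrow> real" where
  "bessel_norm s f = L2norm (\<lambda>\<xi>. (1 + (norm \<xi>)\<^sup>2) powr (s / 2) *\<^sub>R fourier f \<xi>)"

text \<open>Riesz potential spaces of order \<open>s \<ge> 0\<close>, restricted to L2 functions.\<close>

definition riesz_space :: "real \<Rightarrow> (real ^ 'n \<Rightarrow> complex ^ 3) \<Rightarrow> bool" where
  "riesz_space s f \<longleftrightarrow> (\<exists>g. has_fourier f g \<and> square_integrable (\<lambda>\<xi>. abs_pow s \<xi> *\<^sub>R g \<xi>))"

definition riesz_norm :: "real \<Rightarrow> (real ^ 'n \<Rightarrow> complex ^ 3) \<Rightarrow> real" where
  "riesz_norm s f = L2norm (\<lambda>\<xi>. abs_pow s \<xi> *\<^sub>R fourier f \<xi>)"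

definition weighted_L1 :: "real \<Rightarrow> (real ^ 'n \<Rightarrow> complex ^ 3) \<Rightarrow> bool" where
  "weighted_L1 \<kappa> f \<longleftrightarrow>
     f \<in> borel_measurable lebesgue \<and> integrable lebesgue (\<lambda>x. (1 + norm x) powr \<kappa> * norm (f x))"

definition weighted_L1_norm :: "real \<Rightarrow> (real ^ 'n \<Rightarrow> complex ^ 3) \<Rightarrow> real" where
  "weighted_L1_norm \<kappa> f = (LINT x|lebesgue. (1 + norm x) powr \<kappa> * norm (f x))"

definition total_mass :: "(real ^ 'n \<Rightarrow> complex ^ 3) \<Rightarrow> complex ^ 3" where
  "total_mass f = (LINT x|lebesgue. f x)"


section \<open>Cut-offs\<close>

fun Ck :: "nat \<Rightarrow> (real ^ 'n \<Rightarrow> real) \<Rightarrow> bool" where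
  "Ck 0 f \<longleftrightarrow> continuous_on UNIV f"
| "Ck (Suc k) f \<longleftrightarrow> (\<forall>x. f differentiable (at x)) \<and>
     (\<forall>i. Ck k (\<lambda>x. frechet_derivative f (at x) (axis i 1)))"

definition smooth :: "(real ^ 'n \<Rightarrow> real) \<Rightarrow> bool" where
  "smooth f \<longleftrightarrow> (\<forall>k. Ck k f)"

definition cutoffs :: "real \<Rightarrow> real \<Rightarrow> (real ^ 'n \<Rightarrow> real) \<Rightarrow> (real ^ 'n \<Rightarrow> real) \<Rightarrow>
    (real ^ 'n \<Rightarrow> real) \<Rightarrow> bool" where
  "cutoffs \<epsilon> N \<chi>int \<chi>mid \<chi>ext \<longleftrightarrow>
     smooth \<chi>int \<and> smooth \<chi>mid \<and> smooth \<chi>ext \<and>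
     closure {\<xi>. \<chi>int \<xi> \<noteq> 0} \<subseteq> {\<xi>. norm \<xi> \<le> \<epsilon>} \<and>
     closure {\<xi>. \<chi>mid \<xi> \<noteq> 0} \<subseteq> {\<xi>. \<epsilon> / 2 \<le> norm \<xi> \<and> norm \<xi> \<le> 2 * N} \<and>
     closure {\<xi>. \<chi>ext \<xi> \<noteq> 0} \<subseteq> {\<xi>. N \<le> norm \<xi>} \<and>
     (\<forall>\<xi>. \<chi>int \<xi> + \<chi>mid \<xi> + \<chi>ext \<xi> = 1)"


section \<open>Matrices\<close>

abbreviation sqrt3 :: complex where
  "sqrt3 \<equiv> complex_of_real (sqrt 3)"

definition B0 :: "complex ^ 3 ^ 3" where
  "B0 = vector [vector [\<i>, 0, 0],
                vector [0, - \<i>, 0],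
                vector [0, 0, 0]]"

definition B1 :: "complex ^ 3 ^ 3" where
  "B1 = vector [vector [0, 0, 1],
                vector [0, 0, 1],
                vector [- 1/2, - 1/2, - 1]]"

definition N1 :: "complex ^ 3 ^ 3" where
  "N1 = vector [vector [- 1, (\<i> * sqrt3 - 1) / 2, (- \<i> * sqrt3 - 1) / 2],
                vector [1, (\<i> * sqrt3 - 1) / 2, (- \<i> * sqrt3 - 1) / 2],
                vector [0, 1, 1]]"

definition N2 :: "real \<Rightarrow> real \<Rightarrow> real ^ 'n \<Rightarrow> complex ^ 3 ^ 3" where
  "N2 \<sigma> \<alpha> \<xi> = abs_pow (\<sigma> - 2*\<sigma>*\<alpha>) \<xi> *\<^sub>R
     vector [vector [0, - ((sqrt3 + \<i>) / (1 + \<i> * sqrt3)), (- sqrt3 + \<i>) / (- 1 + \<i> * sqrt3)],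
             vector [- (2 * sqrt3 / (3 * (1 + \<i> * sqrt3))), 0, 0],
             vector [2 * sqrt3 / (3 * (1 - \<i> * sqrt3)), 0, 0]]"

definition N4 :: "real \<Rightarrow> real \<Rightarrow> real ^ 'n \<Rightarrow> complex ^ 3 ^ 3" where
  "N4 \<sigma> \<alpha> \<xi> = abs_pow (2*\<sigma>*\<alpha> - \<sigma>) \<xi> *\<^sub>R
     vector [vector [0, 0, \<i>],
             vector [0, 0, - \<i>],
             vector [\<i> / 2, - (\<i> / 2), 0]]"

definition N5 :: "real \<Rightarrow> real \<Rightarrow> real ^ 'n \<Rightarrow> complex ^ 3 ^ 3" where
  "N5 \<sigma> \<alpha> \<xi> = abs_pow (4*\<sigma>*\<alpha> - 2*\<sigma>) \<xi> *\<^sub>R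
     vector [vector [0, 1/4, - 1],
             vector [1/4, 0, - 1],
             vector [- 1/2, - 1/2, 0]]"

definition diag3 :: "complex \<Rightarrow> complex \<Rightarrow> complex \<Rightarrow> complex ^ 3 ^ 3" where
  "diag3 a b c = vector [vector [a, 0, 0], vector [0, b, 0], vector [0, 0, c]]"


section \<open>The evolution system, the reference systems and the profiles\<close>

text \<open>\<open>V\<close> solves \<open>V\<^sub>t = A(\<xi>) V\<close> for \<open>t > 0\<close>, \<open>V(0,\<xi>) = V\<^sub>0(\<xi>)\<close>, for almost every frequency \<open>\<xi>\<close>.\<close>

definition solves_fourier_system :: "(real ^ 'n \<Rightarrow> complex ^ 3 ^ 3) \<Rightarrow>
    (real ^ 'n \<Rightarrow> complex ^ 3) \<Rightarrow> (real \<Rightarrow> real ^ 'n \<Rightarrow> complex ^ 3) \<Rightarrow> bool" where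
  "solves_fourier_system A V0 V \<longleftrightarrow>
     (AE \<xi> in lebesgue.
        V 0 \<xi> = V0 \<xi> \<and> continuous_on {0..} (\<lambda>t. V t \<xi>) \<and>
        (\<forall>t>0. ((\<lambda>r. V r \<xi>) has_vector_derivative (A \<xi> *v V t \<xi>)) (at t)))"

definition is_solution :: "real \<Rightarrow> real \<Rightarrow> (real ^ 'n \<Rightarrow> complex ^ 3) \<Rightarrow>
    (real \<Rightarrow> real ^ 'n \<Rightarrow> complex ^ 3) \<Rightarrow> bool" where
  "is_solution \<sigma> \<alpha> w0 w \<longleftrightarrow>
     (\<exists>W. solves_fourier_system
            (\<lambda>\<xi>. abs_pow \<sigma> \<xi> *\<^sub>R B0 + abs_pow (2*\<sigma>*\<alpha>) \<xi> *\<^sub>R B1) (fourier w0) W \<and>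
          (\<forall>t\<ge>0. has_fourier (w t) (W t)))"

text \<open>The reference systems are solved on the Fourier side only: the first one has solutions growing
  exponentially at high frequencies, the second one at low frequencies, and only the
  products with the cut-offs are Fourier transforms of functions of \<open>x\<close>.\<close>

definition reference_int :: "real \<Rightarrow> real \<Rightarrow> (real ^ 'n \<Rightarrow> complex ^ 3) \<Rightarrow>
    (real \<Rightarrow> real ^ 'n \<Rightarrow> complex ^ 3) \<Rightarrow> bool" where
  "reference_int \<sigma> \<alpha> w0 V \<longleftrightarrow> solves_fourier_system
     (\<lambda>\<xi>. - (abs_pow (2*\<sigma>*\<alpha>) \<xi> *\<^sub>R diag3 0 (1/2 + \<i> * sqrt3 / 2) (1/2 - \<i> * sqrt3 / 2)
           + abs_pow (2*\<sigma> - 2*\<sigma>*\<alpha>) \<xi> *\<^sub>R diag3 1 (- 1/2 + \<i> * sqrt3 / 6) (- 1/2 - \<i> * sqrt3 / 6)))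
     (\<lambda>\<xi>. matrix_inv (mat 1 + N2 \<sigma> \<alpha> \<xi>) *v (matrix_inv N1 *v fourier w0 \<xi>))
     V"

definition reference_ext :: "real \<Rightarrow> real \<Rightarrow> (real ^ 'n \<Rightarrow> complex ^ 3) \<Rightarrow>
    (real \<Rightarrow> real ^ 'n \<Rightarrow> complex ^ 3) \<Rightarrow> bool" where
  "reference_ext \<sigma> \<alpha> w0 V \<longleftrightarrow> solves_fourier_system
     (\<lambda>\<xi>. - (abs_pow \<sigma> \<xi> *\<^sub>R diag3 (- \<i>) \<i> 0
           + abs_pow (2*\<sigma>*\<alpha>) \<xi> *\<^sub>R diag3 0 0 1
           + abs_pow (4*\<sigma>*\<alpha> - \<sigma>) \<xi> *\<^sub>R diag3 (- (\<i> / 2)) (\<i> / 2) 0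
           + abs_pow (6*\<sigma>*\<alpha> - 2*\<sigma>) \<xi> *\<^sub>R diag3 (1/2) (1/2) (- 1)))
     (\<lambda>\<xi>. matrix_inv (mat 1 + N5 \<sigma> \<alpha> \<xi>) *v (matrix_inv (mat 1 + N4 \<sigma> \<alpha> \<xi>) *v fourier w0 \<xi>))
     V"

definition profile_int :: "real \<Rightarrow> real \<Rightarrow> (real ^ 'n \<Rightarrow> real) \<Rightarrow> (real ^ 'n \<Rightarrow> complex ^ 3) \<Rightarrow>
    (real \<Rightarrow> real ^ 'n \<Rightarrow> complex ^ 3) \<Rightarrow> bool" where
  "profile_int \<sigma> \<alpha> \<chi>int w0 S \<longleftrightarrow>
     (\<exists>V. reference_int \<sigma> \<alpha> w0 V \<and>
          (\<forall>t\<ge>0. has_fourier (S t)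
             (\<lambda>\<xi>. \<chi>int \<xi> *\<^sub>R ((N1 ** (mat 1 + N2 \<sigma> \<alpha> \<xi>)) *v V t \<xi>))))"

definition profile_ext :: "real \<Rightarrow> real \<Rightarrow> (real ^ 'n \<Rightarrow> real) \<Rightarrow> (real ^ 'n \<Rightarrow> complex ^ 3) \<Rightarrow>
    (real \<Rightarrow> real ^ 'n \<Rightarrow> complex ^ 3) \<Rightarrow> bool" where
  "profile_ext \<sigma> \<alpha> \<chi>ext w0 S \<longleftrightarrow>
     (\<exists>V. reference_ext \<sigma> \<alpha> w0 V \<and>
          (\<forall>t\<ge>0. has_fourier (S t)
             (\<lambda>\<xi>. \<chi>ext \<xi> *\<^sub>R (((mat 1 + N4 \<sigma> \<alpha> \<xi>) ** (mat 1 + N5 \<sigma> \<alpha> \<xi>)) *v V t \<xi>))))"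

end

theory Submission
  imports Defs
begin

text \<open>The norms and the evolution are given on the Fourier side, so the estimate is proved first at a fixed
frequency and then integrated.  Write \<open>a = |\<xi>|\<^sup>\<sigma>\<close> and \<open>b\<close> for \<open>|\<xi>|\<close> to the
power \<open>2\<sigma>\<alpha>\<close>, so that the system matrix is \<open>a B0 + b B1\<close>.  As \<open>2\<alpha> < 1\<close>, the term \<open>b B1\<close> dominates
near \<open>\<xi> = 0\<close> and \<open>a B0\<close> dominates near infinity; the ratio \<open>h\<close> of the weaker to the stronger
coefficient is \<open>|\<xi>|\<close> to the power \<open>\<sigma> - 2\<sigma>\<alpha>\<close>, respectively to the power \<open>- (\<sigma> - 2\<sigma>\<alpha>)\<close>.

The heart of the matter is that in both regimes the profile approximates the solution up to a
factor \<open>C h\<close> times the slowest exponential decay \<open>exp (- k t / 2)\<close>, where \<open>k\<close> is \<open>b h\<^sup>2\<close> near the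
origin and \<open>a h\<^sup>3 / 2\<close> near infinity.  One factor \<open>h\<close> is exactly the gain in the theorem: it is the
additional time decay of order \<open>(1 - 2\<alpha>) / (2 (1 - \<alpha>))\<close> at low frequencies and the saving of
\<open>\<sigma> - 2\<sigma>\<alpha>\<close> derivatives at high frequencies.  Eigenvalue perturbation theory is avoided: one only needs an
explicit matrix \<open>M\<close>, polynomial in \<open>h\<close>, that intertwines the system matrix with the diagonal matrix of
the reference system up to a residual \<open>E\<close> of size \<open>h k\<close>.  In the coordinates given by \<open>M\<close> the solution
satisfies the reference system perturbed by a matrix of size \<open>h k\<close>, and a Lyapunov
function (\<open>dissipative_comparison\<close>) shows that this costs a relative error \<open>h\<close>, uniformly in time.  Since the
change of basis used by the profile differs from \<open>M\<close> only by \<open>O(h)\<close>, the profile inherits the bound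
(\<open>approximate_diagonalisation\<close>).  The residual must be small compared with the \<^emph>\<open>slowest\<close> rate \<open>k\<close>, which is why
\<open>M\<close> has to be of second order in \<open>h\<close> near the origin and of third order near infinity
(\<open>low_intertwining\<close>, \<open>high_intertwining\<close>).  What remains is the solution
cut off to a compact set of nonzero frequencies, where a hypocoercive energy gives exponential
decay (\<open>mid_frequency_estimate\<close>).

The three terms on the right-hand side then arise as follows.  At low frequencies the transform of
\<open>w\<^sub>0\<close> is split into its value at \<open>0\<close>, which is a multiple of the total mass, and the rest, which is
\<open>O(|\<xi>|\<^sup>\<kappa>)\<close> times the weighted norm (\<open>norm_fourier_integral_le\<close>); the two heat-type integrals are
bounded by \<open>low_frequency_integral\<close>.  At high frequencies the decay rate tends to \<open>0\<close>, and decay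
in time is bought with \<open>l\<close> derivatives (\<open>exp_decay_le_regularity_loss\<close>).\<close>

section \<open>Dissipative linear evolutions\<close>

lemma exponential_decay:
  fixes \<phi> :: "real \<Rightarrow> real"
  assumes cont: "continuous_on {0..} \<phi>"
    and deriv: "\<And>t. t > 0 \<Longrightarrow> (\<phi> has_real_derivative \<phi>' t) (at t)"
    and le: "\<And>t. t > 0 \<Longrightarrow> \<phi>' t \<le> - k * \<phi> t"
    and "t \<ge> 0"
  shows "\<phi> t \<le> exp (- k * t) * \<phi> 0"
proof -
  define \<psi> where "\<psi> s = exp (k * s) * \<phi> s" for s
  have "\<psi> t \<le> \<psi> 0"
  proof (rule DERIV_nonpos_imp_decreasing_open[of 0 t \<psi>])
    show "0 \<le> t" by fact
    fix x :: real assume x: "0 < x"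
    have "(\<psi> has_real_derivative k * exp (k * x) * \<phi> x + exp (k * x) * \<phi>' x) (at x)"
      unfolding \<psi>_def by (auto intro!: derivative_eq_intros deriv[OF x])
    moreover have "k * exp (k * x) * \<phi> x + exp (k * x) * \<phi>' x = exp (k * x) * (\<phi>' x + k * \<phi> x)"
      by (simp add: algebra_simps)
    moreover have "\<dots> \<le> 0"
      using le[OF x] by (simp add: mult_le_0_iff)
    ultimately show "\<exists>y. (\<psi> has_real_derivative y) (at x) \<and> y \<le> 0"
      by auto
  next
    show "continuous_on {0..t} \<psi>"
      unfolding \<psi>_def by (intro continuous_intros continuous_on_subset[OF cont]) auto
  qed
  then have "exp (- k * t) * (exp (k * t) * \<phi> t) \<le> exp (- k * t) * \<phi> 0"
    unfolding \<psi>_def by (simp add: mult_left_mono)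
  then show ?thesis
    by (simp add: mult.assoc[symmetric] exp_add[symmetric])
qed

text \<open>The function \<open>|U - V|\<^sup>2 + 2 (\<rho>/k)\<^sup>2 |U|\<^sup>2\<close> decays at rate \<open>k\<close>: the coupling term \<open>2 \<rho> |U - V| |U|\<close> is
paid half by the dissipation of \<open>U - V\<close>, at the price of \<open>(\<rho>\<^sup>2/k) |U|\<^sup>2\<close>, and this is what the
dissipation of the second summand covers as long as \<open>4 \<rho> \<le> k\<close>.  The perturbation thus
contributes the relative error \<open>\<rho> / k\<close>, with no loss growing in time.\<close>

lemma dissipative_comparison:
  fixes U V :: "real \<Rightarrow> 'a::real_inner"
  assumes add: "\<And>x y. L (x - y) = L x - L y"
    and diss: "\<And>x. x \<bullet> L x \<le> - k * (norm x)\<^sup>2"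
    and R: "\<And>x. norm (R x) \<le> \<rho> * norm x"
    and k: "0 < k" "0 \<le> \<rho>" "4 * \<rho> \<le> k"
    and cont: "continuous_on {0..} U" "continuous_on {0..} V"
    and U': "\<And>t. t > 0 \<Longrightarrow> (U has_vector_derivative L (U t) + R (U t)) (at t)"
    and V': "\<And>t. t > 0 \<Longrightarrow> (V has_vector_derivative L (V t)) (at t)"
    and "t \<ge> 0"
  shows "(norm (U t - V t))\<^sup>2
      \<le> exp (- k * t) * ((norm (U 0 - V 0))\<^sup>2 + 2 * (\<rho> / k)\<^sup>2 * (norm (U 0))\<^sup>2)"
proof -
  define c where "c = 2 * (\<rho> / k)\<^sup>2"
  have c: "c \<ge> 0" by (simp add: c_def)
  define \<phi> where "\<phi> t = (U t - V t) \<bullet> (U t - V t) + c * (U t \<bullet> U t)" for t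
  define \<phi>' where "\<phi>' t = 2 * ((U t - V t) \<bullet> (L (U t - V t) + R (U t)))
      + c * (2 * (U t \<bullet> (L (U t) + R (U t))))" for t
  have "\<phi> t \<le> exp (- k * t) * \<phi> 0"
  proof (rule exponential_decay[where \<phi>' = \<phi>'])
    show "continuous_on {0..} \<phi>"
      unfolding \<phi>_def using cont by (intro continuous_intros)
  next
    fix t :: real assume t: "t > 0"
    have dD: "((\<lambda>t. U t - V t) has_derivative (\<lambda>h. h *\<^sub>R (L (U t - V t) + R (U t)))) (at t)"
      using has_vector_derivative_diff[OF U'[OF t] V'[OF t]]
      by (simp add: has_vector_derivative_def add algebra_simps)
    have dU: "(U has_derivative (\<lambda>h. h *\<^sub>R (L (U t) + R (U t)))) (at t)"
      using U'[OF t] by (simp add: has_vector_derivative_def)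
    have "(\<phi> has_derivative (\<lambda>h. h * \<phi>' t)) (at t)"
      unfolding \<phi>_def \<phi>'_def
      by (rule has_derivative_eq_rhs, (rule derivative_intros dD dU)+)
        (auto simp: fun_eq_iff algebra_simps inner_commute)
    then show "(\<phi> has_real_derivative \<phi>' t) (at t)"
      by (simp add: has_field_derivative_def mult_commute_abs)
    define d u where "d = norm (U t - V t)" and "u = norm (U t)"
    have 1: "(U t - V t) \<bullet> (L (U t - V t) + R (U t)) \<le> - k * d\<^sup>2 + \<rho> * d * u"
    proof -
      have "(U t - V t) \<bullet> R (U t) \<le> d * (\<rho> * u)"
        unfolding d_def u_def
        by (rule order.trans[OF norm_cauchy_schwarz]) (simp add: mult_left_mono R)
      then show ?thesis
        using diss[of "U t - V t"] by (simp add: inner_add_right d_def algebra_simps)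
    qed
    have 2: "U t \<bullet> (L (U t) + R (U t)) \<le> (- k + \<rho>) * u\<^sup>2"
    proof -
      have "U t \<bullet> R (U t) \<le> u * (\<rho> * u)"
        unfolding u_def by (rule order.trans[OF norm_cauchy_schwarz]) (simp add: mult_left_mono R)
      then show ?thesis
        using diss[of "U t"] by (simp add: inner_add_right u_def algebra_simps power2_eq_square)
    qed
    have 3: "2 * \<rho> * d * u \<le> k * d\<^sup>2 + \<rho>\<^sup>2 / k * u\<^sup>2"
    proof -
      have "0 \<le> (k * d - \<rho> * u)\<^sup>2 / k" using k by simp
      also have "\<dots> = k * d\<^sup>2 + \<rho>\<^sup>2 / k * u\<^sup>2 - 2 * \<rho> * d * u"
        using k by (simp add: field_simps power2_eq_square)
      finally show ?thesis by simp
    qed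
    have 4: "\<rho>\<^sup>2 / k \<le> c * (k - 2 * \<rho>)"
    proof -
      have "\<rho>\<^sup>2 / k = c * (k / 2)"
        using k by (simp add: c_def field_simps power2_eq_square)
      also have "\<dots> \<le> c * (k - 2 * \<rho>)"
        using k c by (intro mult_left_mono) auto
      finally show ?thesis .
    qed
    have "\<phi>' t \<le> 2 * (- k * d\<^sup>2 + \<rho> * d * u) + c * (2 * ((- k + \<rho>) * u\<^sup>2))"
      unfolding \<phi>'_def using 1 2 c by (intro add_mono mult_left_mono) auto
    also have "\<dots> \<le> - k * d\<^sup>2 + \<rho>\<^sup>2 / k * u\<^sup>2 + c * (2 * ((- k + \<rho>) * u\<^sup>2))"
      using 3 by simp
    also have "\<dots> \<le> - k * d\<^sup>2 + c * (k - 2 * \<rho>) * u\<^sup>2 + c * (2 * ((- k + \<rho>) * u\<^sup>2))"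
      using mult_right_mono[OF 4, of "u\<^sup>2"] by simp
    also have "\<dots> = - k * \<phi> t"
      by (simp add: \<phi>_def d_def u_def dot_square_norm algebra_simps)
    finally show "\<phi>' t \<le> - k * \<phi> t" .
  qed fact
  moreover have "(norm (U t - V t))\<^sup>2 \<le> \<phi> t"
    using c by (simp add: \<phi>_def dot_square_norm)
  moreover have "\<phi> 0 = (norm (U 0 - V 0))\<^sup>2 + 2 * (\<rho> / k)\<^sup>2 * (norm (U 0))\<^sup>2"
    by (simp add: \<phi>_def dot_square_norm c_def)
  ultimately show ?thesis by simp
qed

section \<open>Matrices close to an invertible one\<close>

lemma norm_matrix_vector_mult_le:
  fixes A :: "complex ^ 'n ^ 'm"
  shows "norm (A *v x) \<le> norm A * norm x"
proof -
  have "norm (A *v x) \<le> L2_set (\<lambda>i. norm x * norm (A $ i)) UNIV"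
    unfolding norm_vec_def[of "A *v x"]
  proof (rule L2_set_mono)
    fix i
    have "norm ((A *v x) $ i) \<le> (\<Sum>j\<in>UNIV. norm (A $ i $ j) * norm (x $ j))"
      by (simp add: matrix_vector_mult_def) (metis (no_types, lifting) norm_mult norm_sum sum.cong)
    also have "\<dots> \<le> norm (A $ i) * norm x"
      using L2_set_mult_ineq[of "\<lambda>j. norm (A $ i $ j)" "\<lambda>j. norm (x $ j)" UNIV]
      by (simp add: norm_vec_def)
    finally show "norm ((A *v x) $ i) \<le> norm x * norm (A $ i)"
      by (simp add: mult.commute)
  qed simp
  also have "\<dots> = norm A * norm x"
    by (simp add: L2_set_right_distrib[symmetric] norm_vec_def[of A])
  finally show ?thesis .
qed

lemma scaleR_matrix_vector_mult:
  fixes A :: "complex ^ 'n ^ 'm"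
  shows "(c *\<^sub>R A) *v x = c *\<^sub>R (A *v x)"
  by (simp add: vec_eq_iff matrix_vector_mult_def scaleR_sum_right)

lemma matrix_mult_scaleR_right:
  fixes A :: "complex ^ 'n ^ 'm" and B :: "complex ^ 'k ^ 'n"
  shows "A ** (c *\<^sub>R B) = c *\<^sub>R (A ** B)"
  by (simp add: vec_eq_iff matrix_matrix_mult_def scaleR_sum_right)

lemma matrix_mult_scaleR_left:
  fixes A :: "complex ^ 'n ^ 'm" and B :: "complex ^ 'k ^ 'n"
  shows "(c *\<^sub>R A) ** B = c *\<^sub>R (A ** B)"
  by (simp add: vec_eq_iff matrix_matrix_mult_def scaleR_sum_right)

lemma matrix_inv_mult:
  fixes A :: "complex ^ 'n ^ 'n"
  assumes "invertible A"
  shows "A ** matrix_inv A = mat 1" "matrix_inv A ** A = mat 1"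
  using someI_ex[of "\<lambda>B. A ** B = mat 1 \<and> B ** A = mat 1"] assms
  unfolding matrix_inv_def invertible_def by auto

lemma invertible_if_bounded_below:
  fixes A :: "complex ^ 'n ^ 'n"
  assumes "\<And>x. norm x \<le> K * norm (A *v x)"
  shows "invertible A"
proof -
  have "inj ((*v) A)"
  proof (rule injI)
    fix x y assume "A *v x = A *v y"
    then show "x = y"
      using assms[of "x - y"] by (simp add: matrix_vector_mult_diff_distrib)
  qed
  then show ?thesis
    using matrix_left_invertible_injective invertible_left_inverse by blast
qed

text \<open>A quantitative Neumann series argument, in the form of a lower bound: it gives at once
invertibility of \<open>A\<close> and a bound for its inverse.\<close>

lemma bounded_below_near_invertible:
  fixes A A0 :: "complex ^ 'n ^ 'n"
  assumes J: "J ** A0 = mat 1" and small: "norm J * norm (A - A0) \<le> 1/2"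
  shows "norm x \<le> 2 * norm J * norm (A *v x)"
proof -
  have "norm x = norm (J *v (A0 *v x))"
    by (simp add: matrix_vector_mul_assoc J)
  also have "\<dots> \<le> norm J * norm (A0 *v x)"
    by (rule norm_matrix_vector_mult_le)
  also have "A0 *v x = A *v x - (A - A0) *v x"
    by (simp add: matrix_vector_mult_diff_rdistrib)
  also have "norm J * norm (A *v x - (A - A0) *v x)
      \<le> norm J * (norm (A *v x) + norm (A - A0) * norm x)"
    by (intro mult_left_mono order.trans[OF norm_triangle_ineq4] add_mono
        norm_matrix_vector_mult_le) auto
  also have "\<dots> = norm J * norm (A *v x) + (norm J * norm (A - A0)) * norm x"
    by (simp add: algebra_simps)
  also have "\<dots> \<le> norm J * norm (A *v x) + 1/2 * norm x"
    using small by (intro add_mono mult_right_mono) auto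
  finally show ?thesis by simp
qed

section \<open>Approximate diagonalisation\<close>

definition evolves :: "complex ^ 'n ^ 'n \<Rightarrow> (real \<Rightarrow> complex ^ 'n) \<Rightarrow> bool" where
  "evolves A W \<longleftrightarrow> continuous_on {0..} W \<and>
     (\<forall>t>0. (W has_vector_derivative A *v W t) (at t))"

text \<open>If \<open>M\<close> were an exact eigenbasis (\<open>E = 0\<close>) and \<open>Q = M\<close>, the two evolutions would correspond exactly.
In general \<open>U = inv M W\<close> solves the system of \<open>V\<close> perturbed by \<open>inv M E\<close>, of size \<open>K\<^sup>2 h k\<close>, and starts at
distance \<open>O(h)\<close> from \<open>V\<close>, so that the comparison lemma yields \<open>U - V = O(h)\<close>; finally \<open>Q\<close> is
traded for \<open>M\<close> at the cost of another \<open>O(h)\<close>.\<close>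

lemma approximate_diagonalisation:
  fixes A M Q \<Lambda> E :: "complex ^ 'n ^ 'n" and W V :: "real \<Rightarrow> complex ^ 'n"
  assumes AM: "A ** M = M ** \<Lambda> + E"
    and diss: "\<And>x. x \<bullet> (\<Lambda> *v x) \<le> - k * (norm x)\<^sup>2"
    and pos: "0 < k" "0 \<le> h" "1 \<le> K"
    and M: "\<And>x. norm x \<le> K * norm (M *v x)" "norm M \<le> K"
    and Q: "\<And>x. norm x \<le> K * norm (Q *v x)"
    and MQ: "norm (M - Q) \<le> K * h"
    and E: "norm E \<le> K * h * k"
    and small: "4 * K\<^sup>2 * h \<le> 1"
    and W: "evolves A W" and V: "evolves \<Lambda> V"
    and init: "Q *v V 0 = W 0" and "t \<ge> 0"
  shows "norm (W t - Q *v V t) \<le> 3 * K^4 * h * exp (- k * t / 2) * norm (W 0)"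
proof -
  have cont: "continuous_on {0..} W" "continuous_on {0..} V"
    and W': "\<And>t. t > 0 \<Longrightarrow> (W has_vector_derivative A *v W t) (at t)"
    and V': "\<And>t. t > 0 \<Longrightarrow> (V has_vector_derivative \<Lambda> *v V t) (at t)"
    using W V by (auto simp: evolves_def)
  define e where "e = exp (- k * t / 2)"
  have e2: "exp (- k * t) = e\<^sup>2"
    by (simp add: e_def power2_eq_square exp_add[symmetric])
  have e: "e > 0" by (simp add: e_def)
  have inv: "invertible M"
    by (rule invertible_if_bounded_below[OF M(1)])
  define J where "J = matrix_inv M"
  have MJ: "M *v (J *v x) = x" and JM: "J *v (M *v x) = x" for x
    using matrix_inv_mult[OF inv] by (simp_all add: J_def matrix_vector_mul_assoc)
  have nJ: "norm (J *v x) \<le> K * norm x" for x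
    using M(1)[of "J *v x"] by (simp add: MJ)
  define U where "U t = J *v W t" for t
  have MU: "M *v U t = W t" for t by (simp add: U_def MJ)
  define R where "R x = J *v (E *v x)" for x
  have nR: "norm (R x) \<le> (K\<^sup>2 * h * k) * norm x" for x
  proof -
    have "norm (R x) \<le> K * (norm E * norm x)"
      unfolding R_def using pos
      by (intro order.trans[OF nJ] mult_left_mono norm_matrix_vector_mult_le) auto
    also have "\<dots> \<le> K * ((K * h * k) * norm x)"
      using pos E by (intro mult_left_mono mult_right_mono) auto
    finally show ?thesis by (simp add: power2_eq_square mult_ac)
  qed
  have comm: "J *v (A *v W t) = \<Lambda> *v U t + R (U t)" for t
  proof -
    have "A *v W t = (A ** M) *v U t"
      by (simp add: matrix_vector_mul_assoc[symmetric] MU)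
    also have "\<dots> = M *v (\<Lambda> *v U t) + E *v U t"
      by (simp add: AM matrix_vector_mult_add_rdistrib matrix_vector_mul_assoc)
    finally show ?thesis
      by (simp add: matrix_vector_right_distrib JM R_def)
  qed
  have bl: "bounded_linear ((*v) J)" by simp
  have U0: "norm (U 0) \<le> K * norm (W 0)"
    unfolding U_def by (rule nJ)
  have V0: "norm (V 0) \<le> K * norm (W 0)"
    using Q[of "V 0"] init by simp
  have D0: "norm (U 0 - V 0) \<le> K^3 * h * norm (W 0)"
  proof -
    have "norm (U 0 - V 0) \<le> K * norm (M *v (U 0 - V 0))"
      by (rule M(1))
    also have "M *v (U 0 - V 0) = - ((M - Q) *v V 0)"
      by (simp add: matrix_vector_mult_diff_distrib matrix_vector_mult_diff_rdistrib MU init)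
    also have "K * norm (- ((M - Q) *v V 0)) \<le> K * (norm (M - Q) * norm (V 0))"
      using pos by (simp add: norm_matrix_vector_mult_le)
    also have "\<dots> \<le> K * ((K * h) * (K * norm (W 0)))"
      using pos MQ V0 by (intro mult_left_mono mult_mono) auto
    finally show ?thesis by (simp add: power3_eq_cube mult_ac)
  qed
  have "(norm (U t - V t))\<^sup>2
      \<le> exp (- k * t) * ((norm (U 0 - V 0))\<^sup>2 + 2 * ((K\<^sup>2 * h * k) / k)\<^sup>2 * (norm (U 0))\<^sup>2)"
  proof (rule dissipative_comparison[where L = "(*v) \<Lambda>" and R = R])
    show "4 * (K\<^sup>2 * h * k) \<le> k"
      using mult_right_mono[OF small, of k] pos by simp
    show "continuous_on {0..} U"
      unfolding U_def using bl cont(1) by (rule bounded_linear.continuous_on)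
    fix t :: real assume "t > 0"
    show "(U has_vector_derivative \<Lambda> *v U t + R (U t)) (at t)"
      unfolding comm[symmetric]
      using bounded_linear.has_vector_derivative[OF bl W'[OF \<open>t > 0\<close>]]
      by (simp add: U_def[abs_def])
  qed (use diss pos cont V' nR \<open>t \<ge> 0\<close> in \<open>auto simp: matrix_vector_mult_diff_distrib\<close>)
  also have "\<dots> \<le> e\<^sup>2 * ((K^3 * h * norm (W 0))\<^sup>2 + 2 * (K\<^sup>2 * h)\<^sup>2 * (K * norm (W 0))\<^sup>2)"
  proof -
    have "(norm (U 0 - V 0))\<^sup>2 \<le> (K^3 * h * norm (W 0))\<^sup>2"
      and "(norm (U 0))\<^sup>2 \<le> (K * norm (W 0))\<^sup>2"
      using D0 U0 by (auto intro: power_mono)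
    then show ?thesis
      unfolding e2 using pos(1) by (intro mult_left_mono add_mono) (auto intro: mult_left_mono)
  qed
  also have "\<dots> = 3 * (e * K^3 * h * norm (W 0))\<^sup>2"
    by algebra
  also have "\<dots> \<le> (2 * (e * K^3 * h * norm (W 0)))\<^sup>2"
    by (simp add: power_mult_distrib)
  finally have D: "norm (U t - V t) \<le> 2 * (e * K^3 * h * norm (W 0))"
    using pos e by (auto intro: power2_le_imp_le)
  have "(norm (V t - 0))\<^sup>2
      \<le> exp (- k * t) * ((norm (V 0 - 0))\<^sup>2 + 2 * (0 / k)\<^sup>2 * (norm (V 0))\<^sup>2)"
  proof (rule dissipative_comparison[where L = "(*v) \<Lambda>" and R = "\<lambda>_. 0" and V = "\<lambda>_. 0"])
  qed (use diss pos cont V' \<open>t \<ge> 0\<close> in \<open>auto simp: matrix_vector_mult_diff_distrib\<close>)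
  also have "\<dots> \<le> (e * (K * norm (W 0)))\<^sup>2"
    unfolding e2 using V0 by (simp add: power_mult_distrib[symmetric] e_def power_mono)
  finally have V: "norm (V t) \<le> e * (K * norm (W 0))"
    using pos e by (auto intro: power2_le_imp_le)
  have "W t - Q *v V t = M *v (U t - V t) + (M - Q) *v V t"
    by (simp add: MU matrix_vector_mult_diff_distrib matrix_vector_mult_diff_rdistrib)
  also have "norm \<dots> \<le> norm M * norm (U t - V t) + norm (M - Q) * norm (V t)"
    by (intro order.trans[OF norm_triangle_ineq] add_mono norm_matrix_vector_mult_le)
  also have "\<dots> \<le> K * (2 * (e * K^3 * h * norm (W 0))) + (K * h) * (e * (K * norm (W 0)))"
    using pos M(2) MQ D V by (intro add_mono mult_mono) auto
  also have "\<dots> \<le> K * (2 * (e * K^3 * h * norm (W 0))) + (K^4 * h) * (e * norm (W 0))"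
  proof -
    have "K^2 \<le> K^4" using pos by (intro power_increasing) auto
    then have "K^2 * (h * (e * norm (W 0))) \<le> K^4 * (h * (e * norm (W 0)))"
      using pos e by (intro mult_right_mono) auto
    then show ?thesis by (simp add: power2_eq_square mult_ac)
  qed
  also have "\<dots> = 3 * K^4 * h * e * norm (W 0)"
    by (simp add: power4_eq_xxxx power3_eq_cube)
  finally show ?thesis unfolding e_def .
qed

text \<open>The uniform version for families depending on \<open>h\<close>: closeness of \<open>M h\<close> and \<open>Q h\<close> to one invertible
matrix \<open>M0\<close> supplies all bounds on inverses, with constants independent of the evolutions, the
overall scale of \<open>A\<close> and the rate \<open>k\<close>.\<close>

lemma approximate_diagonalisation_small_parameter:
  fixes M0 J :: "complex ^ 'n ^ 'n" and M Q :: "real \<Rightarrow> complex ^ 'n ^ 'n"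
  assumes J: "J ** M0 = mat 1"
    and M: "\<And>h. 0 < h \<Longrightarrow> h \<le> 1 \<Longrightarrow> norm (M h - M0) \<le> L * h"
    and Q: "\<And>h. 0 < h \<Longrightarrow> h \<le> 1 \<Longrightarrow> norm (Q h - M0) \<le> L * h"
  shows "\<exists>h0>0. \<exists>C>0. h0 \<le> 1 \<and> (\<forall>h A \<Lambda> E k W V t. 0 < h \<and> h \<le> h0 \<and> 0 < k \<and>
    A ** M h = M h ** \<Lambda> + E \<and> (\<forall>x. x \<bullet> (\<Lambda> *v x) \<le> - k * (norm x)\<^sup>2) \<and>
    norm E \<le> L * h * k \<and> evolves A W \<and> evolves \<Lambda> V \<and>
    Q h *v V 0 = W 0 \<and> 0 \<le> t \<longrightarrow>
    norm (W t - Q h *v V t) \<le> C * h * exp (- k * t / 2) * norm (W 0))"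
proof -
  have L: "L \<ge> 0" using M[of 1] norm_ge_zero[of "M 1 - M0"] by linarith
  \<comment> \<open>\<open>K\<close> dominates simultaneously the inverse bound \<open>2 |J|\<close>, the norms of \<open>M h\<close> and the
    distance of \<open>M h\<close> from \<open>Q h\<close>, as \<open>approximate_diagonalisation\<close> requires.\<close>
  define K where "K = 1 + 2 * norm J + norm M0 + 2 * L"
  have K: "K \<ge> 1" "2 * norm J \<le> K" "norm M0 + L \<le> K" "2 * L \<le> K"
    unfolding K_def using L by auto
  define h0 where "h0 = 1 / (4 * K\<^sup>2)"
  have "1 \<le> K\<^sup>2" using K by simp
  then have "1 \<le> 4 * K\<^sup>2" by linarith
  moreover have "K\<^sup>2 > 0"
    using K by simp
  ultimately have h0: "h0 > 0" "h0 \<le> 1"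
    by (simp_all add: h0_def)
  show ?thesis
  proof (rule exI[of _ h0], intro conjI h0, rule exI[of _ "3 * K^4"], intro conjI h0 allI impI; (elim conjE)?)
    show "3 * K^4 > 0" using K by simp
    fix h A \<Lambda> E k W V and t :: real
    assume h: "0 < h" "h \<le> h0" and H: "0 < k"
      "A ** M h = M h ** \<Lambda> + E" "\<forall>x. x \<bullet> (\<Lambda> *v x) \<le> - k * (norm x)\<^sup>2"
      "norm E \<le> L * h * k" "evolves A W" "evolves \<Lambda> V"
      "Q h *v V 0 = W 0" "0 \<le> t"
    have h1: "h \<le> 1" using h h0 by simp
    have hs: "4 * K\<^sup>2 * h \<le> 1"
      using h K by (simp add: h0_def field_simps)
    have JL: "norm J * (L * h) \<le> 1/2"
    proof -
      have "norm J * (L * h) \<le> (K / 2) * ((K / 2) * h)"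
        using K L h by (intro mult_mono) auto
      also have "\<dots> \<le> 1/2"
        using hs by (simp add: power2_eq_square)
      finally show ?thesis .
    qed
    have near: "norm x \<le> K * norm (P *v x)" if "norm (P - M0) \<le> L * h" for P x
    proof -
      have "norm J * norm (P - M0) \<le> norm J * (L * h)"
        using that by (intro mult_left_mono) auto
      with JL have "norm x \<le> 2 * norm J * norm (P *v x)"
        by (intro bounded_below_near_invertible[OF J]) linarith
      also have "\<dots> \<le> K * norm (P *v x)"
        using K by (intro mult_right_mono) auto
      finally show ?thesis .
    qed
    show "norm (W t - Q h *v V t) \<le> 3 * K^4 * h * exp (- k * t / 2) * norm (W 0)"
    proof (rule approximate_diagonalisation[where M = "M h" and \<Lambda> = \<Lambda> and E = E and A = A])
      show "norm (M h) \<le> K"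
      proof -
        have "norm (M h) \<le> norm M0 + norm (M h - M0)"
          using norm_triangle_sub by blast
        also have "\<dots> \<le> norm M0 + L * h"
          using M[OF h(1) h1] by simp
        also have "\<dots> \<le> norm M0 + L"
          using L h1 h by (simp add: mult_left_le)
        finally show ?thesis using K by simp
      qed
      show "norm (M h - Q h) \<le> K * h"
      proof -
        have "norm (M h - Q h) \<le> norm (M h - M0) + norm (Q h - M0)"
          by (metis norm_triangle_ineq4 diff_diff_eq2 diff_add_cancel)
        also have "\<dots> \<le> 2 * L * h"
          using M[OF h(1) h1] Q[OF h(1) h1] by simp
        also have "\<dots> \<le> K * h"
          using K h by (intro mult_right_mono) auto
        finally show ?thesis .
      qed
      show "norm E \<le> K * h * k"
      proof -
        have "L * h * k \<le> K * h * k"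
          using K L h H by (intro mult_right_mono) auto
        with H show ?thesis by linarith
      qed
    qed (use h H K hs near M[OF h(1) h1] Q[OF h(1) h1] in auto)
  qed
qed

section \<open>The three frequency regimes\<close>

lemma matrix_mult_add_rdistrib:
  fixes A B :: "complex ^ 'n ^ 'm"
  shows "(A + B) ** C = A ** C + B ** C"
  by (simp add: vec_eq_iff matrix_matrix_mult_def algebra_simps sum.distrib)

lemma diag3_dissipative:
  assumes "Re a \<le> - k" "Re b \<le> - k" "Re c \<le> - k"
  shows "x \<bullet> (diag3 a b c *v x) \<le> - k * (norm x)\<^sup>2"
proof -
  have *: "u \<bullet> (l * u) = Re l * (norm u)\<^sup>2" for u l :: complex
    unfolding cmod_power2 by (simp add: inner_complex_def power2_eq_square algebra_simps)
  have "x \<bullet> (diag3 a b c *v x)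
      = Re a * (norm (x $ 1))\<^sup>2 + Re b * (norm (x $ 2))\<^sup>2 + Re c * (norm (x $ 3))\<^sup>2"
    by (simp add: inner_vec_def sum_3 diag3_def matrix_vector_mult_def *)
  also have "\<dots> \<le> (- k) * (norm (x $ 1))\<^sup>2 + (- k) * (norm (x $ 2))\<^sup>2 + (- k) * (norm (x $ 3))\<^sup>2"
    using assms by (intro add_mono mult_right_mono) auto
  also have "\<dots> = - k * (norm x)\<^sup>2"
    by (simp add: power2_norm_eq_inner inner_vec_def sum_3 algebra_simps)
  finally show ?thesis .
qed

lemma invertible_mat1_plus_small:
  fixes N :: "complex ^ 'n ^ 'n"
  shows "\<exists>h0>0. \<forall>h. 0 < h \<and> h \<le> h0 \<longrightarrow> invertible (mat 1 + h *\<^sub>R N)"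
proof -
  define c where "c = 1 + 2 * norm (mat 1 :: complex ^ 'n ^ 'n) * norm N"
  have c: "c > 0" by (simp add: c_def add_pos_nonneg)
  have "invertible (mat 1 + h *\<^sub>R N)" if h: "0 < h" "h \<le> 1 / c" for h
  proof (rule invertible_if_bounded_below[OF bounded_below_near_invertible])
    show "mat 1 ** mat 1 = (mat 1 :: complex ^ 'n ^ 'n)" by simp
    have "norm (mat 1 :: complex ^ 'n ^ 'n) * (h * norm N)
        \<le> norm (mat 1 :: complex ^ 'n ^ 'n) * (1 / c * norm N)"
      using h by (intro mult_left_mono mult_right_mono) auto
    also have "\<dots> \<le> 1/2"
      using c by (simp add: field_simps c_def)
    finally show "norm (mat 1 :: complex ^ 'n ^ 'n) * norm (mat 1 + h *\<^sub>R N - mat 1) \<le> 1/2"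
      using h by simp
  qed
  with c show ?thesis by (intro exI[of _ "1 / c"]) auto
qed

subsection \<open>Low frequencies\<close>

text \<open>An eigenvalue of \<open>B1\<close>; the others are \<open>0\<close> and the conjugate, which is \<open>- 1 - \<omega>\<close>.  All
coefficients below are written as polynomials in \<open>\<omega>\<close>, so that matrix identities reduce to ring
identities modulo \<open>\<omega>\<^sup>2 + \<omega> + 1 = 0\<close>.\<close>

definition \<omega> :: complex where
  "\<omega> = (- 1 - \<i> * sqrt3) / 2"

lemma sqrt3_squared: "sqrt3 * sqrt3 = 3"
  by (simp flip: of_real_mult)

lemma \<omega>_squared: "\<omega> * \<omega> = - \<omega> - 1"
  using sqrt3_squared by (simp add: \<omega>_def field_simps)

definition N2_coeff :: "complex ^ 3 ^ 3" where
  "N2_coeff = vector [vector [0, - ((sqrt3 + \<i>) / (1 + \<i> * sqrt3)), (- sqrt3 + \<i>) / (- 1 + \<i> * sqrt3)],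
             vector [- (2 * sqrt3 / (3 * (1 + \<i> * sqrt3))), 0, 0],
             vector [2 * sqrt3 / (3 * (1 - \<i> * sqrt3)), 0, 0]]"

lemma N1_eq: "N1 = vector [vector [- 1, - 1 - \<omega>, \<omega>], vector [1, - 1 - \<omega>, \<omega>], vector [0, 1, 1]]"
  unfolding N1_def \<omega>_def by (simp add: vec_eq_iff forall_3 field_simps)

text \<open>An eigenvector of \<open>h B0 + B1\<close> for the eigenvalue \<open>\<mu>\<close> is \<open>(\<mu> + i h, \<mu> - i h, \<mu>\<^sup>2 + h\<^sup>2)\<close>, and
\<open>\<mu>\<^sup>3 + \<mu>\<^sup>2 + (1 + h\<^sup>2) \<mu> + h\<^sup>2 = 0\<close>.  The columns of \<open>N1 + h low_M1 + h\<^sup>2 low_M2\<close> are the second-order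
expansions of these vectors, normalised to agree with \<open>N1\<close> at \<open>h = 0\<close>, and \<open>low_\<Lambda>\<close> contains the
expansions \<open>- h\<^sup>2\<close>, \<open>\<omega> + h\<^sup>2 / (1 - \<omega>)\<close> and the conjugate of the latter, where \<open>1 / (1 - \<omega>) = (2 + \<omega>) / 3\<close>; these
are, up to the factor \<open>b\<close>, the eigenvalues of the low-frequency reference system.\<close>

definition low_M1 :: "complex ^ 3 ^ 3" where
  "low_M1 = vector [vector [- \<i>, \<i> * \<omega>, \<i> * (- 1 - \<omega>)],
                    vector [- \<i>, - (\<i> * \<omega>), \<i> * (1 + \<omega>)],
                    vector [\<i>, 0, 0]]"

definition low_M2 :: "complex ^ 3 ^ 3" where
  "low_M2 = vector [vector [0, - (2 + \<omega>) / 3, - (1 - \<omega>) / 3],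
                    vector [0, - (2 + \<omega>) / 3, - (1 - \<omega>) / 3],
                    vector [0, 0, 0]]"

definition low_E0 :: "complex ^ 3 ^ 3" where
  "low_E0 = vector [vector [- \<i>, - (\<i> * ((2 + \<omega>) / 3 * (1 + \<omega>))), \<i> * ((1 - \<omega>) / 3 * \<omega>)],
                    vector [- \<i>, \<i> * ((2 + \<omega>) / 3 * (1 + \<omega>)), - (\<i> * ((1 - \<omega>) / 3 * \<omega>))],
                    vector [\<i>, 0, 0]]"

definition low_E1 :: "complex ^ 3 ^ 3" where
  "low_E1 = vector [vector [0, ((2 + \<omega>) / 3)\<^sup>2, ((1 - \<omega>) / 3)\<^sup>2],
                    vector [0, ((2 + \<omega>) / 3)\<^sup>2, ((1 - \<omega>) / 3)\<^sup>2],
                    vector [0, 0, 0]]"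

definition low_\<Lambda> :: "real \<Rightarrow> complex ^ 3 ^ 3" where
  "low_\<Lambda> h = diag3 (- (complex_of_real h)\<^sup>2)
     (\<omega> + (2 + \<omega>) / 3 * (complex_of_real h)\<^sup>2)
     (- 1 - \<omega> + (1 - \<omega>) / 3 * (complex_of_real h)\<^sup>2)"

text \<open>The expansion is stopped at the first order that makes the residual \<open>O(h\<^sup>3)\<close>, one power of \<open>h\<close>
better than the real part \<open>- h\<^sup>2\<close> of the slowest eigenvalue.\<close>

lemma low_intertwining:
  "(h *\<^sub>R B0 + B1) ** (N1 + h *\<^sub>R low_M1 + h\<^sup>2 *\<^sub>R low_M2)
   = (N1 + h *\<^sub>R low_M1 + h\<^sup>2 *\<^sub>R low_M2) ** low_\<Lambda> h + h^3 *\<^sub>R (low_E0 + h *\<^sub>R low_E1)"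
proof -
  \<comment> \<open>Reciprocals are replaced by symbols with a polynomial relation, so that each entry is an
    identity in a polynomial ring modulo these relations.\<close>
  define e :: complex where "e = 1 / 3"
  have e: "3 * e = 1" and d3: "x / 3 = e * x" for x by (simp_all add: e_def)
  define g :: complex where "g = 1 / 2"
  have g: "2 * g = 1" and d2: "x / 2 = g * x" for x by (simp_all add: g_def)
  define i where "i = \<i>"
  have i: "i * i = - 1" by (simp add: i_def)
  define w where "w = \<omega>"
  have w: "w * w = - w - 1" unfolding w_def by (rule \<omega>_squared)
  define x where "x = complex_of_real h"
  have scale: "c *\<^sub>R z = complex_of_real c * z" for c and z :: complex
    by (rule scaleR_conv_of_real)
  show ?thesis
    unfolding vec_eq_iff forall_3 N1_eq low_M1_def low_M2_def low_E0_def low_E1_def low_\<Lambda>_def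
      diag3_def B0_def B1_def d3 d2
    by (simp add: matrix_matrix_mult_def sum_3 scale d2 flip: i_def x_def w_def, intro conjI)
      (use e g i w in algebra)+
qed

lemma N1_left_inverse: "\<exists>J. J ** N1 = mat 1"
proof -
  define i3 :: complex where "i3 = 1 / 3"
  have e: "3 * i3 = 1" by (simp add: i3_def)
  define g :: complex where "g = 1 / 2"
  have g: "2 * g = 1" by (simp add: g_def)
  define w where "w = \<omega>"
  have w: "w * w = - w - 1" unfolding w_def by (rule \<omega>_squared)
  define d where "d = i3 * (1 + 2 * w)"
  have "vector [vector [- g, g, 0], vector [g * d, g * d, - (d * w)],
      vector [- (g * d), - (g * d), 1 + d * w]] ** N1 = mat 1"
    unfolding N1_eq vec_eq_iff forall_3
    by (simp add: matrix_matrix_mult_def sum_3 mat_def flip: w_def, intro conjI)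
      (use e g w d_def in algebra)+
  then show ?thesis by blast
qed

lemma invertible_N1: "invertible N1"
  using N1_left_inverse invertible_left_inverse by blast

lemma low_frequency_estimate:
  "\<exists>h0>0. \<exists>C>0. h0 \<le> 1 \<and> (\<forall>h b W V t. 0 < h \<and> h \<le> h0 \<and> 0 < b \<and>
    evolves ((b * h) *\<^sub>R B0 + b *\<^sub>R B1) W \<and>
    evolves (- (b *\<^sub>R diag3 0 (1/2 + \<i> * sqrt3 / 2) (1/2 - \<i> * sqrt3 / 2)
         + (b * h\<^sup>2) *\<^sub>R diag3 1 (- 1/2 + \<i> * sqrt3 / 6) (- 1/2 - \<i> * sqrt3 / 6))) V \<and>
    V 0 = matrix_inv (mat 1 + h *\<^sub>R N2_coeff) *v (matrix_inv N1 *v W 0) \<and> 0 \<le> t \<longrightarrow>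
    norm (W t - (N1 ** (mat 1 + h *\<^sub>R N2_coeff)) *v V t)
      \<le> C * h * exp (- (b * h\<^sup>2) * t / 2) * norm (W 0))"
proof -
  obtain J where J: "J ** N1 = mat 1" using N1_left_inverse by blast
  define M where "M h = N1 + h *\<^sub>R low_M1 + h\<^sup>2 *\<^sub>R low_M2" for h
  define Q where "Q h = N1 ** (mat 1 + h *\<^sub>R N2_coeff)" for h
  define E where "E b h = (b * h^3) *\<^sub>R (low_E0 + h *\<^sub>R low_E1)" for b h
  define L where "L = norm low_M1 + norm low_M2 + norm (N1 ** N2_coeff) + norm low_E0 + norm low_E1"
  have M: "norm (M h - N1) \<le> L * h" if h: "0 < h" "h \<le> 1" for h
  proof -
    have "norm (M h - N1) \<le> norm (h *\<^sub>R low_M1) + norm (h\<^sup>2 *\<^sub>R low_M2)"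
      unfolding M_def using norm_triangle_ineq[of "h *\<^sub>R low_M1" "h\<^sup>2 *\<^sub>R low_M2"]
      by (simp add: add.assoc)
    also have "\<dots> \<le> h * norm low_M1 + h * norm low_M2"
      using h by (auto intro!: mult_right_mono simp: power2_eq_square mult_left_le mult_left_le_one_le)
    also have "\<dots> \<le> L * h"
      unfolding L_def using h by (simp add: algebra_simps)
    finally show ?thesis .
  qed
  have Q: "norm (Q h - N1) \<le> L * h" if h: "0 < h" "h \<le> 1" for h
    unfolding Q_def L_def using h
    by (simp add: matrix_add_ldistrib matrix_mult_scaleR_right algebra_simps)
  obtain h1 C where h1: "h1 > 0" "h1 \<le> 1" and C: "C > 0"
    and main: "\<And>h A \<Lambda> E k W V t. 0 < h \<and> h \<le> h1 \<and> 0 < k \<and>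
    A ** M h = M h ** \<Lambda> + E \<and> (\<forall>x. x \<bullet> (\<Lambda> *v x) \<le> - k * (norm x)\<^sup>2) \<and>
    norm E \<le> L * h * k \<and> evolves A W \<and> evolves \<Lambda> V \<and>
    Q h *v V 0 = W 0 \<and> 0 \<le> t \<Longrightarrow>
    norm (W t - Q h *v V t) \<le> C * h * exp (- k * t / 2) * norm (W 0)"
    using approximate_diagonalisation_small_parameter[OF J M Q] by (auto simp del: mult_minus_left)
  obtain h2 where h2: "h2 > 0" and inv: "\<And>h. 0 < h \<and> h \<le> h2 \<Longrightarrow> invertible (mat 1 + h *\<^sub>R N2_coeff)"
    using invertible_mat1_plus_small by blast
  define h0 where "h0 = min h1 (min h2 (1/2))"
  have h0: "h0 > 0" "h0 \<le> 1" using h1 h2 by (auto simp: h0_def)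
  show ?thesis
  proof (rule exI[of _ h0], intro conjI h0, rule exI[of _ C], intro conjI C h0 allI impI, elim conjE)
    fix h b W V and t :: real
    assume h: "0 < h" "h \<le> h0" and b: "0 < b"
      and W: "evolves ((b * h) *\<^sub>R B0 + b *\<^sub>R B1) W"
      and V: "evolves (- (b *\<^sub>R diag3 0 (1/2 + \<i> * sqrt3 / 2) (1/2 - \<i> * sqrt3 / 2)
         + (b * h\<^sup>2) *\<^sub>R diag3 1 (- 1/2 + \<i> * sqrt3 / 6) (- 1/2 - \<i> * sqrt3 / 6))) V"
      and init: "V 0 = matrix_inv (mat 1 + h *\<^sub>R N2_coeff) *v (matrix_inv N1 *v W 0)" and t: "0 \<le> t"
    have hh: "h \<le> 1/2" "h \<le> h1" "h \<le> h2" using h by (auto simp: h0_def)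
    have sc: "c *\<^sub>R z = complex_of_real c * z" for c and z :: complex
      by (rule scaleR_conv_of_real)
    have \<Lambda>: "- (b *\<^sub>R diag3 0 (1/2 + \<i> * sqrt3 / 2) (1/2 - \<i> * sqrt3 / 2)
         + (b * h\<^sup>2) *\<^sub>R diag3 1 (- 1/2 + \<i> * sqrt3 / 6) (- 1/2 - \<i> * sqrt3 / 6))
       = b *\<^sub>R low_\<Lambda> h"
      unfolding low_\<Lambda>_def diag3_def vec_eq_iff forall_3
      by (simp add: sc \<omega>_def field_simps)
    have hsq: "h * h \<le> 1/4" using hh h mult_mono[of h "1/2" h "1/2"] by simp
    have diss: "x \<bullet> ((b *\<^sub>R low_\<Lambda> h) *v x) \<le> - (b * h\<^sup>2) * (norm x)\<^sup>2" for x
    proof -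
      have "x \<bullet> (low_\<Lambda> h *v x) \<le> - (h\<^sup>2) * (norm x)\<^sup>2"
        unfolding low_\<Lambda>_def
        by (rule diag3_dissipative)
          (use hsq in \<open>simp_all add: \<omega>_def power2_eq_square field_simps\<close>)
      then have "b * (x \<bullet> (low_\<Lambda> h *v x)) \<le> b * (- (h\<^sup>2) * (norm x)\<^sup>2)"
        using b by (intro mult_left_mono) auto
      then show ?thesis by (simp add: scaleR_matrix_vector_mult)
    qed
    have "norm (W t - Q h *v V t) \<le> C * h * exp (- (b * h\<^sup>2) * t / 2) * norm (W 0)"
    proof (rule main[where A = "(b * h) *\<^sub>R B0 + b *\<^sub>R B1" and \<Lambda> = "b *\<^sub>R low_\<Lambda> h" and E = "E b h"],
        intro conjI)
      have "((b * h) *\<^sub>R B0 + b *\<^sub>R B1) ** M h = b *\<^sub>R ((h *\<^sub>R B0 + B1) ** M h)"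
        by (simp add: matrix_mult_scaleR_left[symmetric] scaleR_add_right)
      also have "\<dots> = b *\<^sub>R (M h ** low_\<Lambda> h + h^3 *\<^sub>R (low_E0 + h *\<^sub>R low_E1))"
        unfolding M_def low_intertwining ..
      also have "\<dots> = M h ** (b *\<^sub>R low_\<Lambda> h) + E b h"
        by (simp add: E_def matrix_mult_scaleR_right scaleR_add_right)
      finally show "((b * h) *\<^sub>R B0 + b *\<^sub>R B1) ** M h = M h ** (b *\<^sub>R low_\<Lambda> h) + E b h" .
      have "norm (low_E0 + h *\<^sub>R low_E1) \<le> norm low_E0 + norm low_E1"
        using h hh by (intro order.trans[OF norm_triangle_ineq] add_left_mono)
          (auto intro: mult_left_le_one_le)
      also have "\<dots> \<le> L" by (simp add: L_def)
      finally have "(b * h^3) * norm (low_E0 + h *\<^sub>R low_E1) \<le> (b * h^3) * L"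
        using b h by (intro mult_left_mono) auto
      then show "norm (E b h) \<le> L * h * (b * h\<^sup>2)"
        using b h by (simp add: E_def power3_eq_cube power2_eq_square mult_ac)
      show "Q h *v V 0 = W 0"
        using matrix_inv_mult(1)[OF inv[of h]] matrix_inv_mult(1)[OF invertible_N1] h hh
        unfolding Q_def init
        by (metis matrix_vector_mul_assoc matrix_vector_mul_lid)
    qed (use h hh b diss W V t \<Lambda> in auto)
    then show "norm (W t - (N1 ** (mat 1 + h *\<^sub>R N2_coeff)) *v V t)
      \<le> C * h * exp (- (b * h\<^sup>2) * t / 2) * norm (W 0)"
      unfolding Q_def .
  qed
qed

subsection \<open>High frequencies\<close>

definition N4_coeff :: "complex ^ 3 ^ 3" where
  "N4_coeff = vector [vector [0, 0, \<i>],
             vector [0, 0, - \<i>],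
             vector [\<i> / 2, - (\<i> / 2), 0]]"

definition N5_coeff :: "complex ^ 3 ^ 3" where
  "N5_coeff = vector [vector [0, 1/4, - 1],
             vector [1/4, 0, - 1],
             vector [- 1/2, - 1/2, 0]]"

text \<open>At high frequencies the matrix is a multiple of \<open>B0 + h B1\<close>, whose eigenvalues expand as
\<open>\<plusminus> i (1 + h\<^sup>2 / 2) - h\<^sup>3 / 2 + O(h\<^sup>4)\<close> and \<open>- h + h\<^sup>3 + O(h\<^sup>5)\<close>.  With \<open>\<lambda>\<close> an eigenvalue,
eigenvectors are \<open>(h (\<lambda> + i), h (\<lambda> - i), \<lambda>\<^sup>2 + 1)\<close>; rescaled to start at the unit vectors, their expansions to
third order have first- and second-order coefficients \<open>N4_coeff\<close> and \<open>N5_coeff\<close>, and \<open>high_M3\<close> is the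
third-order one.\<close>

definition high_M3 :: "complex ^ 3 ^ 3" where
  "high_M3 = vector [vector [0, - \<i> / 4, - \<i>],
                     vector [\<i> / 4, 0, \<i>],
                     vector [- 5 * \<i> / 8, 5 * \<i> / 8, 0]]"

definition high_E0 :: "complex ^ 3 ^ 3" where
  "high_E0 = vector [vector [- 5 * \<i> / 8, 3 * \<i> / 4, - 2 * \<i>],
                     vector [- 3 * \<i> / 4, 5 * \<i> / 8, 2 * \<i>],
                     vector [\<i>, - \<i>, 0]]"

definition high_E1 :: "complex ^ 3 ^ 3" where
  "high_E1 = vector [vector [0, 1/4, 1],
                     vector [1/4, 0, 1],
                     vector [- 9/16, - 9/16, 0]]"

definition high_E2 :: "complex ^ 3 ^ 3" where
  "high_E2 = vector [vector [0, - \<i> / 8, \<i>],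
                     vector [\<i> / 8, 0, - \<i>],
                     vector [- 5 * \<i> / 16, 5 * \<i> / 16, 0]]"

definition high_\<Lambda> :: "real \<Rightarrow> complex ^ 3 ^ 3" where
  "high_\<Lambda> h = diag3 (\<i> + \<i> / 2 * (complex_of_real h)\<^sup>2 - (complex_of_real h)^3 / 2)
     (- \<i> - \<i> / 2 * (complex_of_real h)\<^sup>2 - (complex_of_real h)^3 / 2)
     (- complex_of_real h + (complex_of_real h)^3)"

text \<open>The slowest eigenvalues have real part of order \<open>h\<^sup>3\<close>, so here the residual has to be \<open>O(h\<^sup>4)\<close>, which takes
the third-order correction \<open>high_M3\<close> on top of the basis suggested by the profile.\<close>

lemma high_intertwining:
  "(B0 + h *\<^sub>R B1) ** (mat 1 + h *\<^sub>R N4_coeff + h\<^sup>2 *\<^sub>R N5_coeff + h^3 *\<^sub>R high_M3)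
   = (mat 1 + h *\<^sub>R N4_coeff + h\<^sup>2 *\<^sub>R N5_coeff + h^3 *\<^sub>R high_M3) ** high_\<Lambda> h
     + h^4 *\<^sub>R (high_E0 + h *\<^sub>R high_E1 + h\<^sup>2 *\<^sub>R high_E2)"
proof -
  define e :: complex where "e = 1 / 16"
  have e: "16 * e = 1" and d16: "x / 16 = e * x"  and d8: "x / 8 = (2 * e) * x"
    and d4: "x / 4 = (4 * e) * x"  and d2: "x / 2 = (8 * e) * x" for x by (simp_all add: e_def)
  define i where "i = \<i>"
  have i: "i * i = - 1" by (simp add: i_def)
  define x where "x = complex_of_real h"
  have scale: "c *\<^sub>R z = complex_of_real c * z" for c and z :: complex
    by (rule scaleR_conv_of_real)
  show ?thesis
    unfolding vec_eq_iff forall_3 N4_coeff_def N5_coeff_def high_M3_def high_E0_def high_E1_def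
      high_E2_def high_\<Lambda>_def diag3_def B0_def B1_def
    by (simp add: matrix_matrix_mult_def sum_3 scale mat_def d16 d8 d4 d2 flip: i_def x_def,
        intro conjI)
      (use e i in \<open>algebra\<close>
        | simp add: algebra_simps power2_eq_square power3_eq_cube power4_eq_xxxx)+
qed

lemma high_frequency_estimate:
  "\<exists>h0>0. \<exists>C>0. h0 \<le> 1 \<and> (\<forall>h a W V t. 0 < h \<and> h \<le> h0 \<and> 0 < a \<and>
    evolves (a *\<^sub>R B0 + (a * h) *\<^sub>R B1) W \<and>
    evolves (- (a *\<^sub>R diag3 (- \<i>) \<i> 0 + (a * h) *\<^sub>R diag3 0 0 1
         + (a * h\<^sup>2) *\<^sub>R diag3 (- (\<i> / 2)) (\<i> / 2) 0
         + (a * h^3) *\<^sub>R diag3 (1/2) (1/2) (- 1))) V \<and>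
    V 0 = matrix_inv (mat 1 + h\<^sup>2 *\<^sub>R N5_coeff) *v (matrix_inv (mat 1 + h *\<^sub>R N4_coeff) *v W 0) \<and> 0 \<le> t \<longrightarrow>
    norm (W t - ((mat 1 + h *\<^sub>R N4_coeff) ** (mat 1 + h\<^sup>2 *\<^sub>R N5_coeff)) *v V t)
      \<le> C * h * exp (- (a * h^3 / 2) * t / 2) * norm (W 0))"
proof -
  define M where "M h = mat 1 + h *\<^sub>R N4_coeff + h\<^sup>2 *\<^sub>R N5_coeff + h^3 *\<^sub>R high_M3" for h
  define Q where "Q h = (mat 1 + h *\<^sub>R N4_coeff) ** (mat 1 + h\<^sup>2 *\<^sub>R N5_coeff)" for h
  define E where "E a h = (a * h^4) *\<^sub>R (high_E0 + h *\<^sub>R high_E1 + h\<^sup>2 *\<^sub>R high_E2)" for a h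
  define L where "L = norm N4_coeff + norm N5_coeff + norm high_M3 + norm (N4_coeff ** N5_coeff)
    + 2 * (norm high_E0 + norm high_E1 + norm high_E2)"
  have pows: "h\<^sup>2 \<le> h" "h^3 \<le> h" if "0 < h" "h \<le> 1" for h :: real
    using that power_decreasing[of 1 2 h] power_decreasing[of 1 3 h] by auto
  have M: "norm (M h - mat 1) \<le> L * h" if h: "0 < h" "h \<le> 1" for h
  proof -
    have "M h - mat 1 = h *\<^sub>R N4_coeff + (h\<^sup>2 *\<^sub>R N5_coeff + h^3 *\<^sub>R high_M3)"
      by (simp add: M_def)
    also have "norm \<dots> \<le> norm (h *\<^sub>R N4_coeff) + (norm (h\<^sup>2 *\<^sub>R N5_coeff) + norm (h^3 *\<^sub>R high_M3))"
      by (intro order.trans[OF norm_triangle_ineq] add_left_mono norm_triangle_ineq)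
    also have "\<dots> \<le> h * norm N4_coeff + (h * norm N5_coeff + h * norm high_M3)"
      using h pows[OF h] by (simp add: add_mono mult_right_mono)
    also have "\<dots> \<le> L * h"
      unfolding L_def using h by (simp add: algebra_simps)
    finally show ?thesis .
  qed
  have Q: "norm (Q h - mat 1) \<le> L * h" if h: "0 < h" "h \<le> 1" for h
  proof -
    have "Q h - mat 1 = h *\<^sub>R N4_coeff + (h\<^sup>2 *\<^sub>R N5_coeff + h^3 *\<^sub>R (N4_coeff ** N5_coeff))"
      unfolding Q_def
      by (simp add: matrix_add_ldistrib matrix_mult_add_rdistrib matrix_mult_scaleR_right
          matrix_mult_scaleR_left power2_eq_square power3_eq_cube scaleR_add_right mult_ac)
    also have "norm \<dots> \<le> norm (h *\<^sub>R N4_coeff)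
        + (norm (h\<^sup>2 *\<^sub>R N5_coeff) + norm (h^3 *\<^sub>R (N4_coeff ** N5_coeff)))"
      by (intro order.trans[OF norm_triangle_ineq] add_left_mono norm_triangle_ineq)
    also have "\<dots> \<le> h * norm N4_coeff + (h * norm N5_coeff + h * norm (N4_coeff ** N5_coeff))"
      using h pows[OF h] by (simp add: add_mono mult_right_mono)
    also have "\<dots> \<le> L * h"
      unfolding L_def using h by (simp add: algebra_simps)
    finally show ?thesis .
  qed
  have J: "mat 1 ** mat 1 = (mat 1 :: complex ^ 3 ^ 3)" by simp
  obtain h1 C where h1: "h1 > 0" "h1 \<le> 1" and C: "C > 0"
    and main: "\<And>h A \<Lambda> E k W V t. 0 < h \<and> h \<le> h1 \<and> 0 < k \<and>
    A ** M h = M h ** \<Lambda> + E \<and> (\<forall>x. x \<bullet> (\<Lambda> *v x) \<le> - k * (norm x)\<^sup>2) \<and>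
    norm E \<le> L * h * k \<and> evolves A W \<and> evolves \<Lambda> V \<and>
    Q h *v V 0 = W 0 \<and> 0 \<le> t \<Longrightarrow>
    norm (W t - Q h *v V t) \<le> C * h * exp (- k * t / 2) * norm (W 0)"
    using approximate_diagonalisation_small_parameter[OF J M Q] by (auto simp del: mult_minus_left)
  obtain h2 where h2: "h2 > 0" and inv4: "\<And>h. 0 < h \<and> h \<le> h2 \<Longrightarrow> invertible (mat 1 + h *\<^sub>R N4_coeff)"
    using invertible_mat1_plus_small by blast
  obtain h3 where h3: "h3 > 0" and inv5: "\<And>h. 0 < h \<and> h \<le> h3 \<Longrightarrow> invertible (mat 1 + h *\<^sub>R N5_coeff)"
    using invertible_mat1_plus_small by blast
  define h0 where "h0 = min h1 (min h2 (min h3 (1/2)))"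
  have h0: "h0 > 0" "h0 \<le> 1" using h1 h2 h3 by (auto simp: h0_def)
  show ?thesis
  proof (rule exI[of _ h0], intro conjI h0, rule exI[of _ C], intro conjI C h0 allI impI, elim conjE)
    fix h a W V and t :: real
    let ?\<Lambda> = "- (a *\<^sub>R diag3 (- \<i>) \<i> 0 + (a * h) *\<^sub>R diag3 0 0 1
         + (a * h\<^sup>2) *\<^sub>R diag3 (- (\<i> / 2)) (\<i> / 2) 0
         + (a * h^3) *\<^sub>R diag3 (1/2) (1/2) (- 1))"
    assume h: "0 < h" "h \<le> h0" and a: "0 < a"
      and W: "evolves (a *\<^sub>R B0 + (a * h) *\<^sub>R B1) W"
      and V: "evolves ?\<Lambda> V"
      and init: "V 0 = matrix_inv (mat 1 + h\<^sup>2 *\<^sub>R N5_coeff) *v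
        (matrix_inv (mat 1 + h *\<^sub>R N4_coeff) *v W 0)" and t: "0 \<le> t"
    have hh: "h \<le> 1/2" "h \<le> h1" "h \<le> h2" "h \<le> h3" using h by (auto simp: h0_def)
    have sc: "c *\<^sub>R z = complex_of_real c * z" for c and z :: complex
      by (rule scaleR_conv_of_real)
    have \<Lambda>: "?\<Lambda> = a *\<^sub>R high_\<Lambda> h"
      unfolding high_\<Lambda>_def diag3_def vec_eq_iff forall_3
      by (simp add: sc field_simps)
    have hsq: "h * h \<le> 1/4" using hh h mult_mono[of h "1/2" h "1/2"] by simp
    have diss: "x \<bullet> ((a *\<^sub>R high_\<Lambda> h) *v x) \<le> - (a * h^3 / 2) * (norm x)\<^sup>2" for x
    proof -
      have "h * (h * h) \<le> h * (1/4)"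
        using h hsq by (intro mult_left_mono) auto
      then have "- h + h^3 \<le> - (h^3 / 2)"
        using h unfolding power3_eq_cube mult.assoc by argo
      then have "x \<bullet> (high_\<Lambda> h *v x) \<le> - (h^3 / 2) * (norm x)\<^sup>2"
        unfolding high_\<Lambda>_def
        by (intro diag3_dissipative) (simp_all flip: of_real_power)
      then have "a * (x \<bullet> (high_\<Lambda> h *v x)) \<le> a * (- (h^3 / 2) * (norm x)\<^sup>2)"
        using a by (intro mult_left_mono) auto
      then show ?thesis by (simp add: scaleR_matrix_vector_mult)
    qed
    have "norm (W t - Q h *v V t) \<le> C * h * exp (- (a * h^3 / 2) * t / 2) * norm (W 0)"
    proof (rule main[where A = "a *\<^sub>R B0 + (a * h) *\<^sub>R B1" and \<Lambda> = "a *\<^sub>R high_\<Lambda> h" and E = "E a h"],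
        intro conjI)
      have "(a *\<^sub>R B0 + (a * h) *\<^sub>R B1) ** M h = a *\<^sub>R ((B0 + h *\<^sub>R B1) ** M h)"
        by (simp add: matrix_mult_scaleR_left[symmetric] scaleR_add_right)
      also have "\<dots> = a *\<^sub>R (M h ** high_\<Lambda> h + h^4 *\<^sub>R (high_E0 + h *\<^sub>R high_E1 + h\<^sup>2 *\<^sub>R high_E2))"
        unfolding M_def high_intertwining ..
      also have "\<dots> = M h ** (a *\<^sub>R high_\<Lambda> h) + E a h"
        by (simp only: E_def matrix_mult_scaleR_right scaleR_add_right[of a] scaleR_scaleR)
      finally show "(a *\<^sub>R B0 + (a * h) *\<^sub>R B1) ** M h = M h ** (a *\<^sub>R high_\<Lambda> h) + E a h" .
      have "norm (high_E0 + h *\<^sub>R high_E1 + h\<^sup>2 *\<^sub>R high_E2)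
          \<le> norm high_E0 + norm (h *\<^sub>R high_E1) + norm (h\<^sup>2 *\<^sub>R high_E2)"
        by (intro order.trans[OF norm_triangle_ineq] add_right_mono norm_triangle_ineq)
      also have "\<dots> \<le> norm high_E0 + norm high_E1 + norm high_E2"
        using h hh by (intro add_mono) (auto intro!: mult_left_le_one_le power_le_one)
      also have "\<dots> \<le> L / 2"
        unfolding L_def by (simp add: field_simps)
      finally have "(a * h^4) * norm (high_E0 + h *\<^sub>R high_E1 + h\<^sup>2 *\<^sub>R high_E2) \<le> (a * h^4) * (L / 2)"
        using a h by (intro mult_left_mono) auto
      then show "norm (E a h) \<le> L * h * (a * h^3 / 2)"
        using a h by (simp add: E_def power3_eq_cube power4_eq_xxxx mult_ac)
      have "h\<^sup>2 \<le> h" using pows[of h] hh h by auto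
      then have i5: "invertible (mat 1 + h\<^sup>2 *\<^sub>R N5_coeff)"
        using hh h by (intro inv5) auto
      show "Q h *v V 0 = W 0"
        using matrix_inv_mult(1)[OF inv4[of h]] matrix_inv_mult(1)[OF i5] h hh
        unfolding Q_def init
        by (metis matrix_vector_mul_assoc matrix_vector_mul_lid)
    qed (use h hh a diss W V t \<Lambda> in auto)
    then show "norm (W t - ((mat 1 + h *\<^sub>R N4_coeff) ** (mat 1 + h\<^sup>2 *\<^sub>R N5_coeff)) *v V t)
      \<le> C * h * exp (- (a * h^3 / 2) * t / 2) * norm (W 0)"
      unfolding Q_def .
  qed
qed

subsection \<open>Intermediate frequencies\<close>

text \<open>The dissipation inequality behind the energy of \<open>mid_frequency_estimate\<close>: \<open>x\<close>, \<open>y\<close>, \<open>w\<close> stand for the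
moduli of \<open>z = W$3\<close>, \<open>p = W$1 + W$2\<close>, \<open>q = W$1 - W$2\<close>, and \<open>S1\<close>, \<open>S2\<close> for the products of \<open>z\<close> with \<open>p\<close> and
\<open>i q\<close>.  The weights \<open>1\<close>, \<open>\<eta>\<^sup>2\<close>, \<open>\<eta>\<^sup>3\<close> of the three dissipative terms form a hierarchy in which every mixed
term is absorbed: consecutive weights have a small ratio, and \<open>(\<eta>\<^sup>2)\<^sup>2\<close> is small compared with \<open>1 \<cdot> \<eta>\<^sup>3\<close>.\<close>

lemma hypocoercive_form_bound:
  fixes a b m K \<eta> x y w S1 S2 :: real
  assumes m: "0 < m" "m \<le> a" "m \<le> b" and K: "1 \<le> K" "a \<le> K * b" "b \<le> K * a"
    and \<eta>: "\<eta> = 1 / (16 * K)"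
    and S: "\<bar>S1\<bar> \<le> x * y" "\<bar>S2\<bar> \<le> x * w" and nonneg: "0 \<le> x" "0 \<le> y" "0 \<le> w"
  shows "- 2 * b * x\<^sup>2 + \<eta>\<^sup>2 * (- b / 2 * y\<^sup>2 - b * S1 + a * S2 + 2 * b * x\<^sup>2)
      - \<eta>^3 * (a * w\<^sup>2 + 2 * b * S2 - a * y\<^sup>2) \<le> - (m * \<eta>^3 / 4) * (x\<^sup>2 + y\<^sup>2 + w\<^sup>2)"
proof -
  have ab: "0 < a" "0 < b" using m by auto
  have \<eta>0: "0 < \<eta>" "\<eta> \<le> 1/16" "\<eta> * K = 1/16"
    using K unfolding \<eta> by (auto simp: field_simps)
  have \<eta>2: "\<eta>\<^sup>2 \<le> 1/256" using power_mono[of \<eta> "1/16" 2] \<eta>0 by (simp add: power2_eq_square)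
  have \<eta>3: "\<eta>^3 \<le> \<eta>\<^sup>2" using \<eta>0 power_decreasing[of 2 3 \<eta>] by simp
  have 1: "- (\<eta>\<^sup>2 * (b * S1)) \<le> \<eta>\<^sup>2 * (b * (y\<^sup>2 / 8 + 2 * x\<^sup>2))"
  proof -
    have "0 \<le> (y / 2 - 2 * x)\<^sup>2" by simp
    then have "x * y \<le> y\<^sup>2 / 8 + 2 * x\<^sup>2"
      by (simp add: power2_eq_square algebra_simps)
    with S have "- S1 \<le> y\<^sup>2 / 8 + 2 * x\<^sup>2" by linarith
    then have "\<eta>\<^sup>2 * (b * (- S1)) \<le> \<eta>\<^sup>2 * (b * (y\<^sup>2 / 8 + 2 * x\<^sup>2))"
      using ab by (intro mult_left_mono) auto
    then show ?thesis by simp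
  qed
  have 2: "\<eta>\<^sup>2 * (a * S2) \<le> a * (\<eta>^3 * w\<^sup>2 / 4 + \<eta> * x\<^sup>2)"
  proof -
    have "0 \<le> \<eta> * (\<eta> * w / 2 - x)\<^sup>2" using \<eta>0 by simp
    then have "\<eta>\<^sup>2 * (x * w) \<le> \<eta>^3 * w\<^sup>2 / 4 + \<eta> * x\<^sup>2"
      by (simp add: power2_eq_square power3_eq_cube algebra_simps)
    moreover have "\<eta>\<^sup>2 * S2 \<le> \<eta>\<^sup>2 * (x * w)" using S by (intro mult_left_mono) auto
    ultimately have "a * (\<eta>\<^sup>2 * S2) \<le> a * (\<eta>^3 * w\<^sup>2 / 4 + \<eta> * x\<^sup>2)"
      using ab by (intro mult_left_mono) auto
    then show ?thesis by (simp add: mult_ac)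
  qed
  have 3: "- (\<eta>^3 * (2 * b * S2)) \<le> \<eta>^3 * (a * w\<^sup>2 / 4 + 4 * K * b * x\<^sup>2)"
  proof -
    have "0 \<le> b / K * (w / 2 - 2 * K * x)\<^sup>2" using ab K by simp
    also have "\<dots> = (b / K) * w\<^sup>2 / 4 - 2 * b * (x * w) + 4 * K * b * x\<^sup>2"
      using K by (simp add: power2_eq_square field_simps)
    also have "(b / K) * w\<^sup>2 / 4 \<le> a * w\<^sup>2 / 4"
      using K by (intro divide_right_mono mult_right_mono) (auto simp: field_simps)
    finally have "2 * b * (x * w) \<le> a * w\<^sup>2 / 4 + 4 * K * b * x\<^sup>2" by simp
    moreover have "2 * b * (- S2) \<le> 2 * b * (x * w)"
      using S ab by (intro mult_left_mono) auto
    ultimately have "2 * b * (- S2) \<le> a * w\<^sup>2 / 4 + 4 * K * b * x\<^sup>2" by (rule order.trans[rotated])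
    then have "\<eta>^3 * (2 * b * (- S2)) \<le> \<eta>^3 * (a * w\<^sup>2 / 4 + 4 * K * b * x\<^sup>2)"
      using \<eta>0 by (intro mult_left_mono) auto
    then show ?thesis by simp
  qed
  have X: "(- 2 * b + 4 * \<eta>\<^sup>2 * b + \<eta> * a + 4 * K * \<eta>^3 * b) * x\<^sup>2 \<le> - (m * \<eta>^3 / 4) * x\<^sup>2"
  proof (rule mult_right_mono)
    have "\<eta> * a \<le> \<eta> * (K * b)" using K \<eta>0 by (intro mult_left_mono) auto
    also have "\<dots> = b / 16" using \<eta>0 by (simp add: mult.assoc[symmetric])
    finally have t1: "\<eta> * a \<le> b / 16" .
    have t2: "\<eta>\<^sup>2 * b \<le> 1/256 * b" using \<eta>2 ab by (intro mult_right_mono) auto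
    have "4 * K * \<eta>^3 * b = 4 * (\<eta> * K) * (\<eta>\<^sup>2 * b)"
      by (simp add: power2_eq_square power3_eq_cube)
    also have "\<dots> = (\<eta>\<^sup>2 * b) / 4" by (simp add: \<eta>0)
    finally have t3: "4 * K * \<eta>^3 * b = (\<eta>\<^sup>2 * b) / 4" .
    have "\<eta>^3 \<le> 1" using \<eta>2 \<eta>3 by linarith
    then have "m * \<eta>^3 \<le> b * 1"
      using m ab \<eta>0 by (intro mult_mono) auto
    with t1 t2 t3 ab show "- 2 * b + 4 * \<eta>\<^sup>2 * b + \<eta> * a + 4 * K * \<eta>^3 * b \<le> - (m * \<eta>^3 / 4)"
      by linarith
  qed simp
  have Y: "(- \<eta>\<^sup>2 * b / 2 + \<eta>\<^sup>2 * b / 8 + \<eta>^3 * a) * y\<^sup>2 \<le> - (m * \<eta>^3 / 4) * y\<^sup>2"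
  proof (rule mult_right_mono)
    have "\<eta>^3 * a \<le> \<eta>^3 * (K * b)" using K \<eta>0 by (intro mult_left_mono) auto
    also have "\<dots> = \<eta>\<^sup>2 * b * (\<eta> * K)" by (simp add: power2_eq_square power3_eq_cube)
    finally have t1: "\<eta>^3 * a \<le> \<eta>\<^sup>2 * b / 16" by (simp add: \<eta>0)
    have "m * \<eta>^3 \<le> b * \<eta>\<^sup>2"
      using m ab \<eta>0 \<eta>2 \<eta>3 by (intro mult_mono) auto
    moreover have "0 \<le> \<eta>\<^sup>2 * b" using ab by simp
    ultimately show "- \<eta>\<^sup>2 * b / 2 + \<eta>\<^sup>2 * b / 8 + \<eta>^3 * a \<le> - (m * \<eta>^3 / 4)"
      using t1 by (simp add: mult.commute[of b])
  qed simp
  have W: "(- (\<eta>^3 * a / 2)) * w\<^sup>2 \<le> - (m * \<eta>^3 / 4) * w\<^sup>2"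
  proof (rule mult_right_mono)
    have "m * \<eta>^3 \<le> a * \<eta>^3" using m \<eta>0 by (intro mult_right_mono) auto
    moreover have "0 \<le> a * \<eta>^3" using ab \<eta>0 by simp
    ultimately show "- (\<eta>^3 * a / 2) \<le> - (m * \<eta>^3 / 4)" by (simp add: mult.commute)
  qed simp
  show ?thesis using 1 2 3 X Y W by (simp add: field_simps)
qed

text \<open>The natural energy \<open>|W$1|\<^sup>2 / 2 + |W$2|\<^sup>2 / 2 + |W$3|\<^sup>2\<close> dissipates only through \<open>z = W$3\<close>.  But \<open>z\<close> is
driven by \<open>p = W$1 + W$2\<close>, and \<open>p\<close> by \<open>q = W$1 - W$2\<close>, so adding small multiples of the correctors
\<open>z \<bullet> p\<close> and \<open>- p \<bullet> (i q)\<close> produces dissipation of \<open>p\<close> and \<open>q\<close> as well.\<close>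

lemma mid_frequency_estimate:
  assumes m: "0 < m"
  shows "\<exists>c>0. \<exists>C>0. \<forall>a b W t. m \<le> a \<and> a \<le> B \<and> m \<le> b \<and> b \<le> B \<and>
    evolves (a *\<^sub>R B0 + b *\<^sub>R B1) W \<and> 0 \<le> t \<longrightarrow>
    norm (W t) \<le> C * exp (- c * t) * norm (W 0)"
proof -
  \<comment> \<open>\<open>K\<close> bounds both ratios \<open>a / b\<close> and \<open>b / a\<close>.\<close>
  define K where "K = max 1 (B / m)"
  define \<eta> where "\<eta> = 1 / (16 * K)"
  have K: "K \<ge> 1" by (simp add: K_def)
  have \<eta>0: "0 < \<eta>" "\<eta> \<le> 1/16"
    using K unfolding \<eta>_def by (auto simp: field_simps)
  have \<eta>2: "\<eta>\<^sup>2 \<le> 1/16" "\<eta>^3 \<le> 1/16"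
    using \<eta>0 power_decreasing[of 1 2 \<eta>] power_decreasing[of 1 3 \<eta>] by auto
  define c where "c = m * \<eta>^3 / 16"
  have c: "c > 0" using m \<eta>0 by (simp add: c_def)
  show ?thesis
  proof (rule exI[of _ c], intro conjI c, rule exI[of _ 6], intro conjI allI impI, simp, elim conjE)
    fix a b W and t :: real
    assume ab: "m \<le> a" "a \<le> B" "m \<le> b" "b \<le> B" and W: "evolves (a *\<^sub>R B0 + b *\<^sub>R B1) W" and t: "0 \<le> t"
    have cont: "continuous_on {0..} W"
      and W': "\<forall>t>0. (W has_vector_derivative (a *\<^sub>R B0 + b *\<^sub>R B1) *v W t) (at t)"
      using W by (auto simp: evolves_def)
    have BK: "B \<le> K * m" using m by (simp add: K_def max_def field_simps)
    have aK: "a \<le> K * b" and bK: "b \<le> K * a"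
      using BK ab K mult_left_mono[of m b K] mult_left_mono[of m a K] by linarith+
    define p q z where "p t = W t $ 1 + W t $ 2" and "q t = W t $ 1 - W t $ 2" and "z t = W t $ 3" for t
    define S where "S t = (norm (z t))\<^sup>2 + (norm (p t))\<^sup>2 + (norm (q t))\<^sup>2" for t
    define \<phi> where "\<phi> t = 1/4 * (p t \<bullet> p t + q t \<bullet> q t) + z t \<bullet> z t + \<eta>\<^sup>2 * (z t \<bullet> p t)
      - \<eta>^3 * (p t \<bullet> (\<i> * q t))" for t
    define \<phi>' where "\<phi>' t = - 2 * b * (norm (z t))\<^sup>2 + \<eta>\<^sup>2 * (- b / 2 * (norm (p t))\<^sup>2 - b * (z t \<bullet> p t)
        + a * (z t \<bullet> (\<i> * q t)) + 2 * b * (norm (z t))\<^sup>2)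
      - \<eta>^3 * (a * (norm (q t))\<^sup>2 + 2 * b * (z t \<bullet> (\<i> * q t)) - a * (norm (p t))\<^sup>2)" for t
    have S1: "\<bar>z t \<bullet> p t\<bar> \<le> norm (z t) * norm (p t)"
      and S2: "\<bar>z t \<bullet> (\<i> * q t)\<bar> \<le> norm (z t) * norm (q t)"
      and S3: "\<bar>p t \<bullet> (\<i> * q t)\<bar> \<le> norm (p t) * norm (q t)" for t
      using Cauchy_Schwarz_ineq2[of "z t" "p t"] Cauchy_Schwarz_ineq2[of "z t" "\<i> * q t"]
        Cauchy_Schwarz_ineq2[of "p t" "\<i> * q t"] by (simp_all add: norm_mult)
    have amgm: "2 * (x * y) \<le> x\<^sup>2 + y\<^sup>2" for x y :: real
      using sum_squares_bound[of x y] by simp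
    have half: "r \<le> (u + v + w) / 2" if "r \<le> xy" "2 * xy \<le> u + v" "0 \<le> w" for r xy u v w :: real
      using that by simp
    have cross: "\<bar>\<eta>\<^sup>2 * (z t \<bullet> p t)\<bar> \<le> 1/32 * S t" "\<bar>\<eta>^3 * (p t \<bullet> (\<i> * q t))\<bar> \<le> 1/32 * S t" for t
    proof -
      have "\<bar>z t \<bullet> p t\<bar> \<le> S t / 2"
        unfolding S_def by (rule half[OF S1 amgm zero_le_power2])
      moreover have "\<bar>p t \<bullet> (\<i> * q t)\<bar> \<le> S t / 2"
        using half[OF S3 amgm zero_le_power2[of "norm (z t)"]] unfolding S_def by (simp add: add_ac)
      ultimately have "\<eta>\<^sup>2 * \<bar>z t \<bullet> p t\<bar> \<le> 1/16 * (S t / 2)" "\<eta>^3 * \<bar>p t \<bullet> (\<i> * q t)\<bar> \<le> 1/16 * (S t / 2)"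
        using \<eta>2 \<eta>0 by (intro mult_mono; simp)+
      then show "\<bar>\<eta>\<^sup>2 * (z t \<bullet> p t)\<bar> \<le> 1/32 * S t" "\<bar>\<eta>^3 * (p t \<bullet> (\<i> * q t))\<bar> \<le> 1/32 * S t"
        using \<eta>0 by (simp_all add: abs_mult)
    qed
    have \<phi>_lower: "S t / 8 \<le> \<phi> t" and \<phi>_upper: "\<phi> t \<le> 2 * S t" for t
    proof -
      have "\<phi> t = ((norm (p t))\<^sup>2 + (norm (q t))\<^sup>2) / 4 + (norm (z t))\<^sup>2
          + \<eta>\<^sup>2 * (z t \<bullet> p t) - \<eta>^3 * (p t \<bullet> (\<i> * q t))"
        by (simp add: \<phi>_def dot_square_norm)
      moreover have "S t / 4 \<le> ((norm (p t))\<^sup>2 + (norm (q t))\<^sup>2) / 4 + (norm (z t))\<^sup>2"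
        "((norm (p t))\<^sup>2 + (norm (q t))\<^sup>2) / 4 + (norm (z t))\<^sup>2 \<le> S t" "0 \<le> S t"
        unfolding S_def by (simp_all add: field_simps)
      ultimately show "S t / 8 \<le> \<phi> t" and "\<phi> t \<le> 2 * S t"
        using cross[of t] by argo+
    qed
    have "\<phi> t \<le> exp (- (2 * c) * t) * \<phi> 0"
    proof (rule exponential_decay[where \<phi>' = \<phi>'])
      show "continuous_on {0..} \<phi>"
        unfolding \<phi>_def p_def q_def z_def using cont by (intro continuous_intros) auto
    next
      fix t :: real assume t: "t > 0"
      have sc: "r *\<^sub>R u = complex_of_real r * u" for r and u :: complex
        by (rule scaleR_conv_of_real)
      have comp: "((\<lambda>t. W t $ i) has_vector_derivative ((a *\<^sub>R B0 + b *\<^sub>R B1) *v W t) $ i) (at t)" for i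
        using bounded_linear.has_vector_derivative[OF bounded_linear_vec_nth W'[rule_format, OF t]] .
      have dp: "(p has_derivative (\<lambda>h. h *\<^sub>R (\<i> * of_real a * q t + 2 * of_real b * z t))) (at t)"
        using has_vector_derivative_add[OF comp[of 1] comp[of 2]]
        unfolding p_def[abs_def] has_vector_derivative_def
        by (simp add: matrix_vector_mult_def sum_3 B0_def B1_def q_def z_def sc algebra_simps)
      have dq: "(q has_derivative (\<lambda>h. h *\<^sub>R (\<i> * of_real a * p t))) (at t)"
        using has_vector_derivative_diff[OF comp[of 1] comp[of 2]]
        unfolding q_def[abs_def] has_vector_derivative_def
        by (simp add: matrix_vector_mult_def sum_3 B0_def B1_def p_def sc algebra_simps)
      have dz: "(z has_derivative (\<lambda>h. h *\<^sub>R (- (of_real b / 2) * p t - of_real b * z t))) (at t)"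
        using comp[of 3]
        unfolding z_def[abs_def] has_vector_derivative_def
        by (rule has_derivative_eq_rhs)
          (auto simp: fun_eq_iff matrix_vector_mult_def sum_3 B0_def B1_def p_def sc field_simps)
      have "(\<phi> has_derivative (\<lambda>h. h * \<phi>' t)) (at t)"
        unfolding \<phi>_def \<phi>'_def dot_square_norm[symmetric]
        by (rule has_derivative_eq_rhs, (rule derivative_intros dp dq dz)+, rule ext,
            simp add: inner_complex_def, algebra)
      then show "(\<phi> has_real_derivative \<phi>' t) (at t)"
        by (simp add: has_field_derivative_def mult_commute_abs)
      have "\<phi>' t \<le> - (m * \<eta>^3 / 4) * S t"
        unfolding \<phi>'_def S_def
        by (rule hypocoercive_form_bound[OF m ab(1) ab(3) K aK bK \<eta>_def S1 S2]) auto
      also have "\<dots> = - (2 * c) * (2 * S t)" by (simp add: c_def)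
      also have "\<dots> \<le> - (2 * c) * \<phi> t"
        using \<phi>_upper[of t] c by simp
      finally show "\<phi>' t \<le> - (2 * c) * \<phi> t" .
    qed fact
    moreover have norm_W: "(norm (W t))\<^sup>2 \<le> S t" "S t \<le> 2 * (norm (W t))\<^sup>2" for t
    proof -
      have n: "(norm (W t))\<^sup>2 = (norm (W t $ 1))\<^sup>2 + (norm (W t $ 2))\<^sup>2 + (norm (W t $ 3))\<^sup>2"
        by (simp add: power2_norm_eq_inner inner_vec_def sum_3)
      have s: "S t = (norm (W t $ 3))\<^sup>2 + 2 * ((norm (W t $ 1))\<^sup>2 + (norm (W t $ 2))\<^sup>2)"
        unfolding S_def p_def q_def z_def
        by (simp add: power2_norm_eq_inner inner_add_left inner_add_right inner_diff_left inner_diff_right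
            inner_commute)
      show "(norm (W t))\<^sup>2 \<le> S t" "S t \<le> 2 * (norm (W t))\<^sup>2"
        unfolding n s by simp_all
    qed
    ultimately have "(norm (W t))\<^sup>2 \<le> 8 * (exp (- (2 * c) * t) * (4 * (norm (W 0))\<^sup>2))"
    proof -
      assume d: "\<phi> t \<le> exp (- (2 * c) * t) * \<phi> 0"
      have "\<phi> 0 \<le> 4 * (norm (W 0))\<^sup>2"
        using \<phi>_upper[of 0] norm_W(2)[of 0] by simp
      then have "exp (- (2 * c) * t) * \<phi> 0 \<le> exp (- (2 * c) * t) * (4 * (norm (W 0))\<^sup>2)"
        by (intro mult_left_mono) auto
      with d \<phi>_lower[of t] norm_W(1)[of t] show ?thesis by linarith
    qed
    also have "\<dots> = 32 * (exp (- c * t) * norm (W 0))\<^sup>2"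
      by (simp add: power_mult_distrib exp_double[symmetric] mult.assoc)
    also have "\<dots> \<le> (6 * exp (- c * t) * norm (W 0))\<^sup>2"
      by (simp add: power_mult_distrib)
    finally show "norm (W t) \<le> 6 * exp (- c * t) * norm (W 0)"
      by (rule power2_le_imp_le) simp
  qed
qed

section \<open>Fourier integrals\<close>

lemma norm_vector_scalar_mult: "norm (c *s v) = cmod c * norm v" for v :: "complex ^ 'k"
  by (simp add: norm_vec_def norm_mult L2_set_right_distrib)

lemma continuous_imp_lebesgue_measurable:
  fixes f :: "real ^ 'n \<Rightarrow> 'b::topological_space"
  assumes "continuous_on UNIV f"
  shows "f \<in> borel_measurable lebesgue"
  using borel_measurable_continuous_onI[OF assms] by (simp add: measurable_completion)

text \<open>Interpolation between the trivial bound \<open>2\<close> and the Lipschitz bound \<open>|a - b|\<close>.\<close>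

lemma cis_diff_le:
  assumes "0 \<le> \<kappa>" "\<kappa> \<le> 1"
  shows "cmod (cis a - cis b) \<le> 2 * \<bar>a - b\<bar> powr \<kappa>"
proof -
  have "cis a - cis b = cis b * (cis (a - b) - 1)"
    by (simp add: algebra_simps cis_mult)
  then have eq: "cmod (cis a - cis b) = 2 * \<bar>sin ((a - b) / 2)\<bar>"
    using dist_exp_i_1[of "a - b"] by (simp add: norm_mult cis_conv_exp dist_norm)
  consider "a = b" | "a \<noteq> b" "\<bar>a - b\<bar> \<le> 1" | "\<bar>a - b\<bar> > 1" by linarith
  then show ?thesis
  proof cases
    case 1
    then show ?thesis by simp
  next
    case 2
    have "cmod (cis a - cis b) \<le> 2 * \<bar>(a - b) / 2\<bar>"
      unfolding eq by (intro mult_left_mono abs_sin_x_le_abs_x) auto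
    also have "\<dots> = \<bar>a - b\<bar> powr 1" by simp
    also have "\<dots> \<le> \<bar>a - b\<bar> powr \<kappa>"
      using 2 assms by (intro powr_mono') auto
    finally show ?thesis using powr_ge_zero[of "\<bar>a - b\<bar>" \<kappa>] by linarith
  next
    case 3
    have "1 \<le> \<bar>a - b\<bar> powr \<kappa>"
      using 3 assms by (intro ge_one_powr_ge_zero) auto
    moreover have "\<bar>sin ((a - b) / 2)\<bar> \<le> 1" by simp
    ultimately show ?thesis unfolding eq by linarith
  qed
qed

lemma fourier_kernel_measurable:
  fixes f :: "real ^ 'n \<Rightarrow> complex ^ 3"
  assumes "f \<in> borel_measurable lebesgue"
  shows "(\<lambda>x. cis (- (x \<bullet> \<xi>)) *s f x) \<in> borel_measurable lebesgue"
proof (rule borel_measurable_continuous_Pair[where H = "(*s)", OF _ assms])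
  show "(\<lambda>x. cis (- (x \<bullet> \<xi>))) \<in> borel_measurable lebesgue"
    by (intro continuous_imp_lebesgue_measurable continuous_intros)
  show "continuous_on UNIV (\<lambda>p :: complex \<times> (complex ^ 3). fst p *s snd p)"
    unfolding vector_scalar_mult_def by (intro continuous_intros)
qed

lemma fourier_kernel_integrable:
  fixes f :: "real ^ 'n \<Rightarrow> complex ^ 3"
  assumes "integrable lebesgue f"
  shows "integrable lebesgue (\<lambda>x. cis (- (x \<bullet> \<xi>)) *s f x)"
  by (rule Bochner_Integration.integrable_bound[OF assms])
    (use assms in \<open>auto intro: fourier_kernel_measurable simp: norm_vector_scalar_mult\<close>)

lemma fourier_integral_diff:
  fixes f g :: "real ^ 'n \<Rightarrow> complex ^ 3"
  assumes "integrable lebesgue f" "integrable lebesgue g"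
  shows "fourier_integral (\<lambda>x. f x - g x) \<xi> = fourier_integral f \<xi> - fourier_integral g \<xi>"
proof -
  have "(\<lambda>x. cis (- (x \<bullet> \<xi>)) *s (f x - g x))
      = (\<lambda>x. cis (- (x \<bullet> \<xi>)) *s f x - cis (- (x \<bullet> \<xi>)) *s g x)"
    by (simp add: fun_eq_iff vec_eq_iff algebra_simps)
  then show ?thesis
    unfolding fourier_integral_def
    by (simp add: fourier_kernel_integrable[OF assms(1)] fourier_kernel_integrable[OF assms(2)]
        scaleR_diff_right)
qed

lemma weighted_L1_imp_integrable:
  assumes "weighted_L1 \<kappa> f" "0 \<le> \<kappa>"
  shows "integrable lebesgue f"
proof (rule Bochner_Integration.integrable_bound)
  show "integrable lebesgue (\<lambda>x. (1 + norm x) powr \<kappa> * norm (f x))"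
    and "f \<in> borel_measurable lebesgue"
    using assms by (auto simp: weighted_L1_def)
  have "norm (f x) \<le> (1 + norm x) powr \<kappa> * norm (f x)" for x
    using ge_one_powr_ge_zero[of "1 + norm x" \<kappa>] assms
    by (intro mult_le_cancel_right1[THEN iffD2]) auto
  then show "AE x in lebesgue. norm (f x) \<le> norm ((1 + norm x) powr \<kappa> * norm (f x))"
    by (auto simp: abs_mult)
qed

text \<open>A moment of order \<open>\<kappa>\<close> makes the transform Hoelder continuous of order \<open>\<kappa>\<close>.  This is used twice:
for \<open>w\<^sub>0\<close> near the frequency \<open>0\<close>, and with \<open>\<kappa> = 1\<close> to see that transforms of truncated functions
are continuous, hence measurable.\<close>

lemma fourier_integral_Hoelder:
  fixes f :: "real ^ 'n \<Rightarrow> complex ^ 3"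
  assumes f: "weighted_L1 \<kappa> f" and \<kappa>: "0 \<le> \<kappa>" "\<kappa> \<le> 1"
  shows "norm (fourier_integral f \<xi> - fourier_integral f \<eta>)
    \<le> 2 * norm (\<xi> - \<eta>) powr \<kappa> * weighted_L1_norm \<kappa> f"
proof -
  define c where "c = (2 * pi) powr (- (real CARD('n) / 2))"
  have c: "0 \<le> c" "c \<le> 1"
    using pi_gt3 powr_mono[of "- (real CARD('n) / 2)" 0 "2 * pi"] by (auto simp: c_def)
  note int = weighted_L1_imp_integrable[OF f \<kappa>(1)]
  have bound: "norm (cis (- (x \<bullet> \<xi>)) *s f x - cis (- (x \<bullet> \<eta>)) *s f x)
      \<le> 2 * norm (\<xi> - \<eta>) powr \<kappa> * ((1 + norm x) powr \<kappa> * norm (f x))" for x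
  proof -
    have "cis (- (x \<bullet> \<xi>)) *s f x - cis (- (x \<bullet> \<eta>)) *s f x
        = (cis (- (x \<bullet> \<xi>)) - cis (- (x \<bullet> \<eta>))) *s f x"
      by (simp add: vec_eq_iff algebra_simps)
    then have "norm (cis (- (x \<bullet> \<xi>)) *s f x - cis (- (x \<bullet> \<eta>)) *s f x)
        = cmod (cis (- (x \<bullet> \<xi>)) - cis (- (x \<bullet> \<eta>))) * norm (f x)"
      by (simp only: norm_vector_scalar_mult)
    also have "\<dots> \<le> 2 * \<bar>- (x \<bullet> \<xi>) - - (x \<bullet> \<eta>)\<bar> powr \<kappa> * norm (f x)"
      using \<kappa> by (intro mult_right_mono cis_diff_le) auto
    also have "\<dots> \<le> 2 * (norm (\<xi> - \<eta>) * (1 + norm x)) powr \<kappa> * norm (f x)"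
    proof -
      have "\<bar>- (x \<bullet> \<xi>) - - (x \<bullet> \<eta>)\<bar> = \<bar>x \<bullet> (\<xi> - \<eta>)\<bar>"
        by (simp add: inner_diff_right)
      also have "\<dots> \<le> norm x * norm (\<xi> - \<eta>)" by (rule Cauchy_Schwarz_ineq2)
      also have "\<dots> \<le> norm (\<xi> - \<eta>) * (1 + norm x)" by (simp add: algebra_simps)
      finally show ?thesis
        using \<kappa> by (intro mult_right_mono mult_left_mono powr_mono2) auto
    qed
    finally show ?thesis by (simp add: powr_mult mult_ac)
  qed
  have "fourier_integral f \<xi> - fourier_integral f \<eta>
      = c *\<^sub>R (LINT x|lebesgue. cis (- (x \<bullet> \<xi>)) *s f x - cis (- (x \<bullet> \<eta>)) *s f x)"
    unfolding fourier_integral_def c_def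
    by (simp add: fourier_kernel_integrable[OF int] scaleR_diff_right)
  then have "norm (fourier_integral f \<xi> - fourier_integral f \<eta>)
      = c * norm (LINT x|lebesgue. cis (- (x \<bullet> \<xi>)) *s f x - cis (- (x \<bullet> \<eta>)) *s f x)"
    using c by simp
  also have "\<dots> \<le> norm (LINT x|lebesgue. cis (- (x \<bullet> \<xi>)) *s f x - cis (- (x \<bullet> \<eta>)) *s f x)"
    using c by (intro mult_left_le_one_le) auto
  also have "\<dots> \<le> (LINT x|lebesgue. 2 * norm (\<xi> - \<eta>) powr \<kappa> * ((1 + norm x) powr \<kappa> * norm (f x)))"
    using f bound
    by (intro Bochner_Integration.integral_norm_bound_integral Bochner_Integration.integrable_diff
        fourier_kernel_integrable[OF int]) (auto simp: weighted_L1_def)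
  finally show ?thesis by (simp add: weighted_L1_norm_def)
qed

text \<open>The transform at \<open>0\<close> is a multiple, by a factor at most \<open>1\<close>, of the total mass, and the deviation from
it is controlled by Hoelder continuity.\<close>

lemma norm_fourier_integral_le:
  fixes f :: "real ^ 'n \<Rightarrow> complex ^ 3"
  assumes f: "weighted_L1 \<kappa> f" and \<kappa>: "0 \<le> \<kappa>" "\<kappa> \<le> 1"
  shows "norm (fourier_integral f \<xi>)
    \<le> norm (total_mass f) + 2 * norm \<xi> powr \<kappa> * weighted_L1_norm \<kappa> f"
proof -
  define c where "c = (2 * pi) powr (- (real CARD('n) / 2))"
  have c: "0 \<le> c" "c \<le> 1"
    using pi_gt3 powr_mono[of "- (real CARD('n) / 2)" 0 "2 * pi"] by (auto simp: c_def)
  have "fourier_integral f 0 = c *\<^sub>R total_mass f"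
    by (simp add: fourier_integral_def total_mass_def c_def vector_scalar_mult_def)
  then have "norm (fourier_integral f 0) \<le> norm (total_mass f)"
    using c by (simp add: mult_left_le_one_le)
  moreover have "norm (fourier_integral f \<xi>)
      \<le> norm (fourier_integral f 0) + norm (fourier_integral f \<xi> - fourier_integral f 0)"
    by (rule norm_triangle_sub)
  ultimately show ?thesis
    using fourier_integral_Hoelder[OF f \<kappa>, of \<xi> 0] by simp
qed

section \<open>The Fourier transform on square-integrable fields\<close>

lemma square_integrable_diff:
  assumes f: "square_integrable f" and g: "square_integrable g"
  shows "square_integrable (\<lambda>x. f x - g x)"
  unfolding square_integrable_def
proof
  show meas: "(\<lambda>x. f x - g x) \<in> borel_measurable lebesgue"
    using f g by (auto simp: square_integrable_def)
  show "integrable lebesgue (\<lambda>x. (norm (f x - g x))\<^sup>2)"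
  proof (rule Bochner_Integration.integrable_bound)
    show "integrable lebesgue (\<lambda>x. 2 * (norm (f x))\<^sup>2 + 2 * (norm (g x))\<^sup>2)"
      using f g by (auto simp: square_integrable_def)
    show "(\<lambda>x. (norm (f x - g x))\<^sup>2) \<in> borel_measurable lebesgue"
      using meas by measurable
    have "(norm (f x - g x))\<^sup>2 \<le> 2 * (norm (f x))\<^sup>2 + 2 * (norm (g x))\<^sup>2" for x
    proof -
      have "(norm (f x - g x))\<^sup>2 \<le> (norm (f x) + norm (g x))\<^sup>2"
        by (intro power_mono norm_triangle_ineq4) auto
      then show ?thesis
        using sum_squares_bound[of "norm (f x)" "norm (g x)"] by (simp add: power2_sum)
    qed
    then show "AE x in lebesgue. norm ((norm (f x - g x))\<^sup>2)
        \<le> norm (2 * (norm (f x))\<^sup>2 + 2 * (norm (g x))\<^sup>2)"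
      by simp
  qed
qed

definition truncate :: "real \<Rightarrow> (real ^ 'n \<Rightarrow> complex ^ 3) \<Rightarrow> real ^ 'n \<Rightarrow> complex ^ 3" where
  "truncate R f x = indicator (cball 0 R) x *\<^sub>R f x"

lemma truncate_measurable:
  assumes "f \<in> borel_measurable lebesgue"
  shows "truncate R f \<in> borel_measurable lebesgue"
proof -
  have "(indicator (cball 0 R) :: real ^ 'n \<Rightarrow> real) \<in> borel_measurable lebesgue"
    by (intro borel_measurable_indicator) (simp add: borel_closed)
  then show ?thesis
    unfolding truncate_def[abs_def] using assms by (rule borel_measurable_scaleR)
qed

lemma truncate_weighted_L1:
  fixes f :: "real ^ 'n \<Rightarrow> complex ^ 3"
  assumes f: "square_integrable f"
  shows "weighted_L1 1 (truncate R f)"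
  unfolding weighted_L1_def
proof
  show meas: "truncate R f \<in> borel_measurable lebesgue"
    using f by (auto simp: square_integrable_def intro: truncate_measurable)
  show "integrable lebesgue (\<lambda>x. (1 + norm x) powr 1 * norm (truncate R f x))"
  proof (rule Bochner_Integration.integrable_bound)
    have "integrable lebesgue (indicator (cball 0 R) :: real ^ 'n \<Rightarrow> real)"
      using emeasure_lborel_cball_finite[of "0 :: real ^ 'n" R]
      by (subst integrable_indicator_iff) (auto simp: emeasure_completion)
    then show "integrable lebesgue (\<lambda>x. (1 + \<bar>R\<bar>) * (indicator (cball 0 R) x + (norm (f x))\<^sup>2))"
      using f by (auto simp: square_integrable_def)
    have "(\<lambda>x :: real ^ 'n. (1 + norm x) powr 1) \<in> borel_measurable lebesgue"
      by (intro continuous_imp_lebesgue_measurable continuous_intros)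
        (metis add_nonneg_eq_0_iff norm_ge_zero zero_le_one zero_neq_one)
    then show "(\<lambda>x. (1 + norm x) powr 1 * norm (truncate R f x)) \<in> borel_measurable lebesgue"
      using meas by measurable
    have "(1 + norm x) * norm (truncate R f x) \<le> (1 + \<bar>R\<bar>) * (indicator (cball 0 R) x + (norm (f x))\<^sup>2)" for x
    proof (cases "x \<in> cball 0 R")
      case True
      have "norm (f x) \<le> 1 + (norm (f x))\<^sup>2"
        using sum_squares_bound[of 1 "norm (f x)"] norm_ge_zero[of "f x"]
        unfolding mult_1_right power_one by linarith
      then show ?thesis
        using True by (auto simp: truncate_def intro!: mult_mono)
    qed (simp add: truncate_def)
    then show "AE x in lebesgue. norm ((1 + norm x) powr 1 * norm (truncate R f x))
        \<le> norm ((1 + \<bar>R\<bar>) * (indicator (cball 0 R) x + (norm (f x))\<^sup>2))"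
      by (auto simp: abs_mult)
  qed
qed

lemma truncated_fourier_measurable:
  fixes f :: "real ^ 'n \<Rightarrow> complex ^ 3"
  assumes f: "square_integrable f"
  shows "fourier_integral (truncate R f) \<in> borel_measurable lebesgue"
proof (rule continuous_imp_lebesgue_measurable, rule lipschitz_on_continuous_on)
  show "(2 * weighted_L1_norm 1 (truncate R f))-lipschitz_on UNIV (fourier_integral (truncate R f))"
  proof (rule lipschitz_onI)
    fix x y :: "real ^ 'n"
    show "dist (fourier_integral (truncate R f) x) (fourier_integral (truncate R f) y)
        \<le> 2 * weighted_L1_norm 1 (truncate R f) * dist x y"
      using fourier_integral_Hoelder[OF truncate_weighted_L1[OF f], of R x y]
      by (simp add: dist_norm mult_ac)
  next
    show "0 \<le> 2 * weighted_L1_norm 1 (truncate R f)"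
      unfolding weighted_L1_norm_def by (simp add: integral_nonneg_AE)
  qed
qed

lemma has_fourier_iff:
  "has_fourier f g \<longleftrightarrow> square_integrable f \<and> square_integrable g \<and>
    ((\<lambda>R. \<integral>\<^sup>+ \<xi>. ennreal ((norm (fourier_integral (truncate R f) \<xi> - g \<xi>))\<^sup>2) \<partial>lebesgue) \<longlongrightarrow> 0) at_top"
  unfolding has_fourier_def truncate_def[abs_def] ..

lemma nn_integral_square_diff_le:
  fixes u v w :: "'a \<Rightarrow> 'b::{second_countable_topology, real_normed_vector}"
  assumes [measurable]: "u \<in> borel_measurable M" "v \<in> borel_measurable M"
  shows "(\<integral>\<^sup>+ x. ennreal ((norm (u x - v x))\<^sup>2) \<partial>M)
    \<le> 2 * (\<integral>\<^sup>+ x. ennreal ((norm (u x))\<^sup>2) \<partial>M) + 2 * (\<integral>\<^sup>+ x. ennreal ((norm (v x))\<^sup>2) \<partial>M)"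
proof -
  have "(norm (u x - v x))\<^sup>2 \<le> 2 * (norm (u x))\<^sup>2 + 2 * (norm (v x))\<^sup>2" for x
  proof -
    have "(norm (u x - v x))\<^sup>2 \<le> (norm (u x) + norm (v x))\<^sup>2"
      by (intro power_mono norm_triangle_ineq4) auto
    then show ?thesis
      using sum_squares_bound[of "norm (u x)" "norm (v x)"] by (simp add: power2_sum)
  qed
  then have "ennreal ((norm (u x - v x))\<^sup>2) \<le> 2 * ennreal ((norm (u x))\<^sup>2) + 2 * ennreal ((norm (v x))\<^sup>2)" for x
    by (simp add: ennreal_leI ennreal_mult''[symmetric] ennreal_plus[symmetric] del: ennreal_plus
        flip: ennreal_numeral)
  then have "(\<integral>\<^sup>+ x. ennreal ((norm (u x - v x))\<^sup>2) \<partial>M)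
      \<le> (\<integral>\<^sup>+ x. 2 * ennreal ((norm (u x))\<^sup>2) + 2 * ennreal ((norm (v x))\<^sup>2) \<partial>M)"
    by (intro nn_integral_mono) auto
  also have "\<dots> = 2 * (\<integral>\<^sup>+ x. ennreal ((norm (u x))\<^sup>2) \<partial>M) + 2 * (\<integral>\<^sup>+ x. ennreal ((norm (v x))\<^sup>2) \<partial>M)"
    by (simp add: nn_integral_add nn_integral_cmult)
  finally show ?thesis .
qed

lemma AE_eq_if_nn_integral_square_0:
  fixes u v :: "'a \<Rightarrow> 'b::{second_countable_topology, real_normed_vector}"
  assumes [measurable]: "u \<in> borel_measurable M" "v \<in> borel_measurable M"
    and "(\<integral>\<^sup>+ x. ennreal ((norm (u x - v x))\<^sup>2) \<partial>M) = 0"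
  shows "AE x in M. u x = v x"
proof -
  have "AE x in M. ennreal ((norm (u x - v x))\<^sup>2) = 0"
    using assms(3) by (subst (asm) nn_integral_0_iff_AE) auto
  then show ?thesis by (rule AE_mp) auto
qed

lemma twice_sum_tendsto_0:
  fixes a b :: "real \<Rightarrow> ennreal"
  assumes "(a \<longlongrightarrow> 0) F" "(b \<longlongrightarrow> 0) F"
  shows "((\<lambda>R. 2 * a R + 2 * b R) \<longlongrightarrow> 0) F"
proof -
  have "((\<lambda>R. 2 * a R + 2 * b R) \<longlongrightarrow> 2 * 0 + 2 * 0) F"
    by (intro tendsto_add ennreal_tendsto_cmult assms) auto
  then show ?thesis by simp
qed

lemma tendsto_0_if_le_twice_sum:
  fixes a b c :: "real \<Rightarrow> ennreal"
  assumes le: "\<And>R. c R \<le> 2 * a R + 2 * b R" and a: "(a \<longlongrightarrow> 0) F" and b: "(b \<longlongrightarrow> 0) F"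
  shows "(c \<longlongrightarrow> 0) F"
  by (rule tendsto_sandwich[OF always_eventually always_eventually tendsto_const
        twice_sum_tendsto_0[OF a b]]) (simp_all add: le)

lemma has_fourier_unique:
  fixes f :: "real ^ 'n \<Rightarrow> complex ^ 3"
  assumes 1: "has_fourier f g1" and 2: "has_fourier f g2"
  shows "AE \<xi> in lebesgue. g1 \<xi> = g2 \<xi>"
proof (rule AE_eq_if_nn_integral_square_0)
  show [measurable]: "g1 \<in> borel_measurable lebesgue" "g2 \<in> borel_measurable lebesgue"
    using 1 2 by (auto simp: has_fourier_def square_integrable_def)
  have [measurable]: "fourier_integral (truncate R f) \<in> borel_measurable lebesgue" for R
    using 1 by (auto simp: has_fourier_def intro: truncated_fourier_measurable)
  have le: "(\<integral>\<^sup>+ \<xi>. ennreal ((norm (g1 \<xi> - g2 \<xi>))\<^sup>2) \<partial>lebesgue)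
     \<le> 2 * (\<integral>\<^sup>+ \<xi>. ennreal ((norm (fourier_integral (truncate R f) \<xi> - g2 \<xi>))\<^sup>2) \<partial>lebesgue)
     + 2 * (\<integral>\<^sup>+ \<xi>. ennreal ((norm (fourier_integral (truncate R f) \<xi> - g1 \<xi>))\<^sup>2) \<partial>lebesgue)" for R
    using nn_integral_square_diff_le[of "\<lambda>\<xi>. fourier_integral (truncate R f) \<xi> - g2 \<xi>" lebesgue
        "\<lambda>\<xi>. fourier_integral (truncate R f) \<xi> - g1 \<xi>"] by simp
  have lim: "((\<lambda>R. \<integral>\<^sup>+ \<xi>. ennreal ((norm (fourier_integral (truncate R f) \<xi> - g1 \<xi>))\<^sup>2) \<partial>lebesgue) \<longlongrightarrow> 0) at_top"
    "((\<lambda>R. \<integral>\<^sup>+ \<xi>. ennreal ((norm (fourier_integral (truncate R f) \<xi> - g2 \<xi>))\<^sup>2) \<partial>lebesgue) \<longlongrightarrow> 0) at_top"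
    using 1 2 unfolding has_fourier_iff by blast+
  have "((\<lambda>R::real. \<integral>\<^sup>+ \<xi>. ennreal ((norm (g1 \<xi> - g2 \<xi>))\<^sup>2) \<partial>lebesgue) \<longlongrightarrow> 0) at_top"
    by (rule tendsto_0_if_le_twice_sum[OF le lim(2) lim(1)])
  then show "(\<integral>\<^sup>+ \<xi>. ennreal ((norm (g1 \<xi> - g2 \<xi>))\<^sup>2) \<partial>lebesgue) = 0"
    by (simp add: tendsto_const_iff)
qed

lemma has_fourier_diff:
  fixes f1 f2 :: "real ^ 'n \<Rightarrow> complex ^ 3"
  assumes 1: "has_fourier f1 g1" and 2: "has_fourier f2 g2"
  shows "has_fourier (\<lambda>x. f1 x - f2 x) (\<lambda>\<xi>. g1 \<xi> - g2 \<xi>)"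
  unfolding has_fourier_iff
proof (intro conjI)
  have sq: "square_integrable f1" "square_integrable f2" "square_integrable g1" "square_integrable g2"
    using 1 2 by (auto simp: has_fourier_def)
  show "square_integrable (\<lambda>x. f1 x - f2 x)" "square_integrable (\<lambda>\<xi>. g1 \<xi> - g2 \<xi>)"
    using sq by (auto intro: square_integrable_diff)
  have [measurable]: "g1 \<in> borel_measurable lebesgue" "g2 \<in> borel_measurable lebesgue"
    using sq by (auto simp: square_integrable_def)
  have [measurable]: "fourier_integral (truncate R f1) \<in> borel_measurable lebesgue"
    "fourier_integral (truncate R f2) \<in> borel_measurable lebesgue" for R
    using sq by (auto intro: truncated_fourier_measurable)
  let ?I = "\<lambda>f g R. \<integral>\<^sup>+ \<xi>. ennreal ((norm (fourier_integral (truncate R f) \<xi> - g \<xi>))\<^sup>2) \<partial>lebesgue"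
  have "?I (\<lambda>x. f1 x - f2 x) (\<lambda>\<xi>. g1 \<xi> - g2 \<xi>) R \<le> 2 * ?I f1 g1 R + 2 * ?I f2 g2 R" for R
  proof -
    have "truncate R (\<lambda>x. f1 x - f2 x) = (\<lambda>x. truncate R f1 x - truncate R f2 x)"
      by (simp add: fun_eq_iff truncate_def scaleR_diff_right)
    then have "fourier_integral (truncate R (\<lambda>x. f1 x - f2 x)) \<xi>
        = fourier_integral (truncate R f1) \<xi> - fourier_integral (truncate R f2) \<xi>" for \<xi>
      using sq by (simp add: fourier_integral_diff weighted_L1_imp_integrable[OF truncate_weighted_L1])
    then have eq: "fourier_integral (truncate R (\<lambda>x. f1 x - f2 x)) \<xi> - (g1 \<xi> - g2 \<xi>)
        = (fourier_integral (truncate R f1) \<xi> - g1 \<xi>) - (fourier_integral (truncate R f2) \<xi> - g2 \<xi>)" for \<xi>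
      by simp
    show ?thesis
      unfolding eq by (rule nn_integral_square_diff_le) measurable
  qed
  moreover have "(?I f1 g1 \<longlongrightarrow> 0) at_top" "(?I f2 g2 \<longlongrightarrow> 0) at_top"
    using 1 2 unfolding has_fourier_iff by blast+
  ultimately show "(?I (\<lambda>x. f1 x - f2 x) (\<lambda>\<xi>. g1 \<xi> - g2 \<xi>) \<longlongrightarrow> 0) at_top"
    by (rule tendsto_0_if_le_twice_sum)
qed

text \<open>The transforms of the truncations converge to \<open>g\<close> in \<open>L\<^sup>2\<close> and, by dominated convergence, pointwise to
the Fourier integral of \<open>f\<close>; Fatou's lemma identifies the two limits.\<close>

lemma has_fourier_integrable:
  fixes f :: "real ^ 'n \<Rightarrow> complex ^ 3"
  assumes f: "has_fourier f g" and int: "integrable lebesgue f"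
  shows "AE \<xi> in lebesgue. fourier_integral f \<xi> = g \<xi>"
proof (rule AE_eq_if_nn_integral_square_0)
  define F where "F n = fourier_integral (truncate (real n) f)" for n
  have sq: "square_integrable f" using f by (simp add: has_fourier_def)
  have [measurable]: "F n \<in> borel_measurable lebesgue" for n
    unfolding F_def by (rule truncated_fourier_measurable[OF sq])
  show [measurable]: "g \<in> borel_measurable lebesgue"
    using f by (auto simp: has_fourier_def square_integrable_def)
  have lim: "(\<lambda>n. F n \<xi>) \<longlonglongrightarrow> fourier_integral f \<xi>" for \<xi>
    unfolding F_def fourier_integral_def
  proof (intro tendsto_scaleR tendsto_const integral_dominated_convergence[where w = "\<lambda>x. norm (f x)"])
    show "(\<lambda>x. cis (- (x \<bullet> \<xi>)) *s f x) \<in> borel_measurable lebesgue"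
      "(\<lambda>x. cis (- (x \<bullet> \<xi>)) *s truncate (real n) f x) \<in> borel_measurable lebesgue" for n
      using int by (auto intro!: fourier_kernel_measurable truncate_measurable)
    show "AE x in lebesgue. (\<lambda>n. cis (- (x \<bullet> \<xi>)) *s truncate (real n) f x)
        \<longlonglongrightarrow> cis (- (x \<bullet> \<xi>)) *s f x"
    proof (rule AE_I2)
      fix x :: "real ^ 'n"
      have "eventually (\<lambda>n. truncate (real n) f x = f x) sequentially"
        using eventually_ge_at_top[of "nat \<lceil>norm x\<rceil>"]
        by eventually_elim (auto simp: truncate_def nat_le_iff ceiling_le_iff)
      then have "eventually (\<lambda>n. cis (- (x \<bullet> \<xi>)) *s truncate (real n) f x
          = cis (- (x \<bullet> \<xi>)) *s f x) sequentially"
        by eventually_elim simp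
      then show "(\<lambda>n. cis (- (x \<bullet> \<xi>)) *s truncate (real n) f x) \<longlonglongrightarrow> cis (- (x \<bullet> \<xi>)) *s f x"
        by (rule tendsto_eventually)
    qed
    show "AE x in lebesgue. norm (cis (- (x \<bullet> \<xi>)) *s truncate (real n) f x) \<le> norm (f x)" for n
      by (rule AE_I2) (simp add: norm_vector_scalar_mult truncate_def indicator_def)
  qed (use int in auto)
  show "fourier_integral f \<in> borel_measurable lebesgue"
    by (rule borel_measurable_LIMSEQ_metric[of F]) (use lim in auto)
  have "(\<integral>\<^sup>+ \<xi>. ennreal ((norm (fourier_integral f \<xi> - g \<xi>))\<^sup>2) \<partial>lebesgue)
      = (\<integral>\<^sup>+ \<xi>. liminf (\<lambda>n. ennreal ((norm (F n \<xi> - g \<xi>))\<^sup>2)) \<partial>lebesgue)"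
  proof (rule nn_integral_cong)
    fix \<xi> :: "real ^ 'n"
    have "(\<lambda>n. ennreal ((norm (F n \<xi> - g \<xi>))\<^sup>2)) \<longlonglongrightarrow> ennreal ((norm (fourier_integral f \<xi> - g \<xi>))\<^sup>2)"
      by (intro tendsto_ennrealI tendsto_intros lim)
    then show "ennreal ((norm (fourier_integral f \<xi> - g \<xi>))\<^sup>2)
        = liminf (\<lambda>n. ennreal ((norm (F n \<xi> - g \<xi>))\<^sup>2))"
      by (intro lim_imp_Liminf[symmetric]) auto
  qed
  also have "\<dots> \<le> liminf (\<lambda>n. \<integral>\<^sup>+ \<xi>. ennreal ((norm (F n \<xi> - g \<xi>))\<^sup>2) \<partial>lebesgue)"
    by (rule nn_integral_liminf) measurable
  also have "\<dots> = 0"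
  proof -
    have "(\<lambda>n. \<integral>\<^sup>+ \<xi>. ennreal ((norm (F n \<xi> - g \<xi>))\<^sup>2) \<partial>lebesgue) \<longlonglongrightarrow> 0"
      using f filterlim_compose[OF _ filterlim_real_sequentially]
      unfolding F_def has_fourier_iff by blast
    then show ?thesis by (simp add: lim_imp_Liminf)
  qed
  finally show "(\<integral>\<^sup>+ \<xi>. ennreal ((norm (fourier_integral f \<xi> - g \<xi>))\<^sup>2) \<partial>lebesgue) = 0" by simp
qed

section \<open>Norms and integral estimates\<close>

text \<open>The hypothesis uses the nonnegative integral because \<^const>\<open>L2norm\<close> is \<open>0\<close> for a function that is not
square-integrable.\<close>

lemma L2norm_le:
  assumes G: "G \<in> borel_measurable lebesgue" and "0 \<le> B"
    and le: "(\<integral>\<^sup>+ \<xi>. ennreal ((norm (G \<xi>))\<^sup>2) \<partial>lebesgue) \<le> ennreal (B\<^sup>2)"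
  shows "square_integrable G" "L2norm G \<le> B"
proof -
  have meas: "(\<lambda>\<xi>. (norm (G \<xi>))\<^sup>2) \<in> borel_measurable lebesgue"
    using G by measurable
  have "(\<integral>\<^sup>+ \<xi>. ennreal ((norm (G \<xi>))\<^sup>2) \<partial>lebesgue) < \<infinity>"
    using le by (rule le_less_trans) simp
  then have int: "integrable lebesgue (\<lambda>\<xi>. (norm (G \<xi>))\<^sup>2)"
    using meas by (intro integrableI_nonneg) auto
  then show "square_integrable G"
    using G by (simp add: square_integrable_def)
  have "ennreal (LINT \<xi>|lebesgue. (norm (G \<xi>))\<^sup>2) \<le> ennreal (B\<^sup>2)"
    using le nn_integral_eq_integral[OF int] by simp
  then have "(LINT \<xi>|lebesgue. (norm (G \<xi>))\<^sup>2) \<le> B\<^sup>2"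
    by (simp add: ennreal_le_iff)
  then have "sqrt (LINT \<xi>|lebesgue. (norm (G \<xi>))\<^sup>2) \<le> sqrt (B\<^sup>2)"
    by (rule real_sqrt_le_mono)
  then show "L2norm G \<le> B"
    unfolding L2norm_def using \<open>0 \<le> B\<close> by simp
qed

lemma nn_integral_L2norm:
  assumes "square_integrable G"
  shows "(\<integral>\<^sup>+ \<xi>. ennreal ((norm (G \<xi>))\<^sup>2) \<partial>lebesgue) = ennreal ((L2norm G)\<^sup>2)"
proof -
  have "0 \<le> (LINT \<xi>|lebesgue. (norm (G \<xi>))\<^sup>2)"
    by (rule integral_nonneg_AE) simp
  then show ?thesis
    using assms nn_integral_eq_integral[of lebesgue "\<lambda>\<xi>. (norm (G \<xi>))\<^sup>2"]
    by (simp add: L2norm_def square_integrable_def)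
qed

lemma has_fourier_fourier: "has_fourier f g \<Longrightarrow> has_fourier f (fourier f)"
  unfolding fourier_def by (rule someI[where P = "has_fourier f"])

lemma fourier_eq_AE: "has_fourier f g \<Longrightarrow> AE \<xi> in lebesgue. fourier f \<xi> = g \<xi>"
  by (rule has_fourier_unique[OF has_fourier_fourier])

lemma abs_pow_measurable: "abs_pow a \<in> borel_measurable lebesgue"
proof (cases "a = 0")
  case False
  have "(\<lambda>\<xi> :: real ^ 'n. norm \<xi>) \<in> borel_measurable lebesgue"
    by (intro continuous_imp_lebesgue_measurable continuous_intros)
  with False show ?thesis
    unfolding abs_pow_def[abs_def] by measurable
qed (simp add: abs_pow_def[abs_def])

lemma riesz_normI:
  assumes f: "has_fourier f g" and sq: "square_integrable (\<lambda>\<xi>. abs_pow s \<xi> *\<^sub>R g \<xi>)"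
    and le: "L2norm (\<lambda>\<xi>. abs_pow s \<xi> *\<^sub>R g \<xi>) \<le> B"
  shows "riesz_space s f" "riesz_norm s f \<le> B"
proof -
  show "riesz_space s f" using f sq unfolding riesz_space_def by blast
  have [measurable]: "fourier f \<in> borel_measurable lebesgue" "g \<in> borel_measurable lebesgue"
    using f has_fourier_fourier[OF f] by (auto simp: has_fourier_def square_integrable_def)
  have [measurable]: "abs_pow s \<in> borel_measurable lebesgue" by (rule abs_pow_measurable)
  have "(LINT \<xi>|lebesgue. (norm (abs_pow s \<xi> *\<^sub>R fourier f \<xi>))\<^sup>2)
      = (LINT \<xi>|lebesgue. (norm (abs_pow s \<xi> *\<^sub>R g \<xi>))\<^sup>2)"
    by (rule integral_cong_AE) (use fourier_eq_AE[OF f] in auto)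
  then show "riesz_norm s f \<le> B"
    using le unfolding riesz_norm_def L2norm_def by simp
qed

lemma bessel_weight_measurable:
  "(\<lambda>\<xi> :: real ^ 'n. (1 + (norm \<xi>)\<^sup>2) powr r) \<in> borel_measurable lebesgue"
proof -
  have "1 + (norm \<xi>)\<^sup>2 \<noteq> 0" for \<xi> :: "real ^ 'n"
    using zero_le_power2[of "norm \<xi>"] by linarith
  then show ?thesis
    by (intro continuous_imp_lebesgue_measurable continuous_intros) auto
qed

lemma bessel_space_mono:
  assumes f: "bessel_space s f" and r: "r \<le> s"
  shows "square_integrable (\<lambda>\<xi>. (1 + (norm \<xi>)\<^sup>2) powr (r / 2) *\<^sub>R fourier f \<xi>)"
proof -
  obtain g where g: "has_fourier f g"
    and sq: "square_integrable (\<lambda>\<xi>. (1 + (norm \<xi>)\<^sup>2) powr (s / 2) *\<^sub>R g \<xi>)"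
    using f by (auto simp: bessel_space_def)
  have [measurable]: "fourier f \<in> borel_measurable lebesgue"
    using has_fourier_fourier[OF g] by (auto simp: has_fourier_def square_integrable_def)
  have meas: "(\<lambda>\<xi>. (1 + (norm \<xi>)\<^sup>2) powr (r / 2) *\<^sub>R fourier f \<xi>) \<in> borel_measurable lebesgue"
    by (intro borel_measurable_scaleR bessel_weight_measurable) measurable
  show ?thesis
    unfolding square_integrable_def
  proof
    show "integrable lebesgue (\<lambda>\<xi>. (norm ((1 + (norm \<xi>)\<^sup>2) powr (r / 2) *\<^sub>R fourier f \<xi>))\<^sup>2)"
    proof (rule Bochner_Integration.integrable_bound)
      show "integrable lebesgue (\<lambda>\<xi>. (norm ((1 + (norm \<xi>)\<^sup>2) powr (s / 2) *\<^sub>R g \<xi>))\<^sup>2)"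
        using sq by (simp add: square_integrable_def)
      show "(\<lambda>\<xi>. (norm ((1 + (norm \<xi>)\<^sup>2) powr (r / 2) *\<^sub>R fourier f \<xi>))\<^sup>2) \<in> borel_measurable lebesgue"
        using meas by measurable
      show "AE \<xi> in lebesgue. norm ((norm ((1 + (norm \<xi>)\<^sup>2) powr (r / 2) *\<^sub>R fourier f \<xi>))\<^sup>2)
          \<le> norm ((norm ((1 + (norm \<xi>)\<^sup>2) powr (s / 2) *\<^sub>R g \<xi>))\<^sup>2)"
        using fourier_eq_AE[OF g]
      proof eventually_elim
        case (elim \<xi>)
        have "(1 + (norm \<xi>)\<^sup>2) powr (r / 2) \<le> (1 + (norm \<xi>)\<^sup>2) powr (s / 2)"
          using r by (intro powr_mono) auto
        then show ?case
          using elim by (auto intro!: power_mono mult_right_mono)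
      qed
    qed
  qed fact
qed

lemma powr_mult_exp_bounded:
  fixes m c :: real
  assumes "0 \<le> m" "0 < c"
  shows "\<exists>C>0. \<forall>y>0. y powr m * exp (- c * y) \<le> C"
proof (cases "m = 0")
  case True
  then show ?thesis using assms by (intro exI[of _ 1]) auto
next
  case False
  then have m: "m > 0" using assms by simp
  have "y powr m * exp (- c * y) \<le> (m / c) powr m" if y: "y > 0" for y
  proof -
    have "ln (c * y / m) \<le> c * y / m - 1"
      using y m assms by (intro ln_le_minus_one) auto
    then have "m * ln (c * y / m) \<le> m * (c * y / m)"
      using m by (intro mult_left_mono) auto
    then have "(c * y / m) powr m \<le> exp (c * y)"
      using y m assms by (simp add: powr_def)
    moreover have "y powr m = (m / c) powr m * (c * y / m) powr m"
      using y m assms by (simp add: powr_mult[symmetric])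
    ultimately have "y powr m \<le> (m / c) powr m * exp (c * y)"
      by (simp add: mult_left_mono)
    then have "y powr m * exp (- c * y) \<le> (m / c) powr m * exp (c * y) * exp (- c * y)"
      by (intro mult_right_mono) auto
    then show ?thesis by (simp add: mult.assoc exp_add[symmetric])
  qed
  then show ?thesis using m assms by (intro exI[of _ "(m / c) powr m"]) auto
qed

text \<open>Regularity loss: the rate \<open>c r powr (- q)\<close> degenerates as \<open>r\<close> grows, and in terms of
\<open>y = r powr (- q) * (1 + t)\<close> the boundedness of \<open>y powr (l / q) * exp (- c y)\<close> converts \<open>l\<close> powers of \<open>r\<close> into
the time decay.\<close>

lemma exp_decay_le_regularity_loss:
  fixes c q l :: real
  assumes "0 < c" "0 < q" "0 \<le> l"
  shows "\<exists>C>0. \<forall>r\<ge>1. \<forall>t\<ge>0. exp (- c * r powr (- q) * t) \<le> C * r powr l * (1 + t) powr (- (l / q))"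
proof -
  obtain C where C: "C > 0" "\<And>y. y > 0 \<Longrightarrow> y powr (l / q) * exp (- c * y) \<le> C"
    using powr_mult_exp_bounded[of "l / q" c] assms by auto
  have "exp (- c * r powr (- q) * t) \<le> (exp c * C) * r powr l * (1 + t) powr (- (l / q))"
    if r: "1 \<le> r" and t: "0 \<le> t" for r t :: real
  proof -
    define y where "y = r powr (- q) * (1 + t)"
    have y: "y > 0" using r t by (simp add: y_def)
    have rq: "r powr (- q) \<le> 1"
      using r assms powr_mono[of "- q" 0 r] by simp
    have "exp (- c * r powr (- q) * t) = exp (- c * y + c * r powr (- q))"
      by (simp add: y_def algebra_simps)
    also have "\<dots> \<le> exp c * exp (- c * y)"
      using rq assms by (simp flip: exp_add add: mult_left_le)
    also have "\<dots> = exp c * (y powr (l / q) * exp (- c * y)) * y powr (- (l / q))"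
      using y by (simp add: powr_minus field_simps)
    also have "\<dots> \<le> exp c * C * y powr (- (l / q))"
      using C(2)[OF y] by (intro mult_right_mono mult_left_mono) auto
    also have "y powr (- (l / q)) = r powr l * (1 + t) powr (- (l / q))"
      using r t assms by (simp add: y_def powr_mult powr_powr)
    finally show ?thesis by (simp add: mult_ac)
  qed
  then show ?thesis using C by (intro exI[of _ "exp c * C"]) auto
qed

lemma summable_powr_exp: "summable (\<lambda>j. (real j + 1) powr M * exp (- real j))"
proof -
  obtain C where C: "C > 0" "\<And>y. y > 0 \<Longrightarrow> y powr max M 0 * exp (- (1/2) * y) \<le> C"
    using powr_mult_exp_bounded[of "max M 0" "1/2"] by auto
  have g: "summable (\<lambda>j. exp (1/2) * C * exp (- (1/2)) ^ j)"
    by (intro summable_mult summable_geometric) simp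
  show ?thesis
  proof (rule summable_comparison_test'[OF g])
    fix j :: nat
    have "(real j + 1) powr M * exp (- real j) \<le> (real j + 1) powr max M 0 * exp (- real j)"
      by (intro mult_right_mono powr_mono) auto
    also have "\<dots> = ((real j + 1) powr max M 0 * exp (- (1/2) * (real j + 1)))
        * (exp (1/2) * exp (- (1/2) * real j))"
      by (simp add: mult.assoc flip: exp_add) (simp add: algebra_simps)
    also have "\<dots> \<le> C * (exp (1/2) * exp (- (1/2) * real j))"
      by (intro mult_right_mono C(2)) auto
    also have "exp (- (1/2) * real j) = exp (- (1/2)) ^ j"
      by (simp flip: exp_of_nat_mult)
    finally show "norm ((real j + 1) powr M * exp (- real j)) \<le> exp (1/2) * C * exp (- (1/2)) ^ j"
      by (simp add: mult_ac)
  qed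
qed

lemma term_le_suminf_ennreal: "f j \<le> suminf f" for f :: "nat \<Rightarrow> ennreal"
  using sum_le_suminf[of f "{j}", OF summableI] by simp

text \<open>The substitution \<open>\<xi> = \<rho> \<eta>\<close> with \<open>\<rho> = (1 + t) powr (- (1 / p))\<close> would make the integrand independent of
time.  Instead of changing variables, the unit ball is covered by the shells
\<open>j \<rho> \<le> |\<xi>| \<le> (j + 1) \<rho>\<close>, on which the integrand is at most \<open>e ((j + 1) \<rho>)\<^sup>m exp (- j)\<close>; the sum over
\<open>j\<close> converges, and only the scaling of the volume of balls is needed.\<close>

lemma low_frequency_integral:
  fixes m p :: real
  assumes m: "0 \<le> m" and p: "1 \<le> p"
  shows "\<exists>C>0. \<forall>t\<ge>0. (\<integral>\<^sup>+ \<xi>. ennreal (indicator (cball 0 1) \<xi> *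
      (norm \<xi> powr m * exp (- (norm \<xi> powr p) * t))) \<partial>(lebesgue :: (real ^ 'n) measure))
    \<le> ennreal (C * (1 + t) powr (- ((real CARD('n) + m) / p)))"
proof -
  define n where "n = CARD('n)"
  define v where "v = unit_ball_vol (real n)"
  have v: "v > 0" by (simp add: v_def)
  define a where "a j = exp 1 * v * ((real j + 1) powr (m + real n) * exp (- real j))" for j
  have a: "summable a" "\<And>j. 0 \<le> a j"
    using v summable_powr_exp unfolding a_def by (auto intro: summable_mult)
  define C where "C = suminf a + 1"
  have C: "C > 0" using suminf_nonneg[OF a] by (simp add: C_def)
  have "(\<integral>\<^sup>+ \<xi>. ennreal (indicator (cball 0 1) \<xi> *
      (norm \<xi> powr m * exp (- (norm \<xi> powr p) * t))) \<partial>(lebesgue :: (real ^ 'n) measure))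
    \<le> ennreal (C * (1 + t) powr (- ((real CARD('n) + m) / p)))" if t: "0 \<le> t" for t
  proof -
    define \<rho> where "\<rho> = (1 + t) powr (- (1 / p))"
    have \<rho>: "\<rho> > 0" using t by (simp add: \<rho>_def)
    have \<rho>p: "\<rho> powr (- p) = 1 + t"
      using t p by (simp add: \<rho>_def powr_powr)
    define T where "T j = exp 1 * (((real j + 1) * \<rho>) powr m * exp (- real j))" for j
    have T: "T j \<ge> 0" for j by (simp add: T_def)
    define B where "B j = (cball 0 ((real j + 1) * \<rho>) :: (real ^ 'n) set)" for j
    have "(\<integral>\<^sup>+ \<xi>. ennreal (indicator (cball 0 1) \<xi> *
        (norm \<xi> powr m * exp (- (norm \<xi> powr p) * t))) \<partial>(lebesgue :: (real ^ 'n) measure))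
      \<le> (\<integral>\<^sup>+ \<xi>. (\<Sum>j. ennreal (T j) * indicator (B j) \<xi>) \<partial>lebesgue)"
    proof (rule nn_integral_mono)
      fix \<xi> :: "real ^ 'n"
      show "ennreal (indicator (cball 0 1) \<xi> * (norm \<xi> powr m * exp (- (norm \<xi> powr p) * t)))
        \<le> (\<Sum>j. ennreal (T j) * indicator (B j) \<xi>)"
      proof (cases "norm \<xi> \<le> 1")
        case True
        define j where "j = nat \<lfloor>norm \<xi> / \<rho>\<rfloor>"
        have fl: "real j \<le> norm \<xi> / \<rho>" "norm \<xi> / \<rho> < real j + 1"
          using \<rho> by (auto simp: j_def)
        then have up: "norm \<xi> \<le> (real j + 1) * \<rho>"
          using \<rho> by (simp add: field_simps)
        have "real j \<le> (norm \<xi> / \<rho>) powr p"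
        proof (cases "j = 0")
          case False
          then have "1 \<le> norm \<xi> / \<rho>" using fl by linarith
          then have "(norm \<xi> / \<rho>) powr 1 \<le> (norm \<xi> / \<rho>) powr p"
            using p by (intro powr_mono) auto
          with fl \<rho> show ?thesis by simp
        qed simp
        also have "(norm \<xi> / \<rho>) powr p = norm \<xi> powr p * (1 + t)"
          using \<rho> by (simp add: powr_divide powr_minus_divide flip: \<rho>p)
        finally have "real j \<le> norm \<xi> powr p * (1 + t)" .
        moreover have "norm \<xi> powr p \<le> 1"
          using True p powr_mono2[of p "norm \<xi>" 1] by simp
        ultimately have "- (norm \<xi> powr p) * t \<le> 1 - real j"
          by (simp add: algebra_simps)
        \<comment> \<open>Passing from \<open>t\<close> to \<open>1 + t\<close> in the exponent costs at most the factor \<open>e\<close> in the unit ball.\<close>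
        then have "exp (- (norm \<xi> powr p) * t) \<le> exp 1 * exp (- real j)"
          by (simp flip: exp_add)
        moreover have "norm \<xi> powr m \<le> ((real j + 1) * \<rho>) powr m"
          using up m by (intro powr_mono2) auto
        ultimately have "norm \<xi> powr m * exp (- (norm \<xi> powr p) * t) \<le> T j"
          unfolding T_def mult.left_commute[of "exp 1"] by (intro mult_mono) auto
        then have "ennreal (indicator (cball 0 1) \<xi> * (norm \<xi> powr m * exp (- (norm \<xi> powr p) * t)))
            \<le> ennreal (T j) * indicator (B j) \<xi>"
          using True up by (simp add: B_def ennreal_leI)
        also have "\<dots> \<le> (\<Sum>j. ennreal (T j) * indicator (B j) \<xi>)"
          by (rule term_le_suminf_ennreal)
        finally show ?thesis .
      qed simp
    qed
    also have "\<dots> = (\<Sum>j. \<integral>\<^sup>+ \<xi>. ennreal (T j) * indicator (B j) \<xi> \<partial>lebesgue)"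
      by (rule nn_integral_suminf)
        (auto intro!: borel_measurable_times_ennreal borel_measurable_indicator simp: B_def borel_closed)
    also have "\<dots> = (\<Sum>j. ennreal (\<rho> powr (m + real n) * a j))"
    proof (rule suminf_cong)
      fix j
      have "(\<integral>\<^sup>+ \<xi>. ennreal (T j) * indicator (B j) \<xi> \<partial>lebesgue) = ennreal (T j) * emeasure lebesgue (B j)"
        by (rule nn_integral_cmult_indicator) (simp add: B_def borel_closed)
      also have "emeasure lebesgue (B j) = ennreal (v * ((real j + 1) * \<rho>) ^ n)"
        using \<rho> emeasure_cball[of "(real j + 1) * \<rho>" "0 :: real ^ 'n"]
        by (simp add: B_def v_def n_def emeasure_completion borel_closed)
      also have "ennreal (T j) * \<dots> = ennreal (T j * (v * ((real j + 1) * \<rho>) ^ n))"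
        using T v \<rho> by (simp add: ennreal_mult)
      also have "T j * (v * ((real j + 1) * \<rho>) ^ n) = \<rho> powr (m + real n) * a j"
        using \<rho> by (simp add: T_def a_def powr_mult powr_add powr_realpow power_mult_distrib
            add_pos_nonneg)
      finally show "(\<integral>\<^sup>+ \<xi>. ennreal (T j) * indicator (B j) \<xi> \<partial>lebesgue)
          = ennreal (\<rho> powr (m + real n) * a j)" .
    qed
    also have "\<dots> = ennreal (\<rho> powr (m + real n) * suminf a)"
      using a by (subst suminf_ennreal2) (auto simp: suminf_mult intro: summable_mult)
    also have "\<dots> \<le> ennreal (C * (1 + t) powr (- ((real CARD('n) + m) / p)))"
    proof (rule ennreal_leI)
      have "\<rho> powr (m + real n) = (1 + t) powr (- ((real CARD('n) + m) / p))"
        using t by (simp add: \<rho>_def powr_powr n_def add.commute)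
      then show "\<rho> powr (m + real n) * suminf a \<le> C * (1 + t) powr (- ((real CARD('n) + m) / p))"
        by (simp add: C_def algebra_simps)
    qed
    finally show ?thesis .
  qed
  with C show ?thesis by blast
qed

section \<open>The estimate at a fixed frequency\<close>

definition system_matrix :: "real \<Rightarrow> real \<Rightarrow> real ^ 'n \<Rightarrow> complex ^ 3 ^ 3" where
  "system_matrix \<sigma> \<alpha> \<xi> = abs_pow \<sigma> \<xi> *\<^sub>R B0 + abs_pow (2*\<sigma>*\<alpha>) \<xi> *\<^sub>R B1"

definition int_matrix :: "real \<Rightarrow> real \<Rightarrow> real ^ 'n \<Rightarrow> complex ^ 3 ^ 3" where
  "int_matrix \<sigma> \<alpha> \<xi> =
     - (abs_pow (2*\<sigma>*\<alpha>) \<xi> *\<^sub>R diag3 0 (1/2 + \<i> * sqrt3 / 2) (1/2 - \<i> * sqrt3 / 2)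
        + abs_pow (2*\<sigma> - 2*\<sigma>*\<alpha>) \<xi> *\<^sub>R diag3 1 (- 1/2 + \<i> * sqrt3 / 6) (- 1/2 - \<i> * sqrt3 / 6))"

definition ext_matrix :: "real \<Rightarrow> real \<Rightarrow> real ^ 'n \<Rightarrow> complex ^ 3 ^ 3" where
  "ext_matrix \<sigma> \<alpha> \<xi> =
     - (abs_pow \<sigma> \<xi> *\<^sub>R diag3 (- \<i>) \<i> 0
        + abs_pow (2*\<sigma>*\<alpha>) \<xi> *\<^sub>R diag3 0 0 1
        + abs_pow (4*\<sigma>*\<alpha> - \<sigma>) \<xi> *\<^sub>R diag3 (- (\<i> / 2)) (\<i> / 2) 0
        + abs_pow (6*\<sigma>*\<alpha> - 2*\<sigma>) \<xi> *\<^sub>R diag3 (1/2) (1/2) (- 1))"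

lemma abs_pow_nonzero: "\<xi> \<noteq> 0 \<Longrightarrow> abs_pow a \<xi> = norm \<xi> powr a"
  by (simp add: abs_pow_def)

text \<open>The choices \<open>b = |\<xi>| powr (2\<sigma>\<alpha>)\<close> and \<open>h = |\<xi>| powr (\<sigma> - 2\<sigma>\<alpha>)\<close> turn the abstract estimate into one
for the symbols: \<open>b h = |\<xi>| powr \<sigma>\<close>, and \<open>b h\<^sup>2 = |\<xi>| powr (2\<sigma> - 2\<sigma>\<alpha>)\<close> is the diffusive rate.\<close>

lemma low_frequency_error:
  fixes \<sigma> \<alpha> :: real
  assumes \<delta>: "0 < \<sigma> - 2*\<sigma>*\<alpha>"
  shows "\<exists>\<epsilon>0>0. \<exists>C>0. \<epsilon>0 \<le> 1 \<and> (\<forall>(\<xi> :: real ^ 'n) W V t. \<xi> \<noteq> 0 \<and> norm \<xi> \<le> \<epsilon>0 \<and>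
    evolves (system_matrix \<sigma> \<alpha> \<xi>) W \<and> evolves (int_matrix \<sigma> \<alpha> \<xi>) V \<and>
    V 0 = matrix_inv (mat 1 + N2 \<sigma> \<alpha> \<xi>) *v (matrix_inv N1 *v W 0) \<and> 0 \<le> t \<longrightarrow>
    norm (W t - (N1 ** (mat 1 + N2 \<sigma> \<alpha> \<xi>)) *v V t)
      \<le> C * norm \<xi> powr (\<sigma> - 2*\<sigma>*\<alpha>) * exp (- (norm \<xi> powr (2*\<sigma> - 2*\<sigma>*\<alpha>)) * t / 2) * norm (W 0))"
proof -
  obtain h0 C where h0: "h0 > 0" "h0 \<le> 1" and C: "C > 0"
    and main: "\<And>h b W V t. 0 < h \<and> h \<le> h0 \<and> 0 < b \<and>
    evolves ((b * h) *\<^sub>R B0 + b *\<^sub>R B1) W \<and>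
    evolves (- (b *\<^sub>R diag3 0 (1/2 + \<i> * sqrt3 / 2) (1/2 - \<i> * sqrt3 / 2)
         + (b * h\<^sup>2) *\<^sub>R diag3 1 (- 1/2 + \<i> * sqrt3 / 6) (- 1/2 - \<i> * sqrt3 / 6))) V \<and>
    V 0 = matrix_inv (mat 1 + h *\<^sub>R N2_coeff) *v (matrix_inv N1 *v W 0) \<and> 0 \<le> t \<Longrightarrow>
    norm (W t - (N1 ** (mat 1 + h *\<^sub>R N2_coeff)) *v V t)
      \<le> C * h * exp (- (b * h\<^sup>2) * t / 2) * norm (W 0)"
    using low_frequency_estimate by blast
  define \<delta>' where "\<delta>' = \<sigma> - 2*\<sigma>*\<alpha>"
  define \<epsilon>0 where "\<epsilon>0 = h0 powr (1 / \<delta>')"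
  have \<epsilon>0: "\<epsilon>0 > 0" "\<epsilon>0 \<le> 1"
    using h0 \<delta> powr_mono2[of "1 / \<delta>'" h0 1] by (auto simp: \<epsilon>0_def \<delta>'_def)
  show ?thesis
  proof (rule exI[of _ \<epsilon>0], intro conjI \<epsilon>0, rule exI[of _ C], intro conjI C \<epsilon>0 allI impI, elim conjE)
    fix \<xi> :: "real ^ 'n" and W V and t :: real
    assume \<xi>: "\<xi> \<noteq> 0" "norm \<xi> \<le> \<epsilon>0" and W: "evolves (system_matrix \<sigma> \<alpha> \<xi>) W"
      and V: "evolves (int_matrix \<sigma> \<alpha> \<xi>) V"
      and init: "V 0 = matrix_inv (mat 1 + N2 \<sigma> \<alpha> \<xi>) *v (matrix_inv N1 *v W 0)" and t: "0 \<le> t"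
    define h b where "h = norm \<xi> powr (\<sigma> - 2*\<sigma>*\<alpha>)" and "b = norm \<xi> powr (2*\<sigma>*\<alpha>)"
    have pos: "h > 0" "b > 0" using \<xi> by (auto simp: h_def b_def)
    have "h \<le> h0"
    proof -
      have "h = norm \<xi> powr \<delta>'" by (simp add: h_def \<delta>'_def)
      also have "\<dots> \<le> \<epsilon>0 powr \<delta>'"
        using \<xi> \<delta> by (intro powr_mono2) (auto simp: \<delta>'_def)
      also have "\<dots> = h0"
        using h0 \<delta>[folded \<delta>'_def] by (simp add: \<epsilon>0_def powr_powr)
      finally show ?thesis .
    qed
    have bh: "b * h = norm \<xi> powr \<sigma>" "b * h\<^sup>2 = norm \<xi> powr (2*\<sigma> - 2*\<sigma>*\<alpha>)"
      by (simp_all add: h_def b_def power2_eq_square mult_ac flip: powr_add)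
    have N2: "N2 \<sigma> \<alpha> \<xi> = h *\<^sub>R N2_coeff"
      by (simp add: N2_def N2_coeff_def h_def abs_pow_nonzero[OF \<xi>(1)])
    have "norm (W t - (N1 ** (mat 1 + h *\<^sub>R N2_coeff)) *v V t)
      \<le> C * h * exp (- (b * h\<^sup>2) * t / 2) * norm (W 0)"
      using W V init t pos \<open>h \<le> h0\<close>
      by (intro main)
        (simp add: system_matrix_def int_matrix_def abs_pow_nonzero[OF \<xi>(1)] N2 bh
          flip: b_def)
    then show "norm (W t - (N1 ** (mat 1 + N2 \<sigma> \<alpha> \<xi>)) *v V t)
      \<le> C * norm \<xi> powr (\<sigma> - 2*\<sigma>*\<alpha>) * exp (- (norm \<xi> powr (2*\<sigma> - 2*\<sigma>*\<alpha>)) * t / 2) * norm (W 0)"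
      by (simp add: N2 bh flip: h_def)
  qed
qed

text \<open>Here \<open>a = |\<xi>| powr \<sigma>\<close> and \<open>h = |\<xi>| powr (2\<sigma>\<alpha> - \<sigma>)\<close>, so that \<open>a h\<^sup>3 = |\<xi>| powr (6\<sigma>\<alpha> - 2\<sigma>)\<close>.  The exponent is
negative because \<open>\<alpha> < 1/3\<close> in the application: the decay gets weaker at infinity.\<close>

lemma high_frequency_error:
  fixes \<sigma> \<alpha> :: real
  assumes \<delta>: "0 < \<sigma> - 2*\<sigma>*\<alpha>"
  shows "\<exists>N0\<ge>1. \<exists>C>0. \<forall>(\<xi> :: real ^ 'n) W V t. N0 \<le> norm \<xi> \<and>
    evolves (system_matrix \<sigma> \<alpha> \<xi>) W \<and> evolves (ext_matrix \<sigma> \<alpha> \<xi>) V \<and>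
    V 0 = matrix_inv (mat 1 + N5 \<sigma> \<alpha> \<xi>) *v (matrix_inv (mat 1 + N4 \<sigma> \<alpha> \<xi>) *v W 0) \<and> 0 \<le> t \<longrightarrow>
    norm (W t - ((mat 1 + N4 \<sigma> \<alpha> \<xi>) ** (mat 1 + N5 \<sigma> \<alpha> \<xi>)) *v V t)
      \<le> C * norm \<xi> powr (- (\<sigma> - 2*\<sigma>*\<alpha>)) * exp (- (1/4) * norm \<xi> powr (- (2*\<sigma>*(1 - 3*\<alpha>))) * t) * norm (W 0)"
proof -
  obtain h0 C where h0: "h0 > 0" "h0 \<le> 1" and C: "C > 0"
    and main: "\<And>h a W V t. 0 < h \<and> h \<le> h0 \<and> 0 < a \<and>
    evolves (a *\<^sub>R B0 + (a * h) *\<^sub>R B1) W \<and>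
    evolves (- (a *\<^sub>R diag3 (- \<i>) \<i> 0 + (a * h) *\<^sub>R diag3 0 0 1
         + (a * h\<^sup>2) *\<^sub>R diag3 (- (\<i> / 2)) (\<i> / 2) 0
         + (a * h^3) *\<^sub>R diag3 (1/2) (1/2) (- 1))) V \<and>
    V 0 = matrix_inv (mat 1 + h\<^sup>2 *\<^sub>R N5_coeff) *v (matrix_inv (mat 1 + h *\<^sub>R N4_coeff) *v W 0) \<and> 0 \<le> t \<Longrightarrow>
    norm (W t - ((mat 1 + h *\<^sub>R N4_coeff) ** (mat 1 + h\<^sup>2 *\<^sub>R N5_coeff)) *v V t)
      \<le> C * h * exp (- (a * h^3 / 2) * t / 2) * norm (W 0)"
    using high_frequency_estimate by blast
  define \<delta>' where "\<delta>' = \<sigma> - 2*\<sigma>*\<alpha>"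
  define N0 where "N0 = h0 powr (- (1 / \<delta>'))"
  have N0: "N0 \<ge> 1"
    using h0 \<delta> powr_mono2'[of "- (1 / \<delta>')" h0 1] by (auto simp: N0_def \<delta>'_def)
  show ?thesis
  proof (rule exI[of _ N0], intro conjI N0, rule exI[of _ C], intro conjI C allI impI, elim conjE)
    fix \<xi> :: "real ^ 'n" and W V and t :: real
    assume \<xi>N: "N0 \<le> norm \<xi>" and W: "evolves (system_matrix \<sigma> \<alpha> \<xi>) W"
      and V: "evolves (ext_matrix \<sigma> \<alpha> \<xi>) V"
      and init: "V 0 = matrix_inv (mat 1 + N5 \<sigma> \<alpha> \<xi>) *v (matrix_inv (mat 1 + N4 \<sigma> \<alpha> \<xi>) *v W 0)"
      and t: "0 \<le> t"
    have \<xi>: "\<xi> \<noteq> 0" using \<xi>N N0 by auto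
    define h a where "h = norm \<xi> powr (2*\<sigma>*\<alpha> - \<sigma>)" and "a = norm \<xi> powr \<sigma>"
    have pos: "h > 0" "a > 0" using \<xi> by (auto simp: h_def a_def)
    have "h \<le> h0"
    proof -
      have "h = norm \<xi> powr (- \<delta>')" by (simp add: h_def \<delta>'_def)
      also have "\<dots> \<le> N0 powr (- \<delta>')"
        using \<xi>N N0 \<delta> by (intro powr_mono2') (auto simp: \<delta>'_def)
      also have "\<dots> = h0"
        using h0 \<delta>[folded \<delta>'_def] by (simp add: N0_def powr_powr)
      finally show ?thesis .
    qed
    have ah: "a * h = norm \<xi> powr (2*\<sigma>*\<alpha>)" "a * h\<^sup>2 = norm \<xi> powr (4*\<sigma>*\<alpha> - \<sigma>)"
      "a * h^3 = norm \<xi> powr (6*\<sigma>*\<alpha> - 2*\<sigma>)" "h\<^sup>2 = norm \<xi> powr (4*\<sigma>*\<alpha> - 2*\<sigma>)"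
      by (simp_all add: h_def a_def power2_eq_square power3_eq_cube mult_ac flip: powr_add)
    have N4: "N4 \<sigma> \<alpha> \<xi> = h *\<^sub>R N4_coeff" and N5: "N5 \<sigma> \<alpha> \<xi> = h\<^sup>2 *\<^sub>R N5_coeff"
      unfolding ah(4)
      by (simp_all add: N4_def N4_coeff_def N5_def N5_coeff_def h_def abs_pow_nonzero[OF \<xi>])
    have "norm (W t - ((mat 1 + h *\<^sub>R N4_coeff) ** (mat 1 + h\<^sup>2 *\<^sub>R N5_coeff)) *v V t)
      \<le> C * h * exp (- (a * h^3 / 2) * t / 2) * norm (W 0)"
      using W V init t pos \<open>h \<le> h0\<close>
      unfolding system_matrix_def ext_matrix_def abs_pow_nonzero[OF \<xi>] N4 N5
      by (intro main) (simp add: ah(1-3) flip: a_def)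
    moreover have "norm \<xi> powr (- (\<sigma> - 2*\<sigma>*\<alpha>)) = h" by (simp add: h_def)
    moreover have "norm \<xi> powr (- (2*\<sigma>*(1 - 3*\<alpha>))) = a * h^3"
      unfolding ah(3) by (simp add: algebra_simps)
    ultimately show "norm (W t - ((mat 1 + N4 \<sigma> \<alpha> \<xi>) ** (mat 1 + N5 \<sigma> \<alpha> \<xi>)) *v V t)
      \<le> C * norm \<xi> powr (- (\<sigma> - 2*\<sigma>*\<alpha>)) * exp (- (1/4) * norm \<xi> powr (- (2*\<sigma>*(1 - 3*\<alpha>))) * t) * norm (W 0)"
      by (simp add: N4 N5)
  qed
qed

lemma mid_frequency_decay:
  fixes \<sigma> \<alpha> r R :: real
  assumes r: "0 < r" "r \<le> R" and "0 \<le> \<sigma>" "0 \<le> \<alpha>"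
  shows "\<exists>c>0. \<exists>C>0. \<forall>(\<xi> :: real ^ 'n) W t. r \<le> norm \<xi> \<and> norm \<xi> \<le> R \<and>
    evolves (system_matrix \<sigma> \<alpha> \<xi>) W \<and> 0 \<le> t \<longrightarrow> norm (W t) \<le> C * exp (- c * t) * norm (W 0)"
proof -
  define m where "m = min (r powr \<sigma>) (r powr (2*\<sigma>*\<alpha>))"
  define B where "B = max (R powr \<sigma>) (R powr (2*\<sigma>*\<alpha>))"
  have "m > 0" using r by (auto simp: m_def)
  then obtain c C where cC: "c > 0" "C > 0"
    and main: "\<And>a b W t. m \<le> a \<and> a \<le> B \<and> m \<le> b \<and> b \<le> B \<and>
    evolves (a *\<^sub>R B0 + b *\<^sub>R B1) W \<and> 0 \<le> t \<Longrightarrow>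
    norm (W t) \<le> C * exp (- c * t) * norm (W 0)"
    using mid_frequency_estimate[of m B] by blast
  show ?thesis
  proof (rule exI[of _ c], intro conjI cC, rule exI[of _ C], intro conjI cC allI impI, elim conjE)
    fix \<xi> :: "real ^ 'n" and W and t :: real
    assume \<xi>: "r \<le> norm \<xi>" "norm \<xi> \<le> R" and W: "evolves (system_matrix \<sigma> \<alpha> \<xi>) W" and t: "0 \<le> t"
    have \<xi>0: "\<xi> \<noteq> 0" using \<xi> r by auto
    have range: "r powr e \<le> norm \<xi> powr e" "norm \<xi> powr e \<le> R powr e" if "0 \<le> e" for e
      using \<xi> r that by (auto intro: powr_mono2)
    show "norm (W t) \<le> C * exp (- c * t) * norm (W 0)"
      using W t range[of \<sigma>] range[of "2*\<sigma>*\<alpha>"] assms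
      unfolding system_matrix_def abs_pow_nonzero[OF \<xi>0]
      by (intro main[of "norm \<xi> powr \<sigma>" "norm \<xi> powr (2*\<sigma>*\<alpha>)"])
        (auto simp: m_def B_def min_le_iff_disj le_max_iff_disj)
  qed
qed

text \<open>The cut-offs may take values outside \<open>[0, 1]\<close>, but they are continuous and constant outside a ball.\<close>

lemma cutoffs_bounded:
  assumes \<chi>: "cutoffs \<epsilon> N \<chi>int \<chi>mid \<chi>ext"
  shows "\<exists>X>0. \<forall>\<xi>. \<bar>\<chi>int \<xi>\<bar> \<le> X \<and> \<bar>\<chi>mid \<xi>\<bar> \<le> X \<and> \<bar>\<chi>ext \<xi>\<bar> \<le> X"
proof -
  define R where "R = max \<epsilon> (2 * N)"
  have bounded: "\<exists>X. \<forall>\<xi>\<in>cball 0 R. \<bar>f \<xi>\<bar> \<le> X" if "smooth f" for f :: "real ^ 'a \<Rightarrow> real"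
  proof -
    have "Ck 0 f" using that by (auto simp: smooth_def)
    then have "continuous_on (cball 0 R) f"
      by (auto intro: continuous_on_subset)
    then have "bounded (f ` cball 0 R)"
      by (intro compact_imp_bounded compact_continuous_image) auto
    then show ?thesis by (auto simp: bounded_iff)
  qed
  obtain X1 X2 X3 where X: "\<forall>\<xi>\<in>cball 0 R. \<bar>\<chi>int \<xi>\<bar> \<le> X1" "\<forall>\<xi>\<in>cball 0 R. \<bar>\<chi>mid \<xi>\<bar> \<le> X2"
    "\<forall>\<xi>\<in>cball 0 R. \<bar>\<chi>ext \<xi>\<bar> \<le> X3"
    using bounded \<chi> unfolding cutoffs_def by meson
  have out: "\<chi>int \<xi> = 0 \<and> \<chi>mid \<xi> = 0 \<and> \<chi>ext \<xi> = 1" if "\<xi> \<notin> cball 0 R" for \<xi>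
  proof -
    have "\<chi>int \<xi> = 0" "\<chi>mid \<xi> = 0"
      using that \<chi> closure_subset[of "{\<xi>. \<chi>int \<xi> \<noteq> 0}"] closure_subset[of "{\<xi>. \<chi>mid \<xi> \<noteq> 0}"]
      unfolding cutoffs_def R_def by fastforce+
    moreover have "\<chi>int \<xi> + \<chi>mid \<xi> + \<chi>ext \<xi> = 1" using \<chi> by (auto simp: cutoffs_def)
    ultimately show ?thesis by simp
  qed
  define X where "X = 1 + \<bar>X1\<bar> + \<bar>X2\<bar> + \<bar>X3\<bar>"
  have "\<bar>\<chi>int \<xi>\<bar> \<le> X \<and> \<bar>\<chi>mid \<xi>\<bar> \<le> X \<and> \<bar>\<chi>ext \<xi>\<bar> \<le> X" for \<xi>
  proof (cases "\<xi> \<in> cball 0 R")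
    case True
    then have "\<bar>\<chi>int \<xi>\<bar> \<le> X1" "\<bar>\<chi>mid \<xi>\<bar> \<le> X2" "\<bar>\<chi>ext \<xi>\<bar> \<le> X3" using X by blast+
    then show ?thesis by (auto simp: X_def)
  next
    case False
    then show ?thesis using out[OF False] by (auto simp: X_def)
  qed
  then show ?thesis by (intro exI[of _ X]) (auto simp: X_def)
qed

text \<open>The Fourier multiplier of a fractional heat semigroup with \<open>m\<close> additional powers of \<open>|\<xi>|\<close>,
localised to the unit ball.\<close>

definition low_profile :: "real \<Rightarrow> real \<Rightarrow> real \<Rightarrow> real ^ 'n \<Rightarrow> real" where
  "low_profile m p t \<xi> =
     indicator (cball 0 1) \<xi> * (norm \<xi> powr m * exp (- (norm \<xi> powr p) * t / 2))"

definition frequency_bound :: "real \<Rightarrow> real \<Rightarrow> (real ^ 'n \<Rightarrow> real) \<Rightarrow> (real ^ 'n \<Rightarrow> real) \<Rightarrow>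
    real \<Rightarrow> real \<Rightarrow> real \<Rightarrow> bool" where
  "frequency_bound \<sigma> \<alpha> \<chi>int \<chi>ext s0 l C \<longleftrightarrow>
     (\<forall>\<xi> W V1 V2 t. \<xi> \<noteq> 0 \<and> evolves (system_matrix \<sigma> \<alpha> \<xi>) W \<and>
      evolves (int_matrix \<sigma> \<alpha> \<xi>) V1 \<and> evolves (ext_matrix \<sigma> \<alpha> \<xi>) V2 \<and>
      V1 0 = matrix_inv (mat 1 + N2 \<sigma> \<alpha> \<xi>) *v (matrix_inv N1 *v W 0) \<and>
      V2 0 = matrix_inv (mat 1 + N5 \<sigma> \<alpha> \<xi>) *v (matrix_inv (mat 1 + N4 \<sigma> \<alpha> \<xi>) *v W 0) \<and> 0 \<le> t \<longrightarrow>
      abs_pow s0 \<xi> * norm (W t - \<chi>int \<xi> *\<^sub>R ((N1 ** (mat 1 + N2 \<sigma> \<alpha> \<xi>)) *v V1 t)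
          - \<chi>ext \<xi> *\<^sub>R (((mat 1 + N4 \<sigma> \<alpha> \<xi>) ** (mat 1 + N5 \<sigma> \<alpha> \<xi>)) *v V2 t))
      \<le> C * (low_profile (s0 + (\<sigma> - 2*\<sigma>*\<alpha>)) (2*\<sigma> - 2*\<sigma>*\<alpha>) t \<xi>
          + (1 + t) powr (- (l / (2*\<sigma>*(1 - 3*\<alpha>)))) * (1 + (norm \<xi>)\<^sup>2) powr ((s0 + l - (\<sigma> - 2*\<sigma>*\<alpha>)) / 2))
        * norm (W 0))"

text \<open>Since the cut-offs add up to \<open>1\<close>, the error is \<open>\<chi>int\<close> times the low-frequency error plus \<open>\<chi>mid\<close> times the
solution itself plus \<open>\<chi>ext\<close> times the high-frequency error.  The last two are both absorbed by the
term with the Bessel weight: on the support of \<open>\<chi>mid\<close> exponential decay beats any power of \<open>1 + t\<close>,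
and on that of \<open>\<chi>ext\<close> the factor \<open>h\<close> lowers the order from \<open>s0 + l\<close> to \<open>s0 + l - (\<sigma> - 2\<sigma>\<alpha>)\<close>.\<close>

lemma frequency_estimate:
  fixes \<sigma> \<alpha> :: real
  assumes \<sigma>: "1 \<le> \<sigma>" and \<alpha>: "0 \<le> \<alpha>" "\<alpha> < 1/3"
  shows "\<exists>\<epsilon>0>0. \<exists>N0>0. \<forall>\<epsilon> N. \<forall>\<chi>int \<chi>mid \<chi>ext :: real ^ 'n \<Rightarrow> real. \<forall>s0 l.
    0 < \<epsilon> \<and> \<epsilon> \<le> \<epsilon>0 \<and> N0 \<le> N \<and> cutoffs \<epsilon> N \<chi>int \<chi>mid \<chi>ext \<and> 0 \<le> s0 \<and> 0 \<le> l \<and>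
    0 \<le> s0 + l - (\<sigma> - 2*\<sigma>*\<alpha>) \<longrightarrow> (\<exists>C>0. frequency_bound \<sigma> \<alpha> \<chi>int \<chi>ext s0 l C)"
proof -
  define \<delta> where "\<delta> = \<sigma> - 2*\<sigma>*\<alpha>"
  have "\<sigma> * (1 - 2 * \<alpha>) > 0" using \<sigma> \<alpha> by (intro mult_pos_pos) auto
  then have \<delta>: "\<delta> > 0" by (simp add: \<delta>_def algebra_simps)
  define q where "q = 2*\<sigma>*(1 - 3*\<alpha>)"
  have q: "q > 0" using \<sigma> \<alpha> by (simp add: q_def)
  obtain \<epsilon>0 C1 where \<epsilon>0: "\<epsilon>0 > 0" "\<epsilon>0 \<le> 1" and C1: "C1 > 0"
    and low: "\<And>(\<xi> :: real ^ 'n) W V t. \<xi> \<noteq> 0 \<and> norm \<xi> \<le> \<epsilon>0 \<and>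
    evolves (system_matrix \<sigma> \<alpha> \<xi>) W \<and> evolves (int_matrix \<sigma> \<alpha> \<xi>) V \<and>
    V 0 = matrix_inv (mat 1 + N2 \<sigma> \<alpha> \<xi>) *v (matrix_inv N1 *v W 0) \<and> 0 \<le> t \<Longrightarrow>
    norm (W t - (N1 ** (mat 1 + N2 \<sigma> \<alpha> \<xi>)) *v V t)
      \<le> C1 * norm \<xi> powr \<delta> * exp (- (norm \<xi> powr (2*\<sigma> - 2*\<sigma>*\<alpha>)) * t / 2) * norm (W 0)"
    using low_frequency_error[OF \<delta>[unfolded \<delta>_def], where 'n = 'n] unfolding \<delta>_def by blast
  obtain N0 C3 where N0: "N0 \<ge> 1" and C3: "C3 > 0"
    and high: "\<And>(\<xi> :: real ^ 'n) W V t. N0 \<le> norm \<xi> \<and>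
    evolves (system_matrix \<sigma> \<alpha> \<xi>) W \<and> evolves (ext_matrix \<sigma> \<alpha> \<xi>) V \<and>
    V 0 = matrix_inv (mat 1 + N5 \<sigma> \<alpha> \<xi>) *v (matrix_inv (mat 1 + N4 \<sigma> \<alpha> \<xi>) *v W 0) \<and> 0 \<le> t \<Longrightarrow>
    norm (W t - ((mat 1 + N4 \<sigma> \<alpha> \<xi>) ** (mat 1 + N5 \<sigma> \<alpha> \<xi>)) *v V t)
      \<le> C3 * norm \<xi> powr (- \<delta>) * exp (- (1/4) * norm \<xi> powr (- q) * t) * norm (W 0)"
    using high_frequency_error[OF \<delta>[unfolded \<delta>_def], where 'n = 'n] unfolding \<delta>_def q_def by blast
  show ?thesis
    unfolding \<delta>_def[symmetric] q_def[symmetric]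
  proof (rule exI[of _ \<epsilon>0], intro conjI \<epsilon>0, rule exI[of _ N0], intro conjI allI impI; (elim conjE)?)
    show "0 < N0" using N0 by simp
    fix \<epsilon> N and \<chi>int \<chi>mid \<chi>ext :: "real ^ 'n \<Rightarrow> real" and s0 l :: real
    assume \<epsilon>: "0 < \<epsilon>" "\<epsilon> \<le> \<epsilon>0" and N: "N0 \<le> N" and \<chi>: "cutoffs \<epsilon> N \<chi>int \<chi>mid \<chi>ext"
      and s0: "0 \<le> s0" and l: "0 \<le> l" and reg: "0 \<le> s0 + l - \<delta>"
    obtain X where X: "X > 0" "\<And>\<xi>. \<bar>\<chi>int \<xi>\<bar> \<le> X" "\<And>\<xi>. \<bar>\<chi>mid \<xi>\<bar> \<le> X" "\<And>\<xi>. \<bar>\<chi>ext \<xi>\<bar> \<le> X"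
      using cutoffs_bounded[OF \<chi>] by blast
    have supp: "\<chi>int \<xi> \<noteq> 0 \<Longrightarrow> norm \<xi> \<le> \<epsilon>" "\<chi>mid \<xi> \<noteq> 0 \<Longrightarrow> \<epsilon> / 2 \<le> norm \<xi> \<and> norm \<xi> \<le> 2 * N"
      "\<chi>ext \<xi> \<noteq> 0 \<Longrightarrow> N \<le> norm \<xi>" for \<xi>
      using \<chi> closure_subset[of "{\<xi>. \<chi>int \<xi> \<noteq> 0}"] closure_subset[of "{\<xi>. \<chi>mid \<xi> \<noteq> 0}"]
        closure_subset[of "{\<xi>. \<chi>ext \<xi> \<noteq> 0}"] unfolding cutoffs_def by blast+
    obtain c C2 where cC2: "c > 0" "C2 > 0"
      and mid: "\<And>(\<xi> :: real ^ 'n) W t. \<epsilon> / 2 \<le> norm \<xi> \<and> norm \<xi> \<le> 2 * N \<and>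
        evolves (system_matrix \<sigma> \<alpha> \<xi>) W \<and> 0 \<le> t \<Longrightarrow> norm (W t) \<le> C2 * exp (- c * t) * norm (W 0)"
      using mid_frequency_decay[of "\<epsilon> / 2" "2 * N" \<sigma> \<alpha>, where 'n = 'n] \<epsilon> \<epsilon>0 N0 N \<sigma> \<alpha> by auto
    obtain D2 where D2: "D2 > 0" "\<And>r t. 1 \<le> r \<Longrightarrow> 0 \<le> t \<Longrightarrow>
        exp (- c * r powr (- q) * t) \<le> D2 * r powr l * (1 + t) powr (- (l / q))"
      using exp_decay_le_regularity_loss[OF cC2(1) q l] by blast
    obtain D3 where D3: "D3 > 0" "\<And>r t. 1 \<le> r \<Longrightarrow> 0 \<le> t \<Longrightarrow>
        exp (- (1/4) * r powr (- q) * t) \<le> D3 * r powr l * (1 + t) powr (- (l / q))"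
      using exp_decay_le_regularity_loss[OF _ q l, of "1/4"] by auto
    define C where "C = X * C1 + (2 * N) powr s0 * X * C2 * D2 + X * C3 * D3"
    have "C > 0"
      unfolding C_def using X(1) C1 C3 cC2 D2 D3 by (simp add: add_pos_nonneg)
    show "\<exists>C>0. frequency_bound \<sigma> \<alpha> \<chi>int \<chi>ext s0 l C"
      unfolding frequency_bound_def \<delta>_def[symmetric] q_def[symmetric]
    proof (rule exI[of _ C], intro conjI \<open>C > 0\<close> allI impI, elim conjE)
      fix \<xi> :: "real ^ 'n" and W V1 V2 and t :: real
      assume \<xi>: "\<xi> \<noteq> 0" and W: "evolves (system_matrix \<sigma> \<alpha> \<xi>) W"
        and V1: "evolves (int_matrix \<sigma> \<alpha> \<xi>) V1" and V2: "evolves (ext_matrix \<sigma> \<alpha> \<xi>) V2"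
        and i1: "V1 0 = matrix_inv (mat 1 + N2 \<sigma> \<alpha> \<xi>) *v (matrix_inv N1 *v W 0)"
        and i2: "V2 0 = matrix_inv (mat 1 + N5 \<sigma> \<alpha> \<xi>) *v (matrix_inv (mat 1 + N4 \<sigma> \<alpha> \<xi>) *v W 0)"
        and t: "0 \<le> t"
      define r where "r = norm \<xi>"
      have r: "r > 0" using \<xi> by (simp add: r_def)
      define e1 where "e1 = W t - (N1 ** (mat 1 + N2 \<sigma> \<alpha> \<xi>)) *v V1 t"
      define e2 where "e2 = W t - ((mat 1 + N4 \<sigma> \<alpha> \<xi>) ** (mat 1 + N5 \<sigma> \<alpha> \<xi>)) *v V2 t"
      define L where "L = low_profile (s0 + \<delta>) (2*\<sigma> - 2*\<sigma>*\<alpha>) t \<xi>"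
      define H where "H = (1 + t) powr (- (l / q)) * (1 + r\<^sup>2) powr ((s0 + l - \<delta>) / 2)"
      define w where "w = norm (W 0)"
      have nonneg: "0 \<le> L" "0 \<le> H" "0 \<le> w" by (simp_all add: L_def low_profile_def H_def w_def)
      have weight: "1 \<le> (1 + r\<^sup>2) powr ((s0 + l - \<delta>) / 2)"
        using reg by (intro ge_one_powr_ge_zero) auto
      have I: "r powr s0 * norm (\<chi>int \<xi> *\<^sub>R e1) \<le> X * C1 * L * w"
      proof (cases "\<chi>int \<xi> = 0")
        case True
        then show ?thesis using nonneg X(1) C1 by simp
      next
        case False
        then have small: "r \<le> \<epsilon>0" using supp(1)[OF False] \<epsilon> by (simp add: r_def)
        have "norm e1 \<le> C1 * r powr \<delta> * exp (- (r powr (2*\<sigma> - 2*\<sigma>*\<alpha>)) * t / 2) * w"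
          unfolding e1_def r_def w_def using \<xi> W V1 i1 t small by (intro low) (auto simp: r_def)
        then have "r powr s0 * (\<bar>\<chi>int \<xi>\<bar> * norm e1)
            \<le> r powr s0 * (X * (C1 * r powr \<delta> * exp (- (r powr (2*\<sigma> - 2*\<sigma>*\<alpha>)) * t / 2) * w))"
          using X(1,2) by (intro mult_left_mono mult_mono) auto
        also have "\<dots> = X * C1 * L * w"
          using small \<epsilon>0 by (simp add: L_def low_profile_def powr_add r_def)
        finally show ?thesis by simp
      qed
      have M: "r powr s0 * norm (\<chi>mid \<xi> *\<^sub>R W t) \<le> (2 * N) powr s0 * X * C2 * D2 * H * w"
      proof (cases "\<chi>mid \<xi> = 0")
        case True
        then show ?thesis using nonneg X(1) cC2 D2(1) by simp
      next
        case False
        have ex: "exp (- c * t) \<le> D2 * H"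
        proof -
          have "exp (- c * t) \<le> D2 * (1 + t) powr (- (l / q)) * 1"
            using D2(2)[of 1 t] t by simp
          also have "\<dots> \<le> D2 * (1 + t) powr (- (l / q)) * (1 + r\<^sup>2) powr ((s0 + l - \<delta>) / 2)"
            using weight D2(1) by (intro mult_left_mono) auto
          finally show ?thesis by (simp add: H_def)
        qed
        have "norm (W t) \<le> C2 * exp (- c * t) * w"
          unfolding w_def using supp(2)[OF False] W t by (intro mid) auto
        also have "\<dots> \<le> C2 * (D2 * H) * w"
          using ex cC2 nonneg by (intro mult_right_mono mult_left_mono) auto
        finally have "r powr s0 * (\<bar>\<chi>mid \<xi>\<bar> * norm (W t)) \<le> (2 * N) powr s0 * (X * (C2 * (D2 * H) * w))"
          using X(1,3) supp(2)[OF False] r s0 nonneg cC2 D2(1)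
          by (intro mult_mono powr_mono2) (auto simp: r_def)
        then show ?thesis by (simp add: mult_ac)
      qed
      have E: "r powr s0 * norm (\<chi>ext \<xi> *\<^sub>R e2) \<le> X * C3 * D3 * H * w"
      proof (cases "\<chi>ext \<xi> = 0")
        case True
        then show ?thesis using nonneg X(1) C3 D3(1) by simp
      next
        case False
        then have large: "N0 \<le> r" using supp(3)[OF False] N by (simp add: r_def)
        then have r1: "1 \<le> r" using N0 by simp
        have "norm e2 \<le> C3 * r powr (- \<delta>) * exp (- (1/4) * r powr (- q) * t) * w"
          unfolding e2_def r_def w_def using W V2 i2 t large by (intro high) (auto simp: r_def)
        also have "\<dots> \<le> C3 * r powr (- \<delta>) * (D3 * r powr l * (1 + t) powr (- (l / q))) * w"
          using D3(2)[OF r1 t] C3 nonneg by (intro mult_right_mono mult_left_mono) auto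
        finally have "r powr s0 * (\<bar>\<chi>ext \<xi>\<bar> * norm e2)
            \<le> r powr s0 * (X * (C3 * r powr (- \<delta>) * (D3 * r powr l * (1 + t) powr (- (l / q))) * w))"
          using X(1,4) by (intro mult_left_mono mult_mono) auto
        also have "\<dots> = X * C3 * D3 * (1 + t) powr (- (l / q)) * w * r powr (s0 + l - \<delta>)"
          using r by (simp add: powr_add powr_diff powr_minus field_simps)
        also have "\<dots> \<le> X * C3 * D3 * (1 + t) powr (- (l / q)) * w * (1 + r\<^sup>2) powr ((s0 + l - \<delta>) / 2)"
        proof (rule mult_left_mono)
          have "r powr e = (r\<^sup>2) powr (e / 2)" for e
            using r by (simp add: powr_powr powr_numeral[symmetric] del: powr_numeral)
          then have "r powr (s0 + l - \<delta>) = (r\<^sup>2) powr ((s0 + l - \<delta>) / 2)" .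
          also have "\<dots> \<le> (1 + r\<^sup>2) powr ((s0 + l - \<delta>) / 2)"
            using reg by (intro powr_mono2) auto
          finally show "r powr (s0 + l - \<delta>) \<le> (1 + r\<^sup>2) powr ((s0 + l - \<delta>) / 2)" .
        qed (use X(1) C3 D3(1) nonneg in auto)
        finally show ?thesis by (simp add: H_def mult_ac)
      qed
      have split: "W t - \<chi>int \<xi> *\<^sub>R ((N1 ** (mat 1 + N2 \<sigma> \<alpha> \<xi>)) *v V1 t)
          - \<chi>ext \<xi> *\<^sub>R (((mat 1 + N4 \<sigma> \<alpha> \<xi>) ** (mat 1 + N5 \<sigma> \<alpha> \<xi>)) *v V2 t)
        = \<chi>int \<xi> *\<^sub>R e1 + \<chi>mid \<xi> *\<^sub>R W t + \<chi>ext \<xi> *\<^sub>R e2"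
      proof -
        have "W t = (\<chi>int \<xi> + \<chi>mid \<xi> + \<chi>ext \<xi>) *\<^sub>R W t"
          using \<chi> by (simp add: cutoffs_def)
        also have "\<dots> = \<chi>int \<xi> *\<^sub>R W t + \<chi>mid \<xi> *\<^sub>R W t + \<chi>ext \<xi> *\<^sub>R W t"
          by (simp add: scaleR_add_left)
        finally show ?thesis
          unfolding e1_def e2_def scaleR_diff_right by (simp add: algebra_simps)
      qed
      have "r powr s0 * norm (\<chi>int \<xi> *\<^sub>R e1 + \<chi>mid \<xi> *\<^sub>R W t + \<chi>ext \<xi> *\<^sub>R e2)
          \<le> r powr s0 * (norm (\<chi>int \<xi> *\<^sub>R e1) + norm (\<chi>mid \<xi> *\<^sub>R W t) + norm (\<chi>ext \<xi> *\<^sub>R e2))"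
        by (intro mult_left_mono order.trans[OF norm_triangle_ineq] add_right_mono norm_triangle_ineq) auto
      also have "\<dots> \<le> X * C1 * L * w + (2 * N) powr s0 * X * C2 * D2 * H * w + X * C3 * D3 * H * w"
        using I M E by (simp add: distrib_left)
      also have "\<dots> \<le> C * (L + H) * w"
      proof -
        have "0 \<le> X * C1 * H * w" "0 \<le> ((2 * N) powr s0 * X * C2 * D2 + X * C3 * D3) * L * w"
          using X(1) C1 C3 cC2 D2(1) D3(1) nonneg by auto
        then show ?thesis by (simp add: C_def algebra_simps)
      qed
      finally show "abs_pow s0 \<xi> * norm (W t - \<chi>int \<xi> *\<^sub>R ((N1 ** (mat 1 + N2 \<sigma> \<alpha> \<xi>)) *v V1 t)
          - \<chi>ext \<xi> *\<^sub>R (((mat 1 + N4 \<sigma> \<alpha> \<xi>) ** (mat 1 + N5 \<sigma> \<alpha> \<xi>)) *v V2 t))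
        \<le> C * (low_profile (s0 + \<delta>) (2*\<sigma> - 2*\<sigma>*\<alpha>) t \<xi>
          + (1 + t) powr (- (l / q)) * (1 + (norm \<xi>)\<^sup>2) powr ((s0 + l - \<delta>) / 2))
        * norm (W 0)"
        unfolding split L_def H_def w_def r_def abs_pow_nonzero[OF \<xi>] .
    qed
  qed
qed

section \<open>Integration over the frequencies\<close>

lemma solves_fourier_system_evolves:
  "solves_fourier_system A V0 V \<longleftrightarrow>
    (AE \<xi> in lebesgue. V 0 \<xi> = V0 \<xi> \<and> evolves (A \<xi>) (\<lambda>t. V t \<xi>))"
  by (simp add: solves_fourier_system_def evolves_def)

lemma AE_lebesgue_nonzero: "AE \<xi> in lebesgue. \<xi> \<noteq> (0 :: real ^ 'n)"
  by (rule AE_completion) (rule AE_lborel_singleton)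

lemma low_profile_measurable: "low_profile m p t \<in> borel_measurable lebesgue"
proof -
  have [measurable]: "(\<lambda>\<xi> :: real ^ 'n. norm \<xi>) \<in> borel_measurable lebesgue"
    by (intro continuous_imp_lebesgue_measurable continuous_intros)
  have [measurable]: "(indicator (cball 0 1) :: real ^ 'n \<Rightarrow> real) \<in> borel_measurable lebesgue"
    by (intro borel_measurable_indicator) (simp add: borel_closed)
  show ?thesis unfolding low_profile_def[abs_def] by measurable
qed

text \<open>Squaring doubles \<open>m\<close> and restores the full rate \<open>|\<xi>| powr p\<close>.\<close>

lemma low_profile_L2:
  fixes m p :: real
  assumes "0 \<le> m" "1 \<le> p"
  shows "\<exists>C>0. \<forall>t\<ge>0. (\<integral>\<^sup>+ \<xi>. ennreal ((low_profile m p t \<xi>)\<^sup>2) \<partial>(lebesgue :: (real ^ 'n) measure))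
    \<le> ennreal (C * ((1 + t) powr (- ((real CARD('n) + 2 * m) / (2 * p))))\<^sup>2)"
proof -
  have sq: "(low_profile m p t \<xi>)\<^sup>2
      = indicator (cball 0 1) \<xi> * (norm \<xi> powr (2 * m) * exp (- (norm \<xi> powr p) * t))"
    for \<xi> :: "real ^ 'n" and t
  proof -
    have "(norm \<xi> powr m)\<^sup>2 = norm \<xi> powr (2 * m)"
      by (simp add: power2_eq_square flip: powr_add)
    moreover have "(exp (- (norm \<xi> powr p) * t / 2))\<^sup>2 = exp (- (norm \<xi> powr p) * t)"
      by (simp add: power2_eq_square flip: exp_add)
    ultimately show ?thesis
      by (simp add: low_profile_def power_mult_distrib indicator_def)
  qed
  have time: "((1 + t) powr (- ((real CARD('n) + 2 * m) / (2 * p))))\<^sup>2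
      = (1 + t) powr (- ((real CARD('n) + 2 * m) / p))" for t
  proof -
    have "- (x / (2 * p)) + - (x / (2 * p)) = - (x / p)" for x
      using assms by (simp add: field_simps)
    then show ?thesis by (simp only: power2_eq_square powr_add[symmetric])
  qed
  show ?thesis
    unfolding sq time using low_frequency_integral[of "2 * m" p, where 'n = 'n] assms by simp
qed

lemma L2_bound_sum3:
  fixes G :: "real ^ 'n \<Rightarrow> complex ^ 3" and f1 f2 f3 :: "real ^ 'n \<Rightarrow> real"
  assumes G: "G \<in> borel_measurable lebesgue"
    and meas: "f1 \<in> borel_measurable lebesgue" "f2 \<in> borel_measurable lebesgue" "f3 \<in> borel_measurable lebesgue"
    and le: "AE \<xi> in lebesgue. norm (G \<xi>) \<le> f1 \<xi> + f2 \<xi> + f3 \<xi>"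
    and int: "(\<integral>\<^sup>+ \<xi>. ennreal ((f1 \<xi>)\<^sup>2) \<partial>lebesgue) \<le> ennreal (a1\<^sup>2)"
      "(\<integral>\<^sup>+ \<xi>. ennreal ((f2 \<xi>)\<^sup>2) \<partial>lebesgue) \<le> ennreal (a2\<^sup>2)"
      "(\<integral>\<^sup>+ \<xi>. ennreal ((f3 \<xi>)\<^sup>2) \<partial>lebesgue) \<le> ennreal (a3\<^sup>2)"
    and nonneg: "0 \<le> a1" "0 \<le> a2" "0 \<le> a3"
  shows "square_integrable G" "L2norm G \<le> 2 * (a1 + a2 + a3)"
proof -
  have [measurable]: "f1 \<in> borel_measurable lebesgue" "f2 \<in> borel_measurable lebesgue"
    "f3 \<in> borel_measurable lebesgue" by fact+
  have "(\<integral>\<^sup>+ \<xi>. ennreal ((norm (G \<xi>))\<^sup>2) \<partial>lebesgue)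
      \<le> (\<integral>\<^sup>+ \<xi>. 3 * (ennreal ((f1 \<xi>)\<^sup>2) + ennreal ((f2 \<xi>)\<^sup>2) + ennreal ((f3 \<xi>)\<^sup>2)) \<partial>lebesgue)"
  proof (rule nn_integral_mono_AE)
    show "AE \<xi> in lebesgue. ennreal ((norm (G \<xi>))\<^sup>2)
        \<le> 3 * (ennreal ((f1 \<xi>)\<^sup>2) + ennreal ((f2 \<xi>)\<^sup>2) + ennreal ((f3 \<xi>)\<^sup>2))"
      using le
    proof eventually_elim
      case (elim \<xi>)
      have "(norm (G \<xi>))\<^sup>2 \<le> (f1 \<xi> + f2 \<xi> + f3 \<xi>)\<^sup>2"
        using elim by (intro power_mono) auto
      also have "\<dots> \<le> 3 * ((f1 \<xi>)\<^sup>2 + (f2 \<xi>)\<^sup>2 + (f3 \<xi>)\<^sup>2)"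
        using sum_squares_bound[of "f1 \<xi>" "f2 \<xi>"] sum_squares_bound[of "f1 \<xi>" "f3 \<xi>"]
          sum_squares_bound[of "f2 \<xi>" "f3 \<xi>"]
        by (simp add: power2_eq_square algebra_simps)
      finally have "ennreal ((norm (G \<xi>))\<^sup>2) \<le> ennreal (3 * ((f1 \<xi>)\<^sup>2 + (f2 \<xi>)\<^sup>2 + (f3 \<xi>)\<^sup>2))"
        by (rule ennreal_leI)
      then show ?case by (simp add: ennreal_mult)
    qed
  qed
  also have "\<dots> = 3 * ((\<integral>\<^sup>+ \<xi>. ennreal ((f1 \<xi>)\<^sup>2) \<partial>lebesgue) + (\<integral>\<^sup>+ \<xi>. ennreal ((f2 \<xi>)\<^sup>2) \<partial>lebesgue)
      + (\<integral>\<^sup>+ \<xi>. ennreal ((f3 \<xi>)\<^sup>2) \<partial>lebesgue))"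
    by (simp add: nn_integral_cmult nn_integral_add)
  also have "\<dots> \<le> 3 * (ennreal (a1\<^sup>2) + ennreal (a2\<^sup>2) + ennreal (a3\<^sup>2))"
    by (intro mult_left_mono add_mono int) auto
  also have "\<dots> = ennreal (3 * (a1\<^sup>2 + a2\<^sup>2 + a3\<^sup>2))"
    by (simp add: ennreal_mult)
  also have "\<dots> \<le> ennreal ((2 * (a1 + a2 + a3))\<^sup>2)"
  proof (rule ennreal_leI)
    have "0 \<le> a1 * a2" "0 \<le> a1 * a3" "0 \<le> a2 * a3" using nonneg by simp_all
    then show "3 * (a1\<^sup>2 + a2\<^sup>2 + a3\<^sup>2) \<le> (2 * (a1 + a2 + a3))\<^sup>2"
      using zero_le_power2[of a1] zero_le_power2[of a2] zero_le_power2[of a3]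
      by (simp add: power2_eq_square algebra_simps)
  qed
  finally have "(\<integral>\<^sup>+ \<xi>. ennreal ((norm (G \<xi>))\<^sup>2) \<partial>lebesgue) \<le> ennreal ((2 * (a1 + a2 + a3))\<^sup>2)" .
  from L2norm_le[OF G _ this] nonneg
  show "square_integrable G" "L2norm G \<le> 2 * (a1 + a2 + a3)" by auto
qed

theorem theorem4p1:
  fixes \<sigma> \<alpha> :: real
  assumes "\<sigma> \<ge> 1" and "0 \<le> \<alpha>" and "\<alpha> < 1/3"
  shows "\<exists>\<epsilon>0>0. \<exists>N0>0. \<forall>\<epsilon> N. \<forall>\<chi>int \<chi>mid \<chi>ext :: real ^ 'n \<Rightarrow> real.
    0 < \<epsilon> \<and> \<epsilon> \<le> \<epsilon>0 \<and> N0 \<le> N \<and> cutoffs \<epsilon> N \<chi>int \<chi>mid \<chi>ext \<longrightarrow>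
    (\<forall>s \<kappa> s0 l :: real.
      0 \<le> s \<and> 0 \<le> \<kappa> \<and> \<kappa> \<le> 1 \<and> 0 \<le> s0 \<and> 0 \<le> l \<and>
      0 \<le> s0 + l - (\<sigma> - 2*\<sigma>*\<alpha>) \<and> s0 + l - (\<sigma> - 2*\<sigma>*\<alpha>) \<le> s \<longrightarrow>
      (\<exists>C>0. \<forall>(w0 :: real ^ 'n \<Rightarrow> complex ^ 3) w Sint Sext.
        bessel_space s w0 \<and> weighted_L1 \<kappa> w0 \<and> is_solution \<sigma> \<alpha> w0 w \<and>
        profile_int \<sigma> \<alpha> \<chi>int w0 Sint \<and> profile_ext \<sigma> \<alpha> \<chi>ext w0 Sext \<longrightarrow>
        (\<forall>t\<ge>0.
          riesz_space s0 (\<lambda>x. w t x - Sint t x - Sext t x) \<and>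
          riesz_norm s0 (\<lambda>x. w t x - Sint t x - Sext t x)
          \<le> C * ((1 + t) powr (- ((real CARD('n) + 2 * (s0 + \<kappa>)) / (2 * (2*\<sigma> - 2*\<sigma>*\<alpha>)))
                                 - (1 - 2*\<alpha>) / (2 * (1 - \<alpha>)))
                  * weighted_L1_norm \<kappa> w0
               + (1 + t) powr (- (l / (2*\<sigma>*(1 - 3*\<alpha>))))
                  * bessel_norm (s0 + l - (\<sigma> - 2*\<sigma>*\<alpha>)) w0
               + (1 + t) powr (- ((real CARD('n) + 2 * s0) / (2 * (2*\<sigma> - 2*\<sigma>*\<alpha>)))
                                 - (1 - 2*\<alpha>) / (2 * (1 - \<alpha>)))
                  * norm (total_mass w0)))))"
proof -
  define \<delta> p q where "\<delta> = \<sigma> - 2*\<sigma>*\<alpha>" and "p = 2*\<sigma> - 2*\<sigma>*\<alpha>" and "q = 2*\<sigma>*(1 - 3*\<alpha>)"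
  have "1 * 1 \<le> \<sigma> * (2 - 2 * \<alpha>)"
    using assms by (intro mult_mono) auto
  then have p: "1 \<le> p" by (simp add: p_def algebra_simps)
  have "0 < \<sigma> * (1 - 2 * \<alpha>)"
    using assms by (intro mult_pos_pos) auto
  then have \<delta>: "0 < \<delta>" by (simp add: \<delta>_def algebra_simps)
  \<comment> \<open>One additional factor \<open>|\<xi>| powr \<delta>\<close> against the heat kernel of order \<open>p\<close> yields this decay.\<close>
  have gain: "(1 - 2*\<alpha>) / (2 * (1 - \<alpha>)) = \<delta> / p"
    using assms by (simp add: \<delta>_def p_def field_simps)
  obtain \<epsilon>0 N0 where \<epsilon>0: "\<epsilon>0 > 0" and N0: "N0 > 0"
    and freq: "\<forall>\<epsilon> N. \<forall>\<chi>int \<chi>mid \<chi>ext :: real ^ 'n \<Rightarrow> real. \<forall>s0 l.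
      0 < \<epsilon> \<and> \<epsilon> \<le> \<epsilon>0 \<and> N0 \<le> N \<and> cutoffs \<epsilon> N \<chi>int \<chi>mid \<chi>ext \<and> 0 \<le> s0 \<and> 0 \<le> l \<and>
      0 \<le> s0 + l - \<delta> \<longrightarrow> (\<exists>C>0. frequency_bound \<sigma> \<alpha> \<chi>int \<chi>ext s0 l C)"
    using frequency_estimate[OF assms, where 'n = 'n, folded \<delta>_def]
    by (elim exE conjE) (rule that)
  show ?thesis
    unfolding gain \<delta>_def[symmetric] p_def[symmetric] q_def[symmetric]
  proof (rule exI[of _ \<epsilon>0], intro conjI \<epsilon>0, rule exI[of _ N0], intro conjI N0 allI impI, elim conjE)
    fix \<epsilon> N and \<chi>int \<chi>mid \<chi>ext :: "real ^ 'n \<Rightarrow> real" and s \<kappa> s0 l :: real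
    assume \<chi>: "0 < \<epsilon>" "\<epsilon> \<le> \<epsilon>0" "N0 \<le> N" "cutoffs \<epsilon> N \<chi>int \<chi>mid \<chi>ext"
      and s: "0 \<le> s" and \<kappa>: "0 \<le> \<kappa>" "\<kappa> \<le> 1" and s0: "0 \<le> s0" and l: "0 \<le> l"
      and reg: "0 \<le> s0 + l - \<delta>" "s0 + l - \<delta> \<le> s"
    define Lo :: "real \<Rightarrow> real \<Rightarrow> real ^ 'n \<Rightarrow> real" where "Lo m = low_profile m p" for m
    have Lo0: "0 \<le> Lo m t \<xi>" for m t and \<xi> :: "real ^ 'n" by (simp add: Lo_def low_profile_def)
    have Lo_meas: "Lo m t \<in> borel_measurable lebesgue" for m t
      unfolding Lo_def by (rule low_profile_measurable)
    obtain C where C: "C > 0" and "frequency_bound \<sigma> \<alpha> \<chi>int \<chi>ext s0 l C"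
      using freq[rule_format, of \<epsilon> N \<chi>int \<chi>mid \<chi>ext s0 l] \<chi> s0 l reg by blast
    note bound = this(2)[unfolded frequency_bound_def, folded \<delta>_def p_def q_def, folded Lo_def, rule_format]
    obtain C1 where C1: "C1 > 0" "\<And>t. t \<ge> 0 \<Longrightarrow> (\<integral>\<^sup>+ \<xi>. ennreal ((Lo (s0 + \<delta>) t \<xi>)\<^sup>2) \<partial>lebesgue)
        \<le> ennreal (C1 * ((1 + t) powr (- ((real CARD('n) + 2 * (s0 + \<delta>)) / (2 * p))))\<^sup>2)"
      using low_profile_L2[of "s0 + \<delta>" p, where 'n = 'n] s0 \<delta> p unfolding Lo_def by auto
    obtain C2 where C2: "C2 > 0" "\<And>t. t \<ge> 0 \<Longrightarrow> (\<integral>\<^sup>+ \<xi>. ennreal ((Lo (s0 + \<delta> + \<kappa>) t \<xi>)\<^sup>2) \<partial>lebesgue)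
        \<le> ennreal (C2 * ((1 + t) powr (- ((real CARD('n) + 2 * (s0 + \<delta> + \<kappa>)) / (2 * p))))\<^sup>2)"
      using low_profile_L2[of "s0 + \<delta> + \<kappa>" p, where 'n = 'n] s0 \<delta> p \<kappa> unfolding Lo_def by auto
    define K where "K = 2 * C * (sqrt C1 + 2 * sqrt C2 + 1)"
    have K: "K > 0" using C C1 C2 by (simp add: K_def add_pos_pos)
    show "\<exists>C>0. \<forall>(w0 :: real ^ 'n \<Rightarrow> complex ^ 3) w Sint Sext.
        bessel_space s w0 \<and> weighted_L1 \<kappa> w0 \<and> is_solution \<sigma> \<alpha> w0 w \<and>
        profile_int \<sigma> \<alpha> \<chi>int w0 Sint \<and> profile_ext \<sigma> \<alpha> \<chi>ext w0 Sext \<longrightarrow>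
        (\<forall>t\<ge>0.
          riesz_space s0 (\<lambda>x. w t x - Sint t x - Sext t x) \<and>
          riesz_norm s0 (\<lambda>x. w t x - Sint t x - Sext t x)
          \<le> C * ((1 + t) powr (- ((real CARD('n) + 2 * (s0 + \<kappa>)) / (2 * p)) - \<delta> / p)
                  * weighted_L1_norm \<kappa> w0
               + (1 + t) powr (- (l / q)) * bessel_norm (s0 + l - \<delta>) w0
               + (1 + t) powr (- ((real CARD('n) + 2 * s0) / (2 * p)) - \<delta> / p)
                  * norm (total_mass w0)))"
    proof (rule exI[of _ K], intro conjI[OF K] allI impI, elim conjE)
      fix w0 :: "real ^ 'n \<Rightarrow> complex ^ 3" and w Sint Sext and t :: real
      assume w0: "bessel_space s w0" "weighted_L1 \<kappa> w0" and w: "is_solution \<sigma> \<alpha> w0 w"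
        and Sint: "profile_int \<sigma> \<alpha> \<chi>int w0 Sint" and Sext: "profile_ext \<sigma> \<alpha> \<chi>ext w0 Sext"
        and t: "0 \<le> t"
      obtain W where W: "AE \<xi> in lebesgue. W 0 \<xi> = fourier w0 \<xi> \<and> evolves (system_matrix \<sigma> \<alpha> \<xi>) (\<lambda>t. W t \<xi>)"
        and wW: "has_fourier (w t) (W t)"
        using w t unfolding is_solution_def solves_fourier_system_evolves system_matrix_def[symmetric]
        by blast
      define Q1 where "Q1 \<xi> = N1 ** (mat 1 + N2 \<sigma> \<alpha> \<xi>)" for \<xi> :: "real ^ 'n"
      define Q2 where "Q2 \<xi> = (mat 1 + N4 \<sigma> \<alpha> \<xi>) ** (mat 1 + N5 \<sigma> \<alpha> \<xi>)" for \<xi> :: "real ^ 'n"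
      obtain V1 where V1: "AE \<xi> in lebesgue.
          V1 0 \<xi> = matrix_inv (mat 1 + N2 \<sigma> \<alpha> \<xi>) *v (matrix_inv N1 *v fourier w0 \<xi>) \<and>
          evolves (int_matrix \<sigma> \<alpha> \<xi>) (\<lambda>t. V1 t \<xi>)"
        and SV1: "has_fourier (Sint t) (\<lambda>\<xi>. \<chi>int \<xi> *\<^sub>R (Q1 \<xi> *v V1 t \<xi>))"
        using Sint t unfolding profile_int_def reference_int_def solves_fourier_system_evolves
          int_matrix_def[symmetric] Q1_def by blast
      obtain V2 where V2: "AE \<xi> in lebesgue.
          V2 0 \<xi> = matrix_inv (mat 1 + N5 \<sigma> \<alpha> \<xi>) *v (matrix_inv (mat 1 + N4 \<sigma> \<alpha> \<xi>) *v fourier w0 \<xi>) \<and>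
          evolves (ext_matrix \<sigma> \<alpha> \<xi>) (\<lambda>t. V2 t \<xi>)"
        and SV2: "has_fourier (Sext t) (\<lambda>\<xi>. \<chi>ext \<xi> *\<^sub>R (Q2 \<xi> *v V2 t \<xi>))"
        using Sext t unfolding profile_ext_def reference_ext_def solves_fourier_system_evolves
          ext_matrix_def[symmetric] Q2_def by blast
      define G where "G \<xi> = W t \<xi> - \<chi>int \<xi> *\<^sub>R (Q1 \<xi> *v V1 t \<xi>) - \<chi>ext \<xi> *\<^sub>R (Q2 \<xi> *v V2 t \<xi>)" for \<xi>
      have G: "has_fourier (\<lambda>x. w t x - Sint t x - Sext t x) G"
        unfolding G_def[abs_def] by (intro has_fourier_diff wW SV1 SV2)
      define P where "P = norm (total_mass w0)"
      define X where "X = weighted_L1_norm \<kappa> w0"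
      define b where "b = bessel_norm (s0 + l - \<delta>) w0"
      define Tq where "Tq = (1 + t) powr (- (l / q))"
      define T1 where "T1 = (1 + t) powr (- ((real CARD('n) + 2 * (s0 + \<kappa>)) / (2 * p)) - \<delta> / p)"
      define T3 where "T3 = (1 + t) powr (- ((real CARD('n) + 2 * s0) / (2 * p)) - \<delta> / p)"
      have T1: "T1 = (1 + t) powr (- ((real CARD('n) + 2 * (s0 + \<delta> + \<kappa>)) / (2 * p)))"
        and T3: "T3 = (1 + t) powr (- ((real CARD('n) + 2 * (s0 + \<delta>)) / (2 * p)))"
        unfolding T1_def T3_def using p by (auto simp: field_simps intro!: arg_cong[where f = "\<lambda>e. (1 + t) powr e"])
      have "0 \<le> X"
        unfolding X_def weighted_L1_norm_def by (rule integral_nonneg_AE) simp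
      moreover have "0 \<le> b"
        unfolding b_def bessel_norm_def L2norm_def by (simp add: integral_nonneg_AE)
      ultimately have nonneg: "0 \<le> P" "0 \<le> X" "0 \<le> b" "0 \<le> Tq" "0 \<le> T1" "0 \<le> T3"
        by (simp_all add: P_def Tq_def T1_def T3_def)
      define B where "B \<xi> = (1 + (norm \<xi>)\<^sup>2) powr ((s0 + l - \<delta>) / 2) *\<^sub>R fourier w0 \<xi>" for \<xi> :: "real ^ 'n"
      have B: "square_integrable B"
        unfolding B_def[abs_def] by (rule bessel_space_mono[OF w0(1) reg(2)])
      have bB: "b = L2norm B"
        unfolding b_def B_def[abs_def] bessel_norm_def ..
      have Bmeas: "B \<in> borel_measurable lebesgue" using B by (simp add: square_integrable_def)
      have f0: "has_fourier w0 (fourier w0)"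
        using w0(1) has_fourier_fourier by (auto simp: bessel_space_def)
      \<comment> \<open>Total mass, moment of order \<open>\<kappa>\<close> and Sobolev regularity: one summand for each of the three
        terms of the claim.\<close>
      define f1 f2 f3 where "f1 \<xi> = C * P * Lo (s0 + \<delta>) t \<xi>"
        and "f2 \<xi> = 2 * C * X * Lo (s0 + \<delta> + \<kappa>) t \<xi>"
        and "f3 \<xi> = C * Tq * norm (B \<xi>)" for \<xi> :: "real ^ 'n"
      have le: "AE \<xi> in lebesgue. norm (abs_pow s0 \<xi> *\<^sub>R G \<xi>) \<le> f1 \<xi> + f2 \<xi> + f3 \<xi>"
        using W V1 V2 AE_lebesgue_nonzero
          has_fourier_integrable[OF f0 weighted_L1_imp_integrable[OF w0(2) \<kappa>(1)]]
      proof eventually_elim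
        case (elim \<xi>)
        have pos: "0 \<le> abs_pow s0 \<xi>" by (simp add: abs_pow_def)
        have "abs_pow s0 \<xi> * norm (G \<xi>) \<le> C * (Lo (s0 + \<delta>) t \<xi>
            + Tq * (1 + (norm \<xi>)\<^sup>2) powr ((s0 + l - \<delta>) / 2)) * norm (W 0 \<xi>)"
          unfolding G_def Q1_def Q2_def Tq_def by (rule bound) (use elim t in auto)
        also have "\<dots> = C * Lo (s0 + \<delta>) t \<xi> * norm (W 0 \<xi>) + f3 \<xi>"
          using elim by (simp add: f3_def B_def algebra_simps)
        also have "C * Lo (s0 + \<delta>) t \<xi> * norm (W 0 \<xi>)
            \<le> C * Lo (s0 + \<delta>) t \<xi> * (P + 2 * norm \<xi> powr \<kappa> * X)"
          using norm_fourier_integral_le[OF w0(2) \<kappa>, of \<xi>] elim C Lo0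
          by (intro mult_left_mono) (auto simp: P_def X_def)
        also have "\<dots> = f1 \<xi> + f2 \<xi>"
          using elim by (simp add: f1_def f2_def Lo_def low_profile_def powr_add algebra_simps)
        finally show ?case using pos by simp
      qed
      have int1: "(\<integral>\<^sup>+ \<xi>. ennreal ((f1 \<xi>)\<^sup>2) \<partial>lebesgue) \<le> ennreal ((C * P * (sqrt C1 * T3))\<^sup>2)"
        and int2: "(\<integral>\<^sup>+ \<xi>. ennreal ((f2 \<xi>)\<^sup>2) \<partial>lebesgue) \<le> ennreal ((2 * C * X * (sqrt C2 * T1))\<^sup>2)"
        and int3: "(\<integral>\<^sup>+ \<xi>. ennreal ((f3 \<xi>)\<^sup>2) \<partial>lebesgue) \<le> ennreal ((C * Tq * b)\<^sup>2)"
      proof -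
        have scale: "(\<integral>\<^sup>+ \<xi>. ennreal ((c * f \<xi>)\<^sup>2) \<partial>lebesgue) \<le> ennreal ((c * a)\<^sup>2)"
          if "f \<in> borel_measurable lebesgue" "(\<integral>\<^sup>+ \<xi>. ennreal ((f \<xi>)\<^sup>2) \<partial>lebesgue) \<le> ennreal (a\<^sup>2)"
          for c a and f :: "real ^ 'n \<Rightarrow> real"
        proof -
          have "(\<integral>\<^sup>+ \<xi>. ennreal ((c * f \<xi>)\<^sup>2) \<partial>lebesgue) = ennreal (c\<^sup>2) * (\<integral>\<^sup>+ \<xi>. ennreal ((f \<xi>)\<^sup>2) \<partial>lebesgue)"
            using that(1) by (simp add: power_mult_distrib ennreal_mult nn_integral_cmult)
          also have "\<dots> \<le> ennreal (c\<^sup>2) * ennreal (a\<^sup>2)"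
            by (intro mult_left_mono that(2)) auto
          finally show ?thesis by (simp add: power_mult_distrib ennreal_mult)
        qed
        show "(\<integral>\<^sup>+ \<xi>. ennreal ((f1 \<xi>)\<^sup>2) \<partial>lebesgue) \<le> ennreal ((C * P * (sqrt C1 * T3))\<^sup>2)"
          unfolding f1_def using C1 t by (intro scale Lo_meas) (simp add: power_mult_distrib T3)
        show "(\<integral>\<^sup>+ \<xi>. ennreal ((f2 \<xi>)\<^sup>2) \<partial>lebesgue) \<le> ennreal ((2 * C * X * (sqrt C2 * T1))\<^sup>2)"
          unfolding f2_def using C2 t by (intro scale Lo_meas) (simp add: power_mult_distrib T1)
        show "(\<integral>\<^sup>+ \<xi>. ennreal ((f3 \<xi>)\<^sup>2) \<partial>lebesgue) \<le> ennreal ((C * Tq * b)\<^sup>2)"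
          unfolding f3_def bB using Bmeas nn_integral_L2norm[OF B] by (intro scale) auto
      qed
      have meas: "f1 \<in> borel_measurable lebesgue" "f2 \<in> borel_measurable lebesgue"
        "f3 \<in> borel_measurable lebesgue"
        unfolding f1_def[abs_def] f2_def[abs_def] f3_def[abs_def]
        using Bmeas Lo_meas by (auto intro!: borel_measurable_times)
      have Gmeas: "(\<lambda>\<xi>. abs_pow s0 \<xi> *\<^sub>R G \<xi>) \<in> borel_measurable lebesgue"
        using G by (auto simp: has_fourier_def square_integrable_def
            intro!: borel_measurable_scaleR abs_pow_measurable)
      have n: "0 \<le> C * P * (sqrt C1 * T3)" "0 \<le> 2 * C * X * (sqrt C2 * T1)" "0 \<le> C * Tq * b"
        using C C1 C2 nonneg by auto
      note L2 = L2_bound_sum3[OF Gmeas meas le int1 int2 int3 n]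
      have "L2norm (\<lambda>\<xi>. abs_pow s0 \<xi> *\<^sub>R G \<xi>)
          \<le> 2 * (C * P * (sqrt C1 * T3) + 2 * C * X * (sqrt C2 * T1) + C * Tq * b)"
        by (rule L2(2))
      also have "\<dots> = 2 * C * sqrt C1 * (T3 * P) + 2 * C * (2 * sqrt C2) * (T1 * X) + 2 * C * 1 * (Tq * b)"
        by (simp add: algebra_simps)
      also have "\<dots> \<le> K * (T3 * P) + K * (T1 * X) + K * (Tq * b)"
        unfolding K_def using C C1 C2 nonneg
        by (intro add_mono mult_right_mono mult_left_mono) auto
      also have "\<dots> = K * (T1 * X + Tq * b + T3 * P)"
        by (simp add: algebra_simps)
      finally have final: "L2norm (\<lambda>\<xi>. abs_pow s0 \<xi> *\<^sub>R G \<xi>) \<le> K * (T1 * X + Tq * b + T3 * P)" .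
      from riesz_normI[OF G L2(1) final]
      show "riesz_space s0 (\<lambda>x. w t x - Sint t x - Sext t x) \<and>
          riesz_norm s0 (\<lambda>x. w t x - Sint t x - Sext t x)
          \<le> K * ((1 + t) powr (- ((real CARD('n) + 2 * (s0 + \<kappa>)) / (2 * p)) - \<delta> / p)
                  * weighted_L1_norm \<kappa> w0
               + (1 + t) powr (- (l / q)) * bessel_norm (s0 + l - \<delta>) w0
               + (1 + t) powr (- ((real CARD('n) + 2 * s0) / (2 * p)) - \<delta> / p)
                  * norm (total_mass w0))"
        unfolding T1_def Tq_def T3_def X_def b_def P_def by (rule conjI)
    qed
  qed
qed

end
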